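(* Let $\rho^{A_1\ldots A_mE}$ be an $(m+1)$-partite quantum state and for each $j\in[m]$ let $M^j=\{M^j_{x_j}\}_{x_j\in\mathcal{X}_j}$ be a POVM on $A_j$. Define $$\omega'=\sum_{x_1,\ldots,x_m}|x_{[m]}\rangle\langle x_{[m]}|^{X_{[m]}}\otimes\mathrm{Tr}_{A_1\ldots A_m}\big[\rho^{A_1\ldots A_mE}(M^1_{x_1}\otimes\cdots\otimes M^m_{x_m}\otimes\mathbb{1}_E)\big].$$ Let $\mathcal{R}_{\mathrm{c}}$ be the set of rate tuples $R_{[m]}=(R_1,\ldots,R_m)$ such that for every $I\subsetneq[m]$, $\sum_{j\in I}R_j\ge H(X_I|X_{[m]\setminus I})_{\omega'}$, and let $R^{\mathrm{c}}_{\mathrm{CO}}=\min_{R_{[m]}\in\mathcal{R}_{\mathrm{c}}}\sum_{i=1}^mR_i$. Then $$K_{\mathrm{n.i.}}(\rho)\ \ge\ S(X_{[m]}|E)_{\omega'}-R^{\mathrm{c}}_{\mathrm{CO}}.$$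
   Context: Notation: $[m]=\{1,\ldots,m\}$; $X_I=(X_j:j\in I)$; $H$ is Shannon (conditional) entropy of the joint distribution $p(x_{[m]})=\mathrm{Tr}\,\rho(M^1_{x_1}\otimes\cdots\otimes M^m_{x_m}\otimes\mathbb{1}_E)$; $S(A|B)=S(AB)-S(B)$ with von Neumann entropy $S$; $\log$ base 2. Non-interactive secret key agreement: $m$ legitimate players and an eavesdropper share $n$ copies $\rho^{\otimes n}$, player $j$ holding $A_j^n$ and the eavesdropper $E^n$. A protocol consists of (1) for each player $j$ an instrument $\{\mathcal{E}^{(j)}_{\ell_j}\}_{\ell_j\in\mathcal{L}_j}$ of completely positive maps $A_j^n\to A_j'$ summing to a trace-preserving map, with $|\mathcal{L}_j|\le 2^{nR_j}$ for some constants $R_j$; player $j$ applies it and publicly broadcasts $\ell_j$ (the eavesdropper receives a copy of all messages); (2) for each $j$ and each tuple $\ell_{[m]}$ a POVM $(D^{(j,\ell_{[m]})}_{k_j})_{k_j\in\mathcal{K}}$ on $A_j'$, whose outcome $k_j$ is player $j$'s key. The resulting state is $$\Omega^{K_1\ldots K_mL_{[m]}E^n}=\sum_{k_{[m]},\ell_{[m]}}|k_1\rangle\langle k_1|\otimes\cdots\otimes|k_m\rangle\langle k_m|\otimes|\ell_{[m]}\rangle\langle\ell_{[m]}|\otimes\mathrm{Tr}_{A'_{[m]}}\Big[\big((\textstyle\bigotimes_j\mathcal{E}^{(j)}_{\ell_j})\otimes\mathrm{id}_{E^n}\big)(\rho^{\otimes n})\,\big(\textstyle\bigotimes_j D^{(j,\ell_{[m]})}_{k_j}\otimes\mathbb{1}_{E^n}\big)\Big].$$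 It is an $(n,\varepsilon)$-protocol if $\Pr\{K_1=\cdots=K_m\}\ge1-\varepsilon$ and $\frac12\|\Omega^{K_1L_{[m]}E^n}-u_{K_1}\otimes\tau_0^{L_{[m]}E^n}\|_1\le\varepsilon$ for some fixed state $\tau_0$, where $u_{K_1}=\frac1{|\mathcal{K}|}\sum_{k}|k\rangle\langle k|$. $R$ is achievable if for all $n$ there are $(n,\varepsilon_n)$-protocols with $\varepsilon_n\to0$ and $\frac1n\log|\mathcal{K}|\to R$. The non-interactive secret-key capacity is $K_{\mathrm{n.i.}}(\rho)=\sup\{R: R\text{ achievable}\}$. *)

theory Defs
  imports "Jordan_Normal_Form.Char_Poly" "HOL-Library.Extended_Real"
begin

text \<open>Operators on a d-dimensional Hilbert space are complex d x d matrices (JNF type complex mat).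
  Tensor products use the Kronecker convention: the first factor is the most significant
  digit of the (mixed-radix) basis index.\<close>

fun mr_dec :: "nat list \<Rightarrow> nat \<Rightarrow> nat list" where
  "mr_dec [] i = []"
| "mr_dec (d # ds) i = (i div prod_list ds) # mr_dec ds (i mod prod_list ds)"

fun mr_enc :: "nat list \<Rightarrow> nat list \<Rightarrow> nat" where
  "mr_enc [] xs = 0"
| "mr_enc (d # ds) xs = hd xs * prod_list ds + mr_enc ds (tl xs)"

definition tuples :: "nat list \<Rightarrow> nat list set" where
  "tuples ns = {xs. length xs = length ns \<and> (\<forall>j<length ns. xs ! j < ns ! j)}"

definition mtrace :: "complex mat \<Rightarrow> complex" where
  "mtrace A = (\<Sum>i<dim_row A. A $$ (i, i))"

definition adj :: "complex mat \<Rightarrow> complex mat" where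
  "adj A = mat (dim_col A) (dim_row A) (\<lambda>(i, j). cnj (A $$ (j, i)))"

definition msum :: "nat \<Rightarrow> nat \<Rightarrow> ('i \<Rightarrow> complex mat) \<Rightarrow> 'i set \<Rightarrow> complex mat" where
  "msum r c f S = mat r c (\<lambda>(i, j). \<Sum>x\<in>S. f x $$ (i, j))"

definition tensor_list :: "complex mat list \<Rightarrow> complex mat" where
  "tensor_list As = (let rs = map dim_row As; cs = map dim_col As in
     mat (prod_list rs) (prod_list cs)
       (\<lambda>(i, j). \<Prod>t<length As. (As ! t) $$ (mr_dec rs i ! t, mr_dec cs j ! t)))"

definition ptrace_first :: "nat \<Rightarrow> complex mat \<Rightarrow> complex mat" where
  "ptrace_first dA M = (let dB = dim_row M div dA in
     mat dB dB (\<lambda>(i, j). \<Sum>a<dA. M $$ (a * dB + i, a * dB + j)))"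

text \<open>Classical-quantum block-diagonal operator  sum_c |c><c| (x) f c.\<close>
definition cq_op :: "nat \<Rightarrow> nat \<Rightarrow> (nat \<Rightarrow> complex mat) \<Rightarrow> complex mat" where
  "cq_op dc dq f = mat (dc * dq) (dc * dq)
     (\<lambda>(i, j). if i div dq = j div dq then f (i div dq) $$ (i mod dq, j mod dq) else 0)"

definition psd :: "complex mat \<Rightarrow> bool" where
  "psd A \<longleftrightarrow> A \<in> carrier_mat (dim_row A) (dim_row A) \<and> adj A = A \<and>
     (\<forall>v \<in> carrier_vec (dim_row A). 0 \<le> Re (\<Sum>i<dim_row A. cnj (v $ i) * (A *\<^sub>v v) $ i))"

definition density :: "nat \<Rightarrow> complex mat \<Rightarrow> bool" where
  "density d \<rho> \<longleftrightarrow> \<rho> \<in> carrier_mat d d \<and> psd \<rho> \<and> mtrace \<rho> = 1"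

definition povm :: "nat \<Rightarrow> nat \<Rightarrow> (nat \<Rightarrow> complex mat) \<Rightarrow> bool" where
  "povm d N M \<longleftrightarrow> (\<forall>x<N. M x \<in> carrier_mat d d \<and> psd (M x)) \<and> msum d d M {..<N} = 1\<^sub>m d"

definition eta :: "real \<Rightarrow> real" where
  "eta x = (if x \<le> 0 then 0 else x * log 2 x)"

definition spec_sum :: "(complex \<Rightarrow> real) \<Rightarrow> complex mat \<Rightarrow> real" where
  "spec_sum f A = (\<Sum>z\<in>{z. poly (char_poly A) z = 0}. real (order z (char_poly A)) * f z)"

definition vn_entropy :: "complex mat \<Rightarrow> real" where
  "vn_entropy A = - spec_sum (\<lambda>z. eta (Re z)) A"

definition trace_norm :: "complex mat \<Rightarrow> real" where
  "trace_norm A = spec_sum (\<lambda>z. sqrt (Re z)) (adj A * A)"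

text \<open>ds = [d_1,...,d_m] dimensions of A_1..A_m, dE dimension of E, rho on A_1..A_m E,
  Ns = [|X_1|,...,|X_m|], M j x = M^(j+1)_x (players indexed 0..m-1).\<close>

definition meas_tensor :: "nat list \<Rightarrow> nat \<Rightarrow> (nat \<Rightarrow> nat \<Rightarrow> complex mat) \<Rightarrow> nat list \<Rightarrow> complex mat" where
  "meas_tensor ds dE M x = tensor_list (map (\<lambda>j. M j (x ! j)) [0..<length ds] @ [1\<^sub>m dE])"

definition cq_block :: "nat list \<Rightarrow> nat \<Rightarrow> complex mat \<Rightarrow> (nat \<Rightarrow> nat \<Rightarrow> complex mat) \<Rightarrow> nat list \<Rightarrow> complex mat" where
  "cq_block ds dE \<rho> M x = ptrace_first (prod_list ds) (\<rho> * meas_tensor ds dE M x)"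

definition joint_prob :: "nat list \<Rightarrow> nat \<Rightarrow> complex mat \<Rightarrow> (nat \<Rightarrow> nat \<Rightarrow> complex mat) \<Rightarrow> nat list \<Rightarrow> real" where
  "joint_prob ds dE \<rho> M x = Re (mtrace (\<rho> * meas_tensor ds dE M x))"

definition omega_XE :: "nat list \<Rightarrow> nat \<Rightarrow> complex mat \<Rightarrow> nat list \<Rightarrow> (nat \<Rightarrow> nat \<Rightarrow> complex mat) \<Rightarrow> complex mat" where
  "omega_XE ds dE \<rho> Ns M = cq_op (prod_list Ns) dE (\<lambda>c. cq_block ds dE \<rho> M (mr_dec Ns c))"

definition cond_vn_XE :: "nat list \<Rightarrow> nat \<Rightarrow> complex mat \<Rightarrow> nat list \<Rightarrow> (nat \<Rightarrow> nat \<Rightarrow> complex mat) \<Rightarrow> real" where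
  "cond_vn_XE ds dE \<rho> Ns M =
     vn_entropy (omega_XE ds dE \<rho> Ns M)
     - vn_entropy (ptrace_first (prod_list Ns) (omega_XE ds dE \<rho> Ns M))"

definition restr :: "nat set \<Rightarrow> nat list \<Rightarrow> nat list" where
  "restr J x = map (\<lambda>j. if j \<in> J then x ! j else 0) [0..<length x]"

definition shannon_marg :: "nat list \<Rightarrow> (nat list \<Rightarrow> real) \<Rightarrow> nat set \<Rightarrow> real" where
  "shannon_marg Ns p J = - (\<Sum>y \<in> restr J ` tuples Ns.
      eta (\<Sum>x \<in> {x \<in> tuples Ns. restr J x = y}. p x))"

definition shannon_cond :: "nat list \<Rightarrow> (nat list \<Rightarrow> real) \<Rightarrow> nat set \<Rightarrow> nat set \<Rightarrow> real" where
  "shannon_cond Ns p I J = shannon_marg Ns p (I \<union> J) - shannon_marg Ns p J"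

definition rate_region_CO :: "nat \<Rightarrow> nat list \<Rightarrow> (nat list \<Rightarrow> real) \<Rightarrow> (nat \<Rightarrow> real) set" where
  "rate_region_CO m Ns p = {R. \<forall>I. I \<subset> {..<m} \<longrightarrow> (\<Sum>j\<in>I. R j) \<ge> shannon_cond Ns p I ({..<m} - I)}"

definition R_CO :: "nat \<Rightarrow> nat list \<Rightarrow> (nat list \<Rightarrow> real) \<Rightarrow> real" where
  "R_CO m Ns p = Inf {\<Sum>j<m. R j | R. R \<in> rate_region_CO m Ns p}"

text \<open>rho^{(x)n}, with tensor factors reordered as A_1^n A_2^n ... A_m^n E^n
  (dsE = ds @ [dE]; within each block the n copies in order).\<close>
definition rho_pow :: "nat list \<Rightarrow> complex mat \<Rightarrow> nat \<Rightarrow> complex mat" where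
  "rho_pow dsE \<rho> n = (let bs = map (\<lambda>d. d ^ n) dsE; D = prod_list bs;
     copy_idx = (\<lambda>i t. mr_enc dsE (map (\<lambda>(d, b). mr_dec (replicate n d) b ! t) (zip dsE (mr_dec bs i))))
   in mat D D (\<lambda>(i, j). \<Prod>t<n. \<rho> $$ (copy_idx i t, copy_idx j t)))"

text \<open>Protocol data: Ls = [|L_1|..|L_m|], dA' = output dimensions, kraus j l = Kraus operators
  (dA'_j x d_j^n matrices) of the CP map E^(j)_l, Dm j ls k = POVM element D^(j,ls)_k,
  key alphabet {0..kappa-1}.  Output (sub-normalised) operator on E^n for keys k and messages ls:\<close>
definition prot_block ::
  "nat list \<Rightarrow> nat \<Rightarrow> complex mat \<Rightarrow> nat \<Rightarrow> nat list \<Rightarrow> (nat \<Rightarrow> nat \<Rightarrow> complex mat list)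
    \<Rightarrow> (nat \<Rightarrow> nat list \<Rightarrow> nat \<Rightarrow> complex mat) \<Rightarrow> nat list \<Rightarrow> nat list \<Rightarrow> complex mat" where
  "prot_block ds dE \<rho> n dA' kraus Dm k ls = (let m = length ds; dEn = dE ^ n;
     Dp = prod_list dA' * dEn;
     T = (\<lambda>c. tensor_list (map (\<lambda>j. kraus j (ls ! j) ! (c ! j)) [0..<m] @ [1\<^sub>m dEn]));
     evolved = msum Dp Dp (\<lambda>c. T c * rho_pow (ds @ [dE]) \<rho> n * adj (T c))
                 (tuples (map (\<lambda>j. length (kraus j (ls ! j))) [0..<m]));
     Dk = tensor_list (map (\<lambda>j. Dm j ls (k ! j)) [0..<m] @ [1\<^sub>m dEn])
   in ptrace_first (prod_list dA') (evolved * Dk))"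

definition is_protocol ::
  "nat list \<Rightarrow> nat \<Rightarrow> complex mat \<Rightarrow> nat \<Rightarrow> (nat \<Rightarrow> real) \<Rightarrow> real \<Rightarrow> nat \<Rightarrow> bool" where
  "is_protocol ds dE \<rho> n Rs \<epsilon> \<kappa> \<longleftrightarrow>
    (\<exists>Ls dA' kraus Dm. let m = length ds; dEn = dE ^ n;
       \<Omega> = cq_op (\<kappa> * prod_list Ls) dEn
             (\<lambda>c. msum dEn dEn (\<lambda>k. prot_block ds dE \<rho> n dA' kraus Dm k (mr_dec Ls (c mod prod_list Ls)))
                    {k \<in> tuples (replicate m \<kappa>). k ! 0 = c div prod_list Ls})
     in length Ls = m \<and> length dA' = m
      \<and> (\<forall>j<m. real (Ls ! j) \<le> 2 powr (real n * Rs j))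
      \<comment> \<open>instruments: CP maps given by Kraus operators, summing to a trace-preserving map\<close>
      \<and> (\<forall>j<m. \<forall>l<Ls ! j. \<forall>K\<in>set (kraus j l). K \<in> carrier_mat (dA' ! j) ((ds ! j) ^ n))
      \<and> (\<forall>j<m. msum ((ds ! j) ^ n) ((ds ! j) ^ n) (\<lambda>(l, c). adj (kraus j l ! c) * (kraus j l ! c))
                 {(l, c). l < Ls ! j \<and> c < length (kraus j l)} = 1\<^sub>m ((ds ! j) ^ n))
      \<comment> \<open>key POVMs\<close>
      \<and> (\<forall>j<m. \<forall>ls\<in>tuples Ls. povm (dA' ! j) \<kappa> (Dm j ls))
      \<comment> \<open>correctness\<close>
      \<and> (\<Sum>ls\<in>tuples Ls. \<Sum>k<\<kappa>. Re (mtrace (prot_block ds dE \<rho> n dA' kraus Dm (replicate m k) ls)))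
          \<ge> 1 - \<epsilon>
      \<comment> \<open>secrecy\<close>
      \<and> (\<exists>\<tau>0. density (prod_list Ls * dEn) \<tau>0 \<and>
           trace_norm (\<Omega> - tensor_list [(1 / of_nat \<kappa>) \<cdot>\<^sub>m 1\<^sub>m \<kappa>, \<tau>0]) / 2 \<le> \<epsilon>))"

definition achievable_ni :: "nat list \<Rightarrow> nat \<Rightarrow> complex mat \<Rightarrow> real \<Rightarrow> bool" where
  "achievable_ni ds dE \<rho> R \<longleftrightarrow>
    (\<exists>Rs \<epsilon>s \<kappa>s. (\<forall>n. \<kappa>s n \<ge> 1 \<and> is_protocol ds dE \<rho> n Rs (\<epsilon>s n) (\<kappa>s n))
       \<and> \<epsilon>s \<longlonglongrightarrow> 0
       \<and> (\<lambda>n. log 2 (real (\<kappa>s n)) / real n) \<longlonglongrightarrow> R)"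

definition K_ni :: "nat list \<Rightarrow> nat \<Rightarrow> complex mat \<Rightarrow> ereal" where
  "K_ni ds dE \<rho> = Sup (ereal ` {R. achievable_ni ds dE \<rho> R})"

end

theory Submission
  imports Defs "HOL-Analysis.L2_Norm" "HOL-Library.FuncSet" "Jordan_Normal_Form.Schur_Decomposition"
begin

text \<open>Player \<open>j\<close> measures the \<open>n\<close> copies with the product POVM and announces a random bin of the outcome block
  \<open>x\<^sub>j\<close>, using \<open>2 powr (n * (R j + 3 * \<delta>))\<close> bins.  Since \<open>R\<close> satisfies the constraints for all proper subsets of players,
  every player can decode all blocks from the bins and the own block (multi-terminal Slepian--Wolf coding),
  and the key is a random function \<open>F\<close> of the full outcome.

  For the secrecy of the key, diagonalize each conditional state of the eavesdropper and her average state
  \<open>\<rho>\<^sub>E\<close>.  The eigenvalues form classical i.i.d. weights of entropies \<open>S(XE)\<close> and \<open>S(E)\<close>, so by Chebyshev's inequality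
  one may truncate to eigenvectors of weight at most \<open>2 powr (- n * (S(XE) - \<delta>))\<close> and project onto at most
  \<open>2 powr (n * (S(E) + \<delta>))\<close> eigenvectors of \<open>\<rho>\<^sub>E\<close>.  On that subspace the trace norm is at most the Hilbert--Schmidt norm
  times the square root of the dimension, and averaging the square of the latter over \<open>F\<close> leaves only the diagonal terms.
  Hence the distance from an ideal key vanishes as soon as (key size) * (number of bin tuples)
  is exponentially smaller than \<open>2 powr (n * S(X|E))\<close>; the bins need not be uniform or independent of the eavesdropper.\<close>

section \<open>Inner products and contractions\<close>

text \<open>The binning and the key function come from two separate averaging arguments: a binning
  with small decoding error is fixed before \<open>F\<close> is drawn. This order is possible
  because the announcement enters the secrecy estimate as one more classical index, which costs its
  number of values under a square root. The obstacle on the quantum side is non-commutativity: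
  eigenvectors for different outcomes need not be orthogonal to each other or aligned with those of
  the average state, so typical weights and a typical subspace cannot be read off one joint
  eigenbasis. They are imposed separately, and the loss from the projection is still classical: the
  mean squared overlap of the conditional eigenvectors with an eigenvector of the average state is
  its eigenvalue. Only proper subsets of players occur in decoding because a candidate that misleads
  a player agrees with that player's own block. Players output decoded keys, so secrecy is proved
  for \<open>F\<close> of the true outcome and carried over at the cost of the decoding error.
  Entropies and trace norm are defined through roots of characteristic polynomials; explicit
  eigenbases turn them into finite sums.\<close>

definition ip :: "'q set \<Rightarrow> ('q \<Rightarrow> complex) \<Rightarrow> ('q \<Rightarrow> complex) \<Rightarrow> complex" where
  "ip Q u v = (\<Sum>a\<in>Q. cnj (u a) * v a)"

definition nrm :: "'q set \<Rightarrow> ('q \<Rightarrow> complex) \<Rightarrow> real" where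
  "nrm Q u = L2_set (\<lambda>a. cmod (u a)) Q"

definition mv :: "'q set \<Rightarrow> ('q \<Rightarrow> 'q \<Rightarrow> complex) \<Rightarrow> ('q \<Rightarrow> complex) \<Rightarrow> 'q \<Rightarrow> complex" where
  "mv Q W v = (\<lambda>a. \<Sum>b\<in>Q. W a b * v b)"

text \<open>Operator norm at most 1, phrased through sesquilinear values only. In this form it
  passes to diagonal blocks and to compressions by inserting suitable test vectors. Vectors are
  functions on an index set, so the same algebra serves one copy, n copies and the joint
  system.\<close>

definition contraction :: "'q set \<Rightarrow> ('q \<Rightarrow> 'q \<Rightarrow> complex) \<Rightarrow> bool" where
  "contraction Q W \<longleftrightarrow> (\<forall>u v. cmod (ip Q u (mv Q W v)) \<le> nrm Q u * nrm Q v)"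

lemma nrm_nonneg [simp]: "0 \<le> nrm Q u"
  by (simp add: nrm_def)

lemma nrm_power2: "(nrm Q u)\<^sup>2 = (\<Sum>a\<in>Q. (cmod (u a))\<^sup>2)"
  by (simp add: nrm_def L2_set_def sum_nonneg)

lemma mult_cnj_self: "z * cnj z = (complex_of_real (cmod z))\<^sup>2"
  using complex_norm_square[of z] by simp

lemma cnj_mult_self: "cnj z * z = (complex_of_real (cmod z))\<^sup>2"
  using complex_norm_square[of z] by (simp add: mult.commute)

lemma ip_self: "ip Q u u = complex_of_real ((nrm Q u)\<^sup>2)"
  unfolding ip_def nrm_power2 of_real_sum
  by (intro sum.cong refl) (metis complex_norm_square mult.commute)

lemma ip_cnj: "cnj (ip Q u v) = ip Q v u"
  by (simp add: ip_def mult.commute)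

lemma ip_add_right: "ip Q u (\<lambda>a. v a + w a) = ip Q u v + ip Q u w"
  by (simp add: ip_def algebra_simps sum.distrib)

lemma ip_add_left: "ip Q (\<lambda>a. v a + w a) u = ip Q v u + ip Q w u"
  by (simp add: ip_def algebra_simps sum.distrib)

lemma ip_diff_right: "ip Q u (\<lambda>a. v a - w a) = ip Q u v - ip Q u w"
  by (simp add: ip_def algebra_simps sum_subtractf)

lemma ip_diff_left: "ip Q (\<lambda>a. v a - w a) u = ip Q v u - ip Q w u"
  by (simp add: ip_def algebra_simps sum_subtractf)

lemma ip_scale_right: "ip Q u (\<lambda>a. c * v a) = c * ip Q u v"
  by (simp add: ip_def algebra_simps sum_distrib_left)

lemma ip_scale_left: "ip Q (\<lambda>a. c * v a) u = cnj c * ip Q v u"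
  by (simp add: ip_def algebra_simps sum_distrib_left)

lemma ip_sum_right: "ip Q u (\<lambda>a. \<Sum>j\<in>J. f j a) = (\<Sum>j\<in>J. ip Q u (f j))"
  unfolding ip_def by (subst sum.swap) (simp add: sum_distrib_left)

lemma ip_sum_left: "ip Q (\<lambda>a. \<Sum>j\<in>J. f j a) u = (\<Sum>j\<in>J. ip Q (f j) u)"
  unfolding ip_def by (subst sum.swap) (simp add: sum_distrib_right cnj_sum)

lemma mv_add: "mv Q W (\<lambda>a. v a + w a) = (\<lambda>a. mv Q W v a + mv Q W w a)"
  by (simp add: mv_def algebra_simps sum.distrib)

lemma mv_scale: "mv Q W (\<lambda>a. c * v a) = (\<lambda>a. c * mv Q W v a)"
  by (simp add: mv_def algebra_simps sum_distrib_left)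

lemma mv_sum: "mv Q W (\<lambda>a. \<Sum>j\<in>J. f j a) = (\<lambda>a. \<Sum>j\<in>J. mv Q W (f j) a)"
  unfolding mv_def by (subst sum.swap) (simp add: sum_distrib_left)

lemma sum_mult_le_sqrt:
  fixes f g :: "'a \<Rightarrow> real"
  shows "(\<Sum>i\<in>A. \<bar>f i\<bar> * \<bar>g i\<bar>) \<le> sqrt (\<Sum>i\<in>A. (f i)\<^sup>2) * sqrt (\<Sum>i\<in>A. (g i)\<^sup>2)"
  using L2_set_mult_ineq[of f g A] by (simp add: L2_set_def)

lemma cmod_sum_mult_le_sqrt:
  "cmod (\<Sum>i\<in>A. f i * g i) \<le> sqrt (\<Sum>i\<in>A. (cmod (f i))\<^sup>2) * sqrt (\<Sum>i\<in>A. (cmod (g i))\<^sup>2)"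
proof -
  have "cmod (\<Sum>i\<in>A. f i * g i) \<le> (\<Sum>i\<in>A. \<bar>cmod (f i)\<bar> * \<bar>cmod (g i)\<bar>)"
    by (rule order_trans[OF norm_sum]) (simp add: norm_mult)
  then show ?thesis using sum_mult_le_sqrt[of "\<lambda>i. cmod (f i)" "\<lambda>i. cmod (g i)" A] by linarith
qed

lemma nrm_combination:
  assumes "finite J" "\<And>i j. i \<in> J \<Longrightarrow> j \<in> J \<Longrightarrow> ip Q (f i) (f j) = (if i = j then 1 else 0)"
  shows "(nrm Q (\<lambda>a. \<Sum>j\<in>J. c j * f j a))\<^sup>2 = (\<Sum>j\<in>J. (cmod (c j))\<^sup>2)"
proof -
  have "complex_of_real ((nrm Q (\<lambda>a. \<Sum>j\<in>J. c j * f j a))\<^sup>2)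
      = (\<Sum>i\<in>J. \<Sum>j\<in>J. cnj (c i) * c j * ip Q (f i) (f j))"
    unfolding ip_self[symmetric] ip_sum_left ip_sum_right ip_scale_left ip_scale_right
    by (simp add: mult_ac)
  also have "\<dots> = (\<Sum>i\<in>J. \<Sum>j\<in>J. if i = j then cnj (c i) * c j else 0)"
    using assms(2) by (intro sum.cong refl) auto
  also have "\<dots> = complex_of_real (\<Sum>j\<in>J. (cmod (c j))\<^sup>2)"
    unfolding of_real_sum using assms(1)
    by (intro sum.cong refl) (auto simp: cnj_mult_self)
  finally show ?thesis using of_real_eq_iff by blast
qed

text \<open>Pythagoras: both cross terms and the square of the projection onto the span of the
  \<open>f j\<close> equal the same sum of squared coefficients.\<close>

lemma nrm_residual:
  assumes "finite J" "\<And>i j. i \<in> J \<Longrightarrow> j \<in> J \<Longrightarrow> ip Q (f i) (f j) = (if i = j then 1 else 0)"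
  shows "(nrm Q (\<lambda>a. w a - (\<Sum>j\<in>J. ip Q (f j) w * f j a)))\<^sup>2
      = (nrm Q w)\<^sup>2 - (\<Sum>j\<in>J. (cmod (ip Q (f j) w))\<^sup>2)"
proof -
  let ?p = "\<lambda>a. \<Sum>j\<in>J. ip Q (f j) w * f j a"
  have pw: "ip Q ?p w = complex_of_real (\<Sum>j\<in>J. (cmod (ip Q (f j) w))\<^sup>2)"
    unfolding ip_sum_left ip_scale_left of_real_sum
    by (intro sum.cong refl) (simp add: cnj_mult_self mult_cnj_self)
  have wp: "ip Q w ?p = complex_of_real (\<Sum>j\<in>J. (cmod (ip Q (f j) w))\<^sup>2)"
    using arg_cong[OF pw, of cnj] unfolding ip_cnj by simp
  have pp: "ip Q ?p ?p = complex_of_real (\<Sum>j\<in>J. (cmod (ip Q (f j) w))\<^sup>2)"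
    unfolding ip_self by (subst nrm_combination[OF assms]) auto
  have "complex_of_real ((nrm Q (\<lambda>a. w a - ?p a))\<^sup>2)
      = complex_of_real ((nrm Q w)\<^sup>2 - (\<Sum>j\<in>J. (cmod (ip Q (f j) w))\<^sup>2))"
    unfolding ip_self[symmetric] ip_diff_left ip_diff_right pw wp pp
    by (simp add: ip_self)
  then show ?thesis using of_real_eq_iff by blast
qed

lemma bessel:
  assumes "finite J" "\<And>i j. i \<in> J \<Longrightarrow> j \<in> J \<Longrightarrow> ip Q (f i) (f j) = (if i = j then 1 else 0)"
  shows "(\<Sum>j\<in>J. (cmod (ip Q (f j) w))\<^sup>2) \<le> (nrm Q w)\<^sup>2"
  using nrm_residual[OF assms, of w] zero_le_power2[of "nrm Q (\<lambda>a. w a - (\<Sum>j\<in>J. ip Q (f j) w * f j a))"]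
  by linarith

lemma nrm_unit: "ip Q u u = 1 \<Longrightarrow> nrm Q u = 1"
  by (metis ip_self nrm_nonneg of_real_eq_1_iff power2_eq_1_iff zero_le_one neg_0_le_iff_le not_one_le_zero)

text \<open>A column of the compressed matrix tests itself: with \<open>c\<close> the column and
  \<open>?u\<close> the combination of the \<open>f j\<close> with coefficients \<open>c\<close>,
  the form of \<open>W\<close> at \<open>?u\<close> and \<open>f k\<close> is s, the squared length
  of the column, while \<open>?u\<close> has norm sqrt s. So s is at most sqrt s.\<close>

lemma contraction_compress_le:
  assumes W: "contraction Q W" and J: "finite J"
    and on: "\<And>i j. i \<in> J \<Longrightarrow> j \<in> J \<Longrightarrow> ip Q (f i) (f j) = (if i = j then 1 else 0)"
    and k: "k \<in> J"
  shows "(\<Sum>j\<in>J. (cmod (ip Q (f j) (mv Q W (f k))))\<^sup>2) \<le> 1"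
proof -
  define c where "c = (\<lambda>j. ip Q (f j) (mv Q W (f k)))"
  define s where "s = (\<Sum>j\<in>J. (cmod (c j))\<^sup>2)"
  have s0: "0 \<le> s" unfolding s_def by (intro sum_nonneg) auto
  let ?u = "\<lambda>a. \<Sum>j\<in>J. c j * f j a"
  have "ip Q ?u (mv Q W (f k)) = (\<Sum>j\<in>J. cnj (c j) * c j)"
    unfolding ip_sum_left ip_scale_left by (simp add: c_def)
  also have "\<dots> = complex_of_real s"
    unfolding s_def of_real_sum by (intro sum.cong refl) (simp add: cnj_mult_self mult_cnj_self)
  finally have "cmod (ip Q ?u (mv Q W (f k))) = s" using s0 by simp
  moreover have "nrm Q (f k) = 1" using on[OF k k] by (intro nrm_unit) simp
  ultimately have "s \<le> nrm Q ?u"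
    using W unfolding contraction_def by (metis mult.right_neutral)
  then have "s\<^sup>2 \<le> (nrm Q ?u)\<^sup>2" using s0 by (intro power_mono)
  moreover have "(nrm Q ?u)\<^sup>2 = s"
    unfolding s_def by (rule nrm_combination[OF J on])
  ultimately have "s * s \<le> s * 1" by (simp add: power2_eq_square)
  then have "s \<le> 1"
    by (cases "s = 0") (use s0 in \<open>auto simp: mult_le_cancel_left\<close>)
  then show ?thesis by (simp add: s_def c_def)
qed

section \<open>Spectral theorem and trace-norm duality\<close>

lemma mtrace_mult:
  assumes "A \<in> carrier_mat r n" "B \<in> carrier_mat n r"
  shows "mtrace (A * B) = (\<Sum>i<r. \<Sum>j<n. A $$ (i, j) * B $$ (j, i))"
  using assms unfolding mtrace_def
  by (auto simp: scalar_prod_def atLeast0LessThan intro!: sum.cong)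

lemma mtrace_comm:
  assumes "A \<in> carrier_mat r n" "B \<in> carrier_mat n r"
  shows "mtrace (A * B) = mtrace (B * A)"
  unfolding mtrace_mult[OF assms] mtrace_mult[OF assms(2,1)]
  by (subst sum.swap) (simp add: mult.commute)

lemma adj_index: "i < dim_col A \<Longrightarrow> j < dim_row A \<Longrightarrow> adj A $$ (i, j) = cnj (A $$ (j, i))"
  by (simp add: adj_def)

lemma adj_carrier [simp]: "A \<in> carrier_mat r c \<Longrightarrow> adj A \<in> carrier_mat c r"
  by (auto simp: adj_def)

lemma hermitian_index:
  assumes "A \<in> carrier_mat n n" "adj A = A" "i < n" "j < n"
  shows "A $$ (j, i) = cnj (A $$ (i, j))"
  using assms adj_index[of j A i] by auto

text \<open>Were all eigenvalues zero, Schur's form would make \<open>B\<close> similar to a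
  triangular \<open>T\<close> with zero diagonal, so the trace of \<open>B * B\<close> would be that
  of \<open>T * T\<close>, which is 0. For Hermitian \<open>B\<close> this trace is the sum of the
  squared moduli of all entries.\<close>

lemma hermitian_nonzero_eigenvector:
  assumes B: "B \<in> carrier_mat n n" and herm: "adj B = B" and nz: "B \<noteq> 0\<^sub>m n n"
  shows "\<exists>w l. w \<in> carrier_vec n \<and> w \<noteq> 0\<^sub>v n \<and> l \<noteq> 0 \<and> B *\<^sub>v w = l \<cdot>\<^sub>v w"
proof -
  obtain as where as: "char_poly B = (\<Prod>a\<leftarrow>as. [:- a, 1:])"
    using char_poly_factorized[OF B] by auto
  have "\<exists>a\<in>set as. a \<noteq> 0"
  proof (rule ccontr)
    assume "\<not> (\<exists>a\<in>set as. a \<noteq> 0)"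
    then have z: "\<And>a. a \<in> set as \<Longrightarrow> a = 0" by auto
    obtain T P Q where sd: "schur_decomposition B as = (T, P, Q)" by (cases "schur_decomposition B as")
    from schur_decomposition[OF B as sd]
    have w: "similar_mat_wit B T P Q" and ut: "upper_triangular T" and d: "diag_mat T = as" by auto
    from similar_mat_witD2[OF B w] have
      PQ: "Q * P = 1\<^sub>m n" and BT: "B = P * T * Q" and
      T: "T \<in> carrier_mat n n" and P: "P \<in> carrier_mat n n" and Q: "Q \<in> carrier_mat n n" by auto
    have diag0: "T $$ (i, i) = 0" if "i < n" for i
      using z[of "T $$ (i, i)"] d T that unfolding diag_mat_def by auto
    have T0: "T $$ (i, j) * T $$ (j, i) = 0" if "i < n" "j < n" for i j
    proof -
      consider "i < j" | "i = j" | "j < i" by linarith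
      then show ?thesis
      proof cases
        case 1 then show ?thesis using ut T that unfolding upper_triangular_def by auto
      next
        case 2 then show ?thesis using diag0 that by auto
      next
        case 3 then show ?thesis using ut T that unfolding upper_triangular_def by auto
      qed
    qed
    have "B * B = P * (T * (T * Q))"
    proof -
      have "B * B = (P * T * Q) * (P * (T * Q))" using BT P T Q by (simp add: assoc_mult_mat[OF P T Q])
      also have "\<dots> = P * T * (Q * (P * (T * Q)))"
        using P T Q by (intro assoc_mult_mat[of _ n n _ n _ n]) auto
      also have "Q * (P * (T * Q)) = (Q * P) * (T * Q)"
        using P T Q by (intro assoc_mult_mat[symmetric, of _ n n _ n _ n]) auto
      also have "\<dots> = T * Q" unfolding PQ using T Q by auto
      also have "P * T * (T * Q) = P * (T * (T * Q))"
        using P T Q by (intro assoc_mult_mat[of _ n n _ n _ n]) auto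
      finally show ?thesis .
    qed
    then have "mtrace (B * B) = mtrace ((T * (T * Q)) * P)"
      using mtrace_comm[of P n n "T * (T * Q)"] P T Q by simp
    also have "(T * (T * Q)) * P = T * T"
    proof -
      have "(T * (T * Q)) * P = T * ((T * Q) * P)"
        using P T Q by (intro assoc_mult_mat[of _ n n _ n _ n]) auto
      also have "(T * Q) * P = T * (Q * P)"
        using P T Q by (intro assoc_mult_mat[of _ n n _ n _ n]) auto
      finally show ?thesis unfolding PQ using T by simp
    qed
    also have "mtrace (T * T) = 0"
      unfolding mtrace_mult[OF T T] using T0 by (intro sum.neutral ballI) auto
    finally have "(\<Sum>i<n. \<Sum>j<n. B $$ (i, j) * B $$ (j, i)) = 0"
      unfolding mtrace_mult[OF B B] .
    moreover have sq: "B $$ (i, j) * B $$ (j, i) = (complex_of_real (cmod (B $$ (i, j))))\<^sup>2" if "i < n" "j < n" for i j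
      unfolding hermitian_index[OF B herm that] mult_cnj_self ..
    have "(\<Sum>i<n. \<Sum>j<n. B $$ (i, j) * B $$ (j, i))
        = complex_of_real (\<Sum>i<n. \<Sum>j<n. (cmod (B $$ (i, j)))\<^sup>2)"
      unfolding of_real_sum of_real_power by (intro sum.cong refl sq) auto
    ultimately have "complex_of_real (\<Sum>i<n. \<Sum>j<n. (cmod (B $$ (i, j)))\<^sup>2) = 0" by (simp only:)
    then have "(\<Sum>i<n. \<Sum>j<n. (cmod (B $$ (i, j)))\<^sup>2) = 0" using of_real_eq_0_iff by blast
    then have "\<forall>i<n. (\<Sum>j<n. (cmod (B $$ (i, j)))\<^sup>2) = 0"
      by (subst (asm) sum_nonneg_eq_0_iff) (auto intro!: sum_nonneg)
    then have "\<forall>i<n. \<forall>j<n. B $$ (i, j) = 0"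
      by (subst (asm) sum_nonneg_eq_0_iff) auto
    then have "B = 0\<^sub>m n n" using B by (intro eq_matI) auto
    then show False using nz by simp
  qed
  then obtain a where a: "a \<in> set as" "a \<noteq> 0" by auto
  have "poly (char_poly B) a = 0" unfolding as using a(1)
    by (auto simp: poly_prod_list prod_list_zero_iff image_iff intro!: bexI[of _ a])
  then have "eigenvalue B a" using eigenvalue_root_char_poly[OF B] by simp
  then show ?thesis using a(2) B unfolding eigenvalue_def eigenvector_def by auto
qed

lemma ip_mv_hermitian:
  assumes "\<And>a b. a \<in> Q \<Longrightarrow> b \<in> Q \<Longrightarrow> A b a = cnj (A a b)"
  shows "ip Q u (mv Q A v) = ip Q (mv Q A u) v"
proof -
  have "ip Q u (mv Q A v) = (\<Sum>a\<in>Q. \<Sum>b\<in>Q. cnj (u a) * A a b * v b)"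
    by (simp add: ip_def mv_def sum_distrib_left mult.assoc)
  also have "\<dots> = (\<Sum>b\<in>Q. \<Sum>a\<in>Q. cnj (u a) * A a b * v b)" by (rule sum.swap)
  also have "\<dots> = (\<Sum>b\<in>Q. \<Sum>a\<in>Q. cnj (A b a * u a) * v b)"
  proof (intro sum.cong refl)
    fix a b assume "a \<in> Q" "b \<in> Q"
    from assms[OF this] have "cnj (A b a) = A a b" by (simp only: complex_cnj_cnj)
    then show "cnj (u a) * A a b * v b = cnj (A b a * u a) * v b"
      by (simp only: complex_cnj_mult mult_ac)
  qed
  also have "\<dots> = ip Q (mv Q A u) v"
    by (simp add: ip_def mv_def sum_distrib_right)
  finally show ?thesis .
qed

lemma ip_cong: "(\<And>a. a \<in> Q \<Longrightarrow> u a = u' a) \<Longrightarrow> (\<And>a. a \<in> Q \<Longrightarrow> v a = v' a) \<Longrightarrow> ip Q u v = ip Q u' v'"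
  by (simp add: ip_def)

text \<open>Deflation inside the full space, without a basis of the orthogonal complement.
  \<open>B\<close> is \<open>A\<close> shifted by \<open>s\<close>, with the known eigenvectors
  moved to eigenvalue 0. An eigenvector of \<open>B\<close> for a non-zero eigenvalue is then
  orthogonal to them and is an eigenvector of \<open>A\<close>.\<close>

lemma hermitian_extend_eigenvectors:
  fixes A :: "complex mat" and a :: "nat \<Rightarrow> real" and u :: "nat \<Rightarrow> nat \<Rightarrow> complex"
  assumes A: "A \<in> carrier_mat n n" "adj A = A" and k: "k < n"
    and on: "\<And>i j. i < k \<Longrightarrow> j < k \<Longrightarrow> ip {..<n} (u i) (u j) = (if i = j then 1 else 0)"
    and eig: "\<And>i x. i < k \<Longrightarrow> x < n \<Longrightarrow> mv {..<n} (\<lambda>x y. A $$ (x, y)) (u i) x = a i * u i x"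
  shows "\<exists>(w :: nat \<Rightarrow> complex) (l::real). ip {..<n} w w = 1 \<and> (\<forall>i<k. ip {..<n} (u i) w = 0)
     \<and> (\<forall>x<n. mv {..<n} (\<lambda>x y. A $$ (x, y)) w x = l * w x)"
proof -
  let ?Q = "{..<n}"
  let ?A = "\<lambda>x y. A $$ (x, y)"
  have hA: "A $$ (j, i) = cnj (A $$ (i, j))" if "i < n" "j < n" for i j
    using hermitian_index[OF A that] .
  define t where "t = (\<Sum>x<n. A $$ (x, x)) - (\<Sum>i<k. complex_of_real (a i))"
  \<comment> \<open>This shift gives the trace of \<open>B\<close> real part 1, so that
    \<open>B\<close> is not zero; a deflation without shift could vanish.\<close>
  define s where "s = (1 - Re t) / real (n - k)"
  define Bf where "Bf = (\<lambda>x y. A $$ (x, y) + (if x = y then complex_of_real s else 0)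
      - (\<Sum>i<k. complex_of_real (a i + s) * u i x * cnj (u i y)))"
  define B where "B = mat n n (\<lambda>(x, y). Bf x y)"
  have B: "B \<in> carrier_mat n n" by (simp add: B_def)
  have hB: "Bf y x = cnj (Bf x y)" if "x < n" "y < n" for x y
    using hA[OF that] unfolding Bf_def by (simp add: cnj_sum mult_ac)
  have adjB: "adj B = B"
    by (intro eq_matI) (auto simp: adj_def B_def hB[symmetric])
  have unit: "(\<Sum>x<n. u i x * cnj (u i x)) = 1" if "i < k" for i
    using on[OF that that] by (simp add: ip_def mult.commute)
  have "(\<Sum>x<n. Bf x x) = (\<Sum>x<n. A $$ (x, x)) + of_nat n * complex_of_real s
      - (\<Sum>i<k. complex_of_real (a i + s) * (\<Sum>x<n. u i x * cnj (u i x)))"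
    unfolding Bf_def sum_subtractf sum.distrib sum_distrib_left
    by (subst sum.swap) (simp add: mult.assoc)
  also have "\<dots> = (\<Sum>x<n. A $$ (x, x)) + of_nat n * complex_of_real s
      - (\<Sum>i<k. complex_of_real (a i + s))"
    using unit by simp
  also have "\<dots> = t + complex_of_real (s * real (n - k))"
    using k by (simp add: t_def sum.distrib algebra_simps of_nat_diff)
  also have "s * real (n - k) = 1 - Re t" using k by (simp add: s_def)
  finally have tr: "Re (\<Sum>x<n. Bf x x) = 1" by simp
  have "B \<noteq> 0\<^sub>m n n"
  proof
    assume "B = 0\<^sub>m n n"
    then have "\<And>x. x < n \<Longrightarrow> Bf x x = 0" unfolding B_def
      by (metis (no_types, lifting) case_prod_conv index_mat(1) index_zero_mat(1))
    then show False using tr by simp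
  qed
  from hermitian_nonzero_eigenvector[OF B adjB this] obtain v l where
    v: "v \<in> carrier_vec n" "v \<noteq> 0\<^sub>v n" and l: "l \<noteq> 0" and ev: "B *\<^sub>v v = l \<cdot>\<^sub>v v" by auto
  define w0 where "w0 = (\<lambda>x. v $ x)"
  have mvB: "mv ?Q Bf w0 x = l * w0 x" if "x < n" for x
  proof -
    have "(B *\<^sub>v v) $ x = l * v $ x" unfolding ev using v that by simp
    then show ?thesis using v(1) that unfolding mv_def w0_def B_def
      by (simp add: scalar_prod_def atLeast0LessThan mult.commute)
  qed
  have Bf_mv: "mv ?Q Bf v' x = mv ?Q ?A v' x + s * v' x
      - (\<Sum>i<k. complex_of_real (a i + s) * ip ?Q (u i) v' * u i x)" if "x < n" for v' :: "nat \<Rightarrow> complex" and x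
  proof -
    have "Bf x y * v' y = A $$ (x, y) * v' y + (if x = y then complex_of_real s * v' y else 0)
        - (\<Sum>i<k. complex_of_real (a i + s) * u i x * cnj (u i y) * v' y)" for y
      unfolding Bf_def by (simp only: left_diff_distrib distrib_right sum_distrib_right) simp
    then have "mv ?Q Bf v' x = mv ?Q ?A v' x + (\<Sum>y<n. (if x = y then complex_of_real s * v' y else 0))
        - (\<Sum>y<n. \<Sum>i<k. complex_of_real (a i + s) * u i x * cnj (u i y) * v' y)"
      unfolding mv_def by (simp only: sum.distrib sum_subtractf)
    also have "(\<Sum>y<n. (if x = y then complex_of_real s * v' y else 0)) = s * v' x"
      using that by simp
    also have "(\<Sum>y<n. \<Sum>i<k. complex_of_real (a i + s) * u i x * cnj (u i y) * v' y)
        = (\<Sum>i<k. complex_of_real (a i + s) * ip ?Q (u i) v' * u i x)"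
      by (subst sum.swap) (simp add: ip_def sum_distrib_left sum_distrib_right mult_ac)
    finally show ?thesis .
  qed
  have Bu: "mv ?Q Bf (u i) x = 0" if i: "i < k" and x: "x < n" for i x
  proof -
    have "(\<Sum>j<k. complex_of_real (a j + s) * ip ?Q (u j) (u i) * u j x)
        = (\<Sum>j<k. if j = i then complex_of_real (a j + s) * u j x else 0)"
      using on i by (intro sum.cong refl) auto
    also have "\<dots> = complex_of_real (a i + s) * u i x" using i by simp
    finally show ?thesis unfolding Bf_mv[OF x] eig[OF i x] by (simp add: algebra_simps)
  qed
  have orth: "ip ?Q (u i) w0 = 0" if i: "i < k" for i
  proof -
    have "l * ip ?Q (u i) w0 = ip ?Q (u i) (\<lambda>x. l * w0 x)" by (simp add: ip_scale_right)
    also have "\<dots> = ip ?Q (u i) (mv ?Q Bf w0)" using mvB by (intro ip_cong) auto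
    also have "\<dots> = ip ?Q (mv ?Q Bf (u i)) w0" by (rule ip_mv_hermitian, rule hB, auto)
    also have "\<dots> = ip ?Q (\<lambda>x. 0) w0" using Bu[OF i] by (intro ip_cong) auto
    finally show ?thesis using l by (simp add: ip_def)
  qed
  have Aw0: "mv ?Q ?A w0 x = (l - s) * w0 x" if x: "x < n" for x
    using Bf_mv[OF x, of w0] mvB[OF x] orth by (simp add: algebra_simps)
  have nz: "nrm ?Q w0 \<noteq> 0"
  proof
    assume "nrm ?Q w0 = 0"
    then have "\<forall>x<n. w0 x = 0" unfolding nrm_def by (subst (asm) L2_set_eq_0_iff) auto
    then have "v = 0\<^sub>v n" using v(1) unfolding w0_def by (intro eq_vecI) auto
    then show False using v(2) by simp
  qed
  define w where "w = (\<lambda>x. complex_of_real (1 / nrm ?Q w0) * w0 x)"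
  have ww: "ip ?Q w w = 1"
    unfolding w_def ip_scale_left ip_scale_right ip_self using nz
    by (simp add: power2_eq_square)
  have Aw: "mv ?Q ?A w x = (l - s) * w x" if "x < n" for x
    unfolding w_def mv_scale Aw0[OF that] by (simp add: mult_ac)
  \<comment> \<open>Moving \<open>A\<close> to the other side of the inner product shows that the
    eigenvalue \<open>l - s\<close> is real.\<close>
  have "(l - s) * ip ?Q w w = ip ?Q w (\<lambda>x. (l - s) * w x)" by (simp add: ip_scale_right)
  also have "\<dots> = ip ?Q w (mv ?Q ?A w)" using Aw by (intro ip_cong) auto
  also have "\<dots> = ip ?Q (mv ?Q ?A w) w" by (rule ip_mv_hermitian, rule hA, auto)
  also have "\<dots> = ip ?Q (\<lambda>x. (l - s) * w x) w" using Aw by (intro ip_cong) auto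
  also have "\<dots> = cnj (l - s) * ip ?Q w w" by (simp add: ip_scale_left)
  finally have "l - s = cnj (l - s)" unfolding ww by simp
  then have "complex_of_real (Re (l - s)) = l - s" by (metis Reals_cnj_iff of_real_Re)
  then have "\<forall>x<n. mv ?Q ?A w x = complex_of_real (Re (l - s)) * w x" using Aw by simp
  moreover have "\<forall>i<k. ip ?Q (u i) w = 0" unfolding w_def ip_scale_right using orth by simp
  ultimately show ?thesis using ww by blast
qed

lemma hermitian_eigenvectors:
  assumes A: "A \<in> carrier_mat n n" "adj A = A" and "k \<le> n"
  shows "\<exists>(u :: nat \<Rightarrow> nat \<Rightarrow> complex) (a :: nat \<Rightarrow> real).
      (\<forall>i<k. \<forall>j<k. ip {..<n} (u i) (u j) = (if i = j then 1 else 0))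
    \<and> (\<forall>i<k. \<forall>x<n. mv {..<n} (\<lambda>x y. A $$ (x, y)) (u i) x = a i * u i x)"
  using \<open>k \<le> n\<close>
proof (induction k)
  case 0
  then show ?case by auto
next
  case (Suc k)
  then obtain u :: "nat \<Rightarrow> nat \<Rightarrow> complex" and a :: "nat \<Rightarrow> real" where
    ue: "(\<forall>i<k. \<forall>j<k. ip {..<n} (u i) (u j) = (if i = j then 1 else 0))
      \<and> (\<forall>i<k. \<forall>x<n. mv {..<n} (\<lambda>x y. A $$ (x, y)) (u i) x = a i * u i x)"
    using Suc_leD by blast
  have on: "\<And>i j. i < k \<Longrightarrow> j < k \<Longrightarrow> ip {..<n} (u i) (u j) = (if i = j then 1 else 0)" and
    eig: "\<And>i x. i < k \<Longrightarrow> x < n \<Longrightarrow> mv {..<n} (\<lambda>x y. A $$ (x, y)) (u i) x = a i * u i x"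
    using ue by auto
  have "k < n" using Suc.prems by simp
  from hermitian_extend_eigenvectors[OF A this on eig]
  obtain w :: "nat \<Rightarrow> complex" and l :: real where w: "ip {..<n} w w = 1" "\<forall>i<k. ip {..<n} (u i) w = 0"
     "\<forall>x<n. mv {..<n} (\<lambda>x y. A $$ (x, y)) w x = l * w x" by blast
  have w': "ip {..<n} w (u i) = 0" if "i < k" for i
    using w(2) that ip_cnj[of "{..<n}" "u i" w] by simp
  show ?case
    by (rule exI[of _ "u(k := w)"], rule exI[of _ "a(k := l)"])
      (use w w' on eig in \<open>auto simp: less_Suc_eq\<close>)
qed

text \<open>Orthonormality says that \<open>V\<close> is a left inverse of \<open>U\<close>; for
  square matrices it is also a right inverse, which is the completeness relation. Inserting that
  relation next to \<open>A\<close> gives the expansion.\<close>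

lemma spectral_theorem:
  assumes A: "A \<in> carrier_mat n n" "adj A = A"
  obtains u :: "nat \<Rightarrow> nat \<Rightarrow> complex" and a :: "nat \<Rightarrow> real" where
    "\<And>i j. i < n \<Longrightarrow> j < n \<Longrightarrow> ip {..<n} (u i) (u j) = (if i = j then 1 else 0)"
    "\<And>x y. x < n \<Longrightarrow> y < n \<Longrightarrow> (\<Sum>k<n. u k x * cnj (u k y)) = (if x = y then 1 else 0)"
    "\<And>x y. x < n \<Longrightarrow> y < n \<Longrightarrow> A $$ (x, y) = (\<Sum>k<n. complex_of_real (a k) * u k x * cnj (u k y))"
proof -
  from hermitian_eigenvectors[OF A order_refl] obtain u :: "nat \<Rightarrow> nat \<Rightarrow> complex" and a :: "nat \<Rightarrow> real" where
    ue: "(\<forall>i<n. \<forall>j<n. ip {..<n} (u i) (u j) = (if i = j then 1 else 0))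
      \<and> (\<forall>i<n. \<forall>x<n. mv {..<n} (\<lambda>x y. A $$ (x, y)) (u i) x = a i * u i x)"
    by blast
  have on: "\<And>i j. i < n \<Longrightarrow> j < n \<Longrightarrow> ip {..<n} (u i) (u j) = (if i = j then 1 else 0)" and
    eig: "\<And>i x. i < n \<Longrightarrow> x < n \<Longrightarrow> mv {..<n} (\<lambda>x y. A $$ (x, y)) (u i) x = a i * u i x"
    using ue by auto
  define U where "U = mat n n (\<lambda>(x, k). u k x)"
  define V where "V = mat n n (\<lambda>(k, x). cnj (u k x))"
  have "V * U = 1\<^sub>m n"
    using on by (intro eq_matI) (auto simp: U_def V_def scalar_prod_def ip_def atLeast0LessThan)
  then have "U * V = 1\<^sub>m n"
    using mat_mult_left_right_inverse[of V n U] by (auto simp: U_def V_def)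
  then have compl: "(\<Sum>k<n. u k x * cnj (u k y)) = (if x = y then 1 else 0)" if "x < n" "y < n" for x y
  proof -
    have "(U * V) $$ (x, y) = (\<Sum>k<n. u k x * cnj (u k y))"
      using that by (simp add: U_def V_def scalar_prod_def atLeast0LessThan)
    then show ?thesis unfolding \<open>U * V = 1\<^sub>m n\<close> using that by simp
  qed
  have "A $$ (x, y) = (\<Sum>k<n. complex_of_real (a k) * u k x * cnj (u k y))" if "x < n" "y < n" for x y
  proof -
    have "A $$ (x, y) = (\<Sum>z<n. A $$ (x, z) * (\<Sum>k<n. u k z * cnj (u k y)))"
      using that by (subst sum.cong[OF refl, of _ _ "\<lambda>z. if z = y then A $$ (x, z) else 0"])
        (auto simp: compl)
    also have "\<dots> = (\<Sum>k<n. mv {..<n} (\<lambda>x y. A $$ (x, y)) (u k) x * cnj (u k y))"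
      unfolding mv_def sum_distrib_left sum_distrib_right
      by (subst sum.swap) (simp add: mult.assoc)
    finally show ?thesis using eig[OF _ that(1)] by simp
  qed
  then show ?thesis using that[OF on compl] by blast
qed

section \<open>Spectral sums over characteristic roots, evaluated in an eigenbasis\<close>

lemma order_prod_linear:
  "Polynomial.order z (\<Prod>a\<leftarrow>as. [:- a, 1:]) = count_list as (z :: complex)"
proof (induction as)
  case Nil
  then show ?case by (simp add: order_1_eq_0)
next
  case (Cons b as)
  have nz: "[:- b, 1:] * (\<Prod>a\<leftarrow>as. [:- a, 1:]) \<noteq> 0"
    by (simp only: mult_eq_0_iff prod_list_zero_iff) auto
  have "Polynomial.order z [:- b, 1:] = (if b = z then 1 else 0)"
    using order_power_n_n[of z 1] by (auto simp: order_0I)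
  then show ?case using order_mult[OF nz, of z] Cons.IH by auto
qed

lemma sum_count_list:
  fixes f :: "'a \<Rightarrow> real"
  assumes "finite S" "set xs \<subseteq> S"
  shows "(\<Sum>z\<in>S. real (count_list xs z) * f z) = sum_list (map f xs)"
  using assms(2)
proof (induction xs)
  case Nil
  then show ?case by simp
next
  case (Cons a xs)
  have "(\<Sum>z\<in>S. real (count_list (a # xs) z) * f z)
      = (\<Sum>z\<in>S. (if z = a then f z else 0) + real (count_list xs z) * f z)"
    by (intro sum.cong refl) (auto simp: algebra_simps)
  also have "\<dots> = f a + (\<Sum>z\<in>S. real (count_list xs z) * f z)"
    using assms(1) Cons.prems by (simp add: sum.distrib)
  finally show ?case using Cons by simp
qed

text \<open>\<open>spec_sum\<close> runs over distinct roots with algebraic multiplicity. The basis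
  makes the matrix similar to a diagonal one, whose characteristic polynomial lists the
  \<open>d k\<close>; regrouping equal values turns multiplicities into a plain sum over k.\<close>

lemma spec_sum_diagonalized:
  fixes d :: "nat \<Rightarrow> complex"
  assumes A: "A \<in> carrier_mat n n"
    and on: "\<And>i j. i < n \<Longrightarrow> j < n \<Longrightarrow> ip {..<n} (u i) (u j) = (if i = j then 1 else 0)"
    and compl: "\<And>x y. x < n \<Longrightarrow> y < n \<Longrightarrow> (\<Sum>k<n. u k x * cnj (u k y)) = (if x = y then 1 else 0)"
    and ent: "\<And>x y. x < n \<Longrightarrow> y < n \<Longrightarrow> A $$ (x, y) = (\<Sum>k<n. d k * u k x * cnj (u k y))"
  shows "spec_sum f A = (\<Sum>k<n. f (d k))"
proof -
  define U where "U = mat n n (\<lambda>(x, k). u k x)"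
  define V where "V = mat n n (\<lambda>(k, x). cnj (u k x))"
  define D where "D = mat n n (\<lambda>(i, j). if i = j then d i else 0)"
  have VU: "V * U = 1\<^sub>m n"
    using on by (intro eq_matI) (auto simp: U_def V_def scalar_prod_def ip_def atLeast0LessThan)
  have UV: "U * V = 1\<^sub>m n"
    using compl by (intro eq_matI) (auto simp: U_def V_def scalar_prod_def atLeast0LessThan)
  have UD: "U * D = mat n n (\<lambda>(x, k). d k * u k x)"
    by (intro eq_matI) (auto simp: U_def D_def scalar_prod_def atLeast0LessThan if_distrib mult.commute cong: if_cong)
  have "A = U * D * V" unfolding UD
    using A ent by (intro eq_matI) (auto simp: V_def scalar_prod_def atLeast0LessThan)
  then have "similar_mat A D" using A VU UV
    unfolding similar_mat_def by (intro exI[of _ U] exI[of _ V] similar_mat_witI[of _ _ n]) (auto simp: U_def V_def D_def)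
  then have "char_poly A = char_poly D" by (rule char_poly_similar)
  also have "\<dots> = (\<Prod>a\<leftarrow>diag_mat D. [:- a, 1:])"
    by (rule char_poly_upper_triangular[of _ n]) (auto simp: D_def upper_triangular_def)
  also have "diag_mat D = map d [0..<n]" by (auto simp: diag_mat_def D_def)
  finally have cp: "char_poly A = (\<Prod>a\<leftarrow>map d [0..<n]. [:- a, 1:])" .
  have roots: "{z. poly (char_poly A) z = 0} = set (map d [0..<n])"
    unfolding cp by (auto simp: poly_prod_list prod_list_zero_iff image_iff)
  have "spec_sum f A = (\<Sum>z\<in>set (map d [0..<n]). real (count_list (map d [0..<n]) z) * f z)"
    unfolding spec_sum_def roots unfolding cp order_prod_linear ..
  also have "\<dots> = sum_list (map f (map d [0..<n]))"
    by (rule sum_count_list) simp_all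
  also have "\<dots> = (\<Sum>k<n. f (d k))"
    by (simp add: interv_sum_list_conv_sum_set_nat atLeast0LessThan comp_def)
  finally show ?thesis .
qed

text \<open>\<open>W\<close> is the sign of \<open>A\<close>: same eigenvectors, eigenvalues
  \<open>sgn (a k)\<close>. It is a contraction by Cauchy-Schwarz and Bessel, and pairing it with
  \<open>A\<close> gives the sum of the absolute eigenvalues. Since secrecy is bounded for all
  contractions at once, one norming contraction is enough.\<close>

lemma trace_norm_dual:
  assumes A: "A \<in> carrier_mat n n" "adj A = A"
  obtains W where "contraction {..<n} W"
    "complex_of_real (trace_norm A) = (\<Sum>x<n. \<Sum>y<n. A $$ (x, y) * W y x)"
proof -
  from spectral_theorem[OF A] obtain u :: "nat \<Rightarrow> nat \<Rightarrow> complex" and a :: "nat \<Rightarrow> real" where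
    on: "\<And>i j. i < n \<Longrightarrow> j < n \<Longrightarrow> ip {..<n} (u i) (u j) = (if i = j then 1 else 0)" and
    compl: "\<And>x y. x < n \<Longrightarrow> y < n \<Longrightarrow> (\<Sum>k<n. u k x * cnj (u k y)) = (if x = y then 1 else 0)" and
    ent: "\<And>x y. x < n \<Longrightarrow> y < n \<Longrightarrow> A $$ (x, y) = (\<Sum>k<n. complex_of_real (a k) * u k x * cnj (u k y))"
    by blast
  have ipu: "(\<Sum>z<n. cnj (u k z) * u k' z) = (if k = k' then 1 else 0)" if "k < n" "k' < n" for k k'
    using on[OF that] by (simp add: ip_def)
  have sq: "(adj A * A) $$ (x, y) = (\<Sum>k<n. complex_of_real ((a k)\<^sup>2) * u k x * cnj (u k y))"
    if x: "x < n" and y: "y < n" for x y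
  proof -
    have "(adj A * A) $$ (x, y) = (\<Sum>z<n. A $$ (x, z) * A $$ (z, y))"
      using A x y by (simp add: scalar_prod_def atLeast0LessThan)
    also have "\<dots> = (\<Sum>z<n. \<Sum>k<n. \<Sum>k'<n. (a k * u k x * a k' * cnj (u k' y)) * (cnj (u k z) * u k' z))"
    proof (rule sum.cong[OF refl])
      fix z assume "z \<in> {..<n}"
      then have z: "z < n" by simp
      show "A $$ (x, z) * A $$ (z, y) = (\<Sum>k<n. \<Sum>k'<n. (a k * u k x * a k' * cnj (u k' y)) * (cnj (u k z) * u k' z))"
        unfolding ent[OF x z] ent[OF z y] sum_product by (intro sum.cong refl) (simp only: mult_ac)
    qed
    also have "\<dots> = (\<Sum>k<n. \<Sum>k'<n. \<Sum>z<n. (a k * u k x * a k' * cnj (u k' y)) * (cnj (u k z) * u k' z))"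
      by (subst sum.swap, rule sum.cong[OF refl], rule sum.swap)
    also have "\<dots> = (\<Sum>k<n. \<Sum>k'<n. if k = k' then a k * u k x * a k' * cnj (u k' y) else 0)"
      unfolding sum_distrib_left[symmetric] using ipu by (intro sum.cong refl) auto
    also have "\<dots> = (\<Sum>k<n. complex_of_real ((a k)\<^sup>2) * u k x * cnj (u k y))"
      by (simp add: power2_eq_square mult_ac)
    finally show ?thesis .
  qed
  have "trace_norm A = (\<Sum>k<n. sqrt (Re (complex_of_real ((a k)\<^sup>2))))"
    unfolding trace_norm_def
    by (rule spec_sum_diagonalized[OF _ on compl sq]) (use A in \<open>auto intro!: mult_carrier_mat[of _ _ n]\<close>)
  then have tn: "trace_norm A = (\<Sum>k<n. \<bar>a k\<bar>)" by simp
  define W where "W = (\<lambda>y x. \<Sum>k<n. complex_of_real (sgn (a k)) * u k y * cnj (u k x))"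
  have "contraction {..<n} W"
    unfolding contraction_def
  proof (intro allI)
    fix v w
    have "mv {..<n} W w = (\<lambda>y. \<Sum>k<n. (complex_of_real (sgn (a k)) * ip {..<n} (u k) w) * u k y)"
      unfolding mv_def W_def ip_def sum_distrib_left sum_distrib_right
      by (subst sum.swap) (simp add: mult_ac)
    then have "ip {..<n} v (mv {..<n} W w)
        = (\<Sum>k<n. (complex_of_real (sgn (a k)) * ip {..<n} v (u k)) * ip {..<n} (u k) w)"
      by (simp only: ip_sum_right ip_scale_right) (simp only: mult_ac)
    then have "cmod (ip {..<n} v (mv {..<n} W w))
       \<le> sqrt (\<Sum>k<n. (cmod (complex_of_real (sgn (a k)) * ip {..<n} v (u k)))\<^sup>2) * sqrt (\<Sum>k<n. (cmod (ip {..<n} (u k) w))\<^sup>2)"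
      using cmod_sum_mult_le_sqrt[of "\<lambda>k. complex_of_real (sgn (a k)) * ip {..<n} v (u k)" "\<lambda>k. ip {..<n} (u k) w" "{..<n}"]
      by simp
    also have "\<dots> \<le> nrm {..<n} v * nrm {..<n} w"
    proof (rule mult_mono)
      have "(cmod (complex_of_real (sgn (a k)) * ip {..<n} v (u k)))\<^sup>2 \<le> (cmod (ip {..<n} (u k) v))\<^sup>2" for k
        using ip_cnj[of "{..<n}" v "u k"]
        by (auto simp: norm_mult sgn_real_def) (metis complex_mod_cnj order_refl)+
      then have "(\<Sum>k<n. (cmod (complex_of_real (sgn (a k)) * ip {..<n} v (u k)))\<^sup>2) \<le> (\<Sum>k<n. (cmod (ip {..<n} (u k) v))\<^sup>2)"
        by (intro sum_mono)
      also have "\<dots> \<le> (nrm {..<n} v)\<^sup>2" using on by (intro bessel) auto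
      finally show "sqrt (\<Sum>k<n. (cmod (complex_of_real (sgn (a k)) * ip {..<n} v (u k)))\<^sup>2) \<le> nrm {..<n} v"
        using real_le_lsqrt real_sqrt_le_iff[of _ "(nrm {..<n} v)\<^sup>2"] by simp
      have "(\<Sum>k<n. (cmod (ip {..<n} (u k) w))\<^sup>2) \<le> (nrm {..<n} w)\<^sup>2" using on by (intro bessel) auto
      then show "sqrt (\<Sum>k<n. (cmod (ip {..<n} (u k) w))\<^sup>2) \<le> nrm {..<n} w"
        using real_sqrt_le_iff[of _ "(nrm {..<n} w)\<^sup>2"] by simp
    qed (auto intro!: sum_nonneg)
    finally show "cmod (ip {..<n} v (mv {..<n} W w)) \<le> nrm {..<n} v * nrm {..<n} w" .
  qed
  moreover have "complex_of_real (trace_norm A) = (\<Sum>x<n. \<Sum>y<n. A $$ (x, y) * W y x)"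
  proof -
    have "(\<Sum>x<n. \<Sum>y<n. A $$ (x, y) * W y x)
        = (\<Sum>x<n. \<Sum>y<n. \<Sum>k<n. \<Sum>k'<n. (a k * sgn (a k')) * ((cnj (u k' x) * u k x) * (cnj (u k y) * u k' y)))"
    proof (rule sum.cong[OF refl], rule sum.cong[OF refl])
      fix x y assume "x \<in> {..<n}" "y \<in> {..<n}"
      then have x: "x < n" and y: "y < n" by auto
      show "A $$ (x, y) * W y x = (\<Sum>k<n. \<Sum>k'<n. (a k * sgn (a k')) * ((cnj (u k' x) * u k x) * (cnj (u k y) * u k' y)))"
        unfolding ent[OF x y] W_def sum_product
        by (intro sum.cong refl) (simp only: of_real_mult mult_ac)
    qed
    also have "\<dots> = (\<Sum>k<n. \<Sum>k'<n. \<Sum>x<n. \<Sum>y<n. (a k * sgn (a k')) * ((cnj (u k' x) * u k x) * (cnj (u k y) * u k' y)))"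
    proof -
      have sw: "(\<Sum>x<n. \<Sum>y<n. \<Sum>k<n. \<Sum>k'<n. g x y k k') = (\<Sum>k<n. \<Sum>k'<n. \<Sum>x<n. \<Sum>y<n. g x y k k')"
        for g :: "nat \<Rightarrow> nat \<Rightarrow> nat \<Rightarrow> nat \<Rightarrow> complex"
        unfolding sum.cartesian_product by (rule sum.reindex_bij_witness
            [of _ "\<lambda>(k, k', x, y). (x, y, k, k')" "\<lambda>(x, y, k, k'). (k, k', x, y)"]) auto
      show ?thesis by (rule sw)
    qed
    also have "\<dots> = (\<Sum>k<n. \<Sum>k'<n. if k = k' then complex_of_real (a k * sgn (a k)) else 0)"
      unfolding sum_distrib_left[symmetric] sum_product[symmetric]
      using ipu by (intro sum.cong refl) auto
    also have "\<dots> = complex_of_real (\<Sum>k<n. \<bar>a k\<bar>)"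
      by (simp add: abs_sgn)
    finally show ?thesis unfolding tn by simp
  qed
  ultimately show ?thesis using that by blast
qed

section \<open>Privacy amplification\<close>

text \<open>Splitting off the value at one point turns averages over random functions into
  inductions over the domain.\<close>

lemma sum_PiE_insert:
  assumes "x \<notin> S" "finite S" "finite (T x)" "\<And>s. s \<in> S \<Longrightarrow> finite (T s)"
  shows "(\<Sum>F\<in>PiE (insert x S) T. \<phi> F) = (\<Sum>c\<in>T x. \<Sum>F\<in>PiE S T. \<phi> (F(x := c)))"
proof -
  have "(\<Sum>F\<in>PiE (insert x S) T. \<phi> F) = sum \<phi> ((\<lambda>(y, g). g(x := y)) ` (T x \<times> PiE S T))"
    by (simp add: PiE_insert_eq)
  also have "\<dots> = (\<Sum>(c, F)\<in>T x \<times> PiE S T. \<phi> (F(x := c)))"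
    using inj_combinator[OF assms(1), of T]
    by (subst sum.reindex) (auto simp: case_prod_unfold)
  also have "\<dots> = (\<Sum>c\<in>T x. \<Sum>F\<in>PiE S T. \<phi> (F(x := c)))"
    by (simp add: sum.cartesian_product)
  finally show ?thesis .
qed

lemma exists_le_average:
  fixes \<phi> :: "'a \<Rightarrow> real"
  assumes "finite S" "S \<noteq> {}" "(\<Sum>s\<in>S. \<phi> s) \<le> real (card S) * c"
  shows "\<exists>s\<in>S. \<phi> s \<le> c"
proof (rule ccontr)
  assume "\<not> ?thesis"
  then have "(\<Sum>s\<in>S. c) < (\<Sum>s\<in>S. \<phi> s)" using assms by (intro sum_strict_mono) auto
  then show False using assms by simp
qed

lemma cmod_add_power2: "(cmod (z + complex_of_real t * g))\<^sup>2
    = (cmod z)\<^sup>2 + 2 * t * Re (z * cnj g) + t\<^sup>2 * (cmod g)\<^sup>2"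
  unfolding cmod_power2 by (simp add: power2_eq_square algebra_simps)

text \<open>The centred indicator of \<open>F x = k\<close> has mean zero over the value of
  \<open>F x\<close>, so mixed terms of different x cancel and only the diagonal remains. Its mean
  square is (1 - 1/\<kappa>)/\<kappa>, which is why the sum over the \<kappa> values of k costs no
  factor \<kappa>.\<close>

lemma random_key_second_moment:
  fixes \<kappa> :: nat and g :: "'x \<Rightarrow> complex"
  assumes "finite X" and \<kappa>: "\<kappa> \<ge> 1"
  shows "(\<Sum>F\<in>PiE X (\<lambda>_. {..<\<kappa>}). \<Sum>k<\<kappa>. (cmod (\<Sum>x\<in>X. complex_of_real ((if F x = k then 1 else 0) - 1 / \<kappa>) * g x))\<^sup>2)
    \<le> real (\<kappa> ^ card X) * (\<Sum>x\<in>X. (cmod (g x))\<^sup>2)"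
  using \<open>finite X\<close>
proof (induction X rule: finite_induct)
  case empty
  then show ?case by simp
next
  case (insert x0 X)
  let ?t = "\<lambda>c k. (if c = k then 1 else 0) - 1 / real \<kappa>"
  let ?z = "\<lambda>F k. \<Sum>x\<in>X. complex_of_real (?t (F x) k) * g x"
  have t1: "(\<Sum>c<\<kappa>. ?t c k) = 0" if "k < \<kappa>" for k
    using that \<kappa> by (simp add: sum_subtractf)
  have t2: "(\<Sum>c<\<kappa>. (?t c k)\<^sup>2) \<le> 1" if "k < \<kappa>" for k
  proof -
    have "(\<Sum>c<\<kappa>. (?t c k)\<^sup>2) = (\<Sum>c<\<kappa>. (if c = k then 1 - 2 / \<kappa> else 0) + (1 / \<kappa>)\<^sup>2)"
      by (intro sum.cong refl) (auto simp: power2_eq_square algebra_simps)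
    also have "\<dots> = (1 - 2 / \<kappa>) + \<kappa> * (1 / \<kappa>)\<^sup>2"
      using that by (simp add: sum.distrib)
    also have "\<dots> = 1 - 1 / \<kappa>" using \<kappa> by (simp add: power2_eq_square field_simps)
    finally show ?thesis by simp
  qed
  have z_upd: "(\<Sum>x\<in>X. complex_of_real (?t ((F(x0 := c)) x) k) * g x) = ?z F k" for F c k
    using insert.hyps by (intro sum.cong refl) auto
  have ins: "(\<Sum>x\<in>insert x0 X. complex_of_real (?t ((F(x0 := c)) x) k) * g x)
      = ?z F k + complex_of_real (?t c k) * g x0" for F c k
    by (subst sum.insert[OF insert.hyps]) (simp only: z_upd fun_upd_same add.commute)
  have "(\<Sum>F\<in>PiE (insert x0 X) (\<lambda>_. {..<\<kappa>}). \<Sum>k<\<kappa>. (cmod (\<Sum>x\<in>insert x0 X. complex_of_real (?t (F x) k) * g x))\<^sup>2)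
     = (\<Sum>c<\<kappa>. \<Sum>F\<in>PiE X (\<lambda>_. {..<\<kappa>}). \<Sum>k<\<kappa>. (cmod (?z F k + complex_of_real (?t c k) * g x0))\<^sup>2)"
    unfolding sum_PiE_insert[OF insert.hyps(2,1), of "\<lambda>_. {..<\<kappa>}", OF finite_lessThan finite_lessThan]
    by (simp only: ins)
  also have "\<dots> = (\<Sum>F\<in>PiE X (\<lambda>_. {..<\<kappa>}). \<Sum>k<\<kappa>. \<Sum>c<\<kappa>. (cmod (?z F k + complex_of_real (?t c k) * g x0))\<^sup>2)"
    by (subst sum.swap, rule sum.cong[OF refl], rule sum.swap)
  also have "\<dots> = (\<Sum>F\<in>PiE X (\<lambda>_. {..<\<kappa>}). \<Sum>k<\<kappa>. \<kappa> * (cmod (?z F k))\<^sup>2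
        + 2 * (\<Sum>c<\<kappa>. ?t c k) * Re (?z F k * cnj (g x0)) + (\<Sum>c<\<kappa>. (?t c k)\<^sup>2) * (cmod (g x0))\<^sup>2)"
    unfolding cmod_add_power2 sum.distrib sum_distrib_left sum_distrib_right by simp
  also have "\<dots> \<le> (\<Sum>F\<in>PiE X (\<lambda>_. {..<\<kappa>}). \<Sum>k<\<kappa>. \<kappa> * (cmod (?z F k))\<^sup>2 + (cmod (g x0))\<^sup>2)"
    using t1 t2 by (intro sum_mono) (auto intro!: mult_left_le_one_le sum_nonneg)
  also have "\<dots> = \<kappa> * (\<Sum>F\<in>PiE X (\<lambda>_. {..<\<kappa>}). \<Sum>k<\<kappa>. (cmod (?z F k))\<^sup>2) + \<kappa> ^ card X * \<kappa> * (cmod (g x0))\<^sup>2"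
    using insert.hyps by (simp add: sum.distrib sum_distrib_left card_PiE)
  also have "\<dots> \<le> \<kappa> * (\<kappa> ^ card X * (\<Sum>x\<in>X. (cmod (g x))\<^sup>2)) + \<kappa> ^ card X * \<kappa> * (cmod (g x0))\<^sup>2"
    using insert.IH by (intro add_right_mono mult_left_mono) auto
  also have "\<dots> = real (\<kappa> ^ card (insert x0 X)) * (\<Sum>x\<in>insert x0 X. (cmod (g x))\<^sup>2)"
    using insert.hyps by (simp add: algebra_simps)
  finally show ?case .
qed

text \<open>Everything is controlled by testing against contractions: the unit vectors are cut down to the
  span of the f j, where the Cauchy--Schwarz inequality costs only the factor sqrt (card J).\<close>

lemma contraction_sum_bound:
  fixes b :: "'c \<Rightarrow> 'z \<Rightarrow> real" and l :: "'z \<Rightarrow> real"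
  assumes fin: "finite C" "finite Z" "finite J"
    and b: "\<And>z. z \<in> Z \<Longrightarrow> (\<Sum>c\<in>C. \<bar>b c z\<bar>) \<le> 2"
    and l: "\<And>z. z \<in> Z \<Longrightarrow> 0 \<le> l z" and l1: "(\<Sum>z\<in>Z. l z) = 1"
    and e: "\<And>z. z \<in> Z \<Longrightarrow> ip Q (e z) (e z) = 1"
    and f: "\<And>i j. i \<in> J \<Longrightarrow> j \<in> J \<Longrightarrow> ip Q (f i) (f j) = (if i = j then 1 else 0)"
    and W: "\<And>c. c \<in> C \<Longrightarrow> contraction Q (W c)"
  shows "cmod (\<Sum>c\<in>C. \<Sum>z\<in>Z. complex_of_real (b c z * l z) * ip Q (e z) (mv Q (W c) (e z)))
    \<le> 2 * (\<Sum>z\<in>{z\<in>Z. \<not> T z}. l z)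
      + 4 * sqrt (\<Sum>z\<in>Z. l z * (1 - (\<Sum>j\<in>J. (cmod (ip Q (f j) (e z)))\<^sup>2)))
      + sqrt (card C * card J) * sqrt (\<Sum>c\<in>C. \<Sum>i\<in>J. \<Sum>j\<in>J.
          (cmod (\<Sum>z\<in>{z\<in>Z. T z}. complex_of_real (b c z * l z) * (cnj (ip Q (f i) (e z)) * ip Q (f j) (e z))))\<^sup>2)"
proof -
  define p where "p = (\<lambda>z a. \<Sum>j\<in>J. ip Q (f j) (e z) * f j a)"
  define r where "r = (\<lambda>z a. e z a - p z a)"
  define w where "w = (\<lambda>c z. complex_of_real (b c z * l z))"
  have nrm_e: "nrm Q (e z) = 1" if "z \<in> Z" for z using e[OF that] by (rule nrm_unit)
  have r2: "(nrm Q (r z))\<^sup>2 = 1 - (\<Sum>j\<in>J. (cmod (ip Q (f j) (e z)))\<^sup>2)" if "z \<in> Z" for z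
    unfolding r_def p_def using nrm_residual[OF fin(3) f, of "e z"] nrm_e[OF that] by simp
  have nrm_p: "nrm Q (p z) \<le> 1" if "z \<in> Z" for z
  proof -
    have "(nrm Q (p z))\<^sup>2 = (\<Sum>j\<in>J. (cmod (ip Q (f j) (e z)))\<^sup>2)"
      unfolding p_def by (rule nrm_combination[OF fin(3) f])
    also have "\<dots> \<le> 1" using bessel[OF fin(3) f, of "e z"] nrm_e[OF that] by simp
    finally show ?thesis by (simp add: power_le_one_iff abs_square_le_1)
  qed
  \<comment> \<open>Both arguments are cut down one after the other, so each of the two errors
    carries a single \<open>r z\<close> next to a vector of norm at most 1.\<close>
  have split: "ip Q (e z) (mv Q (W c) (e z)) = ip Q (p z) (mv Q (W c) (p z))
      + (ip Q (p z) (mv Q (W c) (r z)) + ip Q (r z) (mv Q (W c) (e z)))" for c z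
  proof -
    have ez: "e z = (\<lambda>a. p z a + r z a)" by (simp add: r_def)
    have "ip Q (e z) (mv Q (W c) (e z)) = ip Q (p z) (mv Q (W c) (e z)) + ip Q (r z) (mv Q (W c) (e z))"
      by (subst ez) (simp only: ip_add_left)
    also have "ip Q (p z) (mv Q (W c) (e z)) = ip Q (p z) (mv Q (W c) (p z)) + ip Q (p z) (mv Q (W c) (r z))"
      by (subst ez) (simp only: mv_add ip_add_right)
    finally show ?thesis by simp
  qed
  have err: "cmod (ip Q (p z) (mv Q (W c) (r z)) + ip Q (r z) (mv Q (W c) (e z))) \<le> 2 * nrm Q (r z)"
    if "z \<in> Z" "c \<in> C" for z c
  proof -
    have "cmod (ip Q (p z) (mv Q (W c) (r z))) \<le> nrm Q (p z) * nrm Q (r z)"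
      using W[OF that(2)] unfolding contraction_def by blast
    also have "\<dots> \<le> nrm Q (r z)" using nrm_p[OF that(1)] by (simp add: mult_left_le_one_le)
    finally have 1: "cmod (ip Q (p z) (mv Q (W c) (r z))) \<le> nrm Q (r z)" .
    have "cmod (ip Q (r z) (mv Q (W c) (e z))) \<le> nrm Q (r z) * nrm Q (e z)"
      using W[OF that(2)] unfolding contraction_def by blast
    then have 2: "cmod (ip Q (r z) (mv Q (W c) (e z))) \<le> nrm Q (r z)" using nrm_e[OF that(1)] by simp
    show ?thesis using norm_triangle_ineq 1 2 by (smt (verit))
  qed
  have full: "cmod (ip Q (e z) (mv Q (W c) (e z))) \<le> 1" if "z \<in> Z" "c \<in> C" for z c
    using W[OF that(2)] nrm_e[OF that(1)] unfolding contraction_def by (metis mult_1)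
  let ?Z1 = "{z\<in>Z. T z}" and ?Z0 = "{z\<in>Z. \<not> T z}"
  \<comment> \<open>For each z the coefficients \<open>b c z\<close> have total modulus at most 2,
    so these error terms pick up no factor for the number of keys or announcements.\<close>
  have weighted: "cmod (\<Sum>c\<in>C. \<Sum>z\<in>Z'. w c z * h c z) \<le> (\<Sum>z\<in>Z'. 2 * (l z * B z))"
    if "Z' \<subseteq> Z" and hB: "\<And>c z. c \<in> C \<Longrightarrow> z \<in> Z \<Longrightarrow> cmod (h c z) \<le> B z" and B0: "\<And>z. z \<in> Z \<Longrightarrow> 0 \<le> B z"
    for Z' h and B :: "'z \<Rightarrow> real"
  proof -
    have "cmod (\<Sum>c\<in>C. \<Sum>z\<in>Z'. w c z * h c z) \<le> (\<Sum>c\<in>C. \<Sum>z\<in>Z'. \<bar>b c z\<bar> * (l z * B z))"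
    proof (intro order_trans[OF norm_sum] sum_mono)
      fix c z assume "c \<in> C" "z \<in> Z'"
      then have "z \<in> Z" using that by auto
      then show "cmod (w c z * h c z) \<le> \<bar>b c z\<bar> * (l z * B z)"
        using l[of z] hB[OF \<open>c \<in> C\<close>, of z]
        by (simp add: w_def norm_mult abs_mult mult.assoc mult_left_mono del: of_real_mult)
    qed
    also have "\<dots> = (\<Sum>z\<in>Z'. (\<Sum>c\<in>C. \<bar>b c z\<bar>) * (l z * B z))"
      by (subst sum.swap) (simp add: sum_distrib_right)
    also have "\<dots> \<le> (\<Sum>z\<in>Z'. 2 * (l z * B z))"
      using that b l B0 by (intro sum_mono mult_right_mono mult_nonneg_nonneg) auto
    finally show ?thesis .
  qed
  have atyp: "cmod (\<Sum>c\<in>C. \<Sum>z\<in>?Z0. w c z * ip Q (e z) (mv Q (W c) (e z))) \<le> 2 * (\<Sum>z\<in>?Z0. l z)"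
    using weighted[of ?Z0 "\<lambda>c z. ip Q (e z) (mv Q (W c) (e z))" "\<lambda>_. 1"] full
    by (simp add: sum_distrib_left)
  have errs: "cmod (\<Sum>c\<in>C. \<Sum>z\<in>?Z1. w c z * (ip Q (p z) (mv Q (W c) (r z)) + ip Q (r z) (mv Q (W c) (e z))))
      \<le> 4 * sqrt (\<Sum>z\<in>Z. l z * (1 - (\<Sum>j\<in>J. (cmod (ip Q (f j) (e z)))\<^sup>2)))"
  proof -
    have "cmod (\<Sum>c\<in>C. \<Sum>z\<in>?Z1. w c z * (ip Q (p z) (mv Q (W c) (r z)) + ip Q (r z) (mv Q (W c) (e z))))
        \<le> (\<Sum>z\<in>?Z1. 2 * (l z * (2 * nrm Q (r z))))"
      using err by (intro weighted) auto
    also have "\<dots> \<le> (\<Sum>z\<in>Z. 2 * (l z * (2 * nrm Q (r z))))"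
      using fin l by (intro sum_mono2) auto
    \<comment> \<open>Writing \<open>l z\<close> as a product of two square roots and applying
      Cauchy-Schwarz puts the root outside the average, so that only the mean lost weight
      enters.\<close>
    also have "\<dots> = 4 * (\<Sum>z\<in>Z. \<bar>sqrt (l z)\<bar> * \<bar>sqrt (l z) * nrm Q (r z)\<bar>)"
      using l by (simp add: sum_distrib_left abs_mult mult.assoc[symmetric] cong: sum.cong)
    also have "\<dots> \<le> 4 * (sqrt (\<Sum>z\<in>Z. (sqrt (l z))\<^sup>2) * sqrt (\<Sum>z\<in>Z. (sqrt (l z) * nrm Q (r z))\<^sup>2))"
      by (intro mult_left_mono sum_mult_le_sqrt) simp
    also have "(\<Sum>z\<in>Z. (sqrt (l z))\<^sup>2) = 1" using l l1 by simp
    also have "(\<Sum>z\<in>Z. (sqrt (l z) * nrm Q (r z))\<^sup>2) = (\<Sum>z\<in>Z. l z * (1 - (\<Sum>j\<in>J. (cmod (ip Q (f j) (e z)))\<^sup>2)))"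
      using l r2 by (intro sum.cong refl) (simp add: power_mult_distrib)
    finally show ?thesis by simp
  qed
  define G where "G = (\<lambda>c i j. \<Sum>z\<in>?Z1. w c z * (cnj (ip Q (f i) (e z)) * ip Q (f j) (e z)))"
  define V where "V = (\<lambda>c i j. ip Q (f i) (mv Q (W c) (f j)))"
  have pWp: "ip Q (p z) (mv Q (W c) (p z))
      = (\<Sum>i\<in>J. \<Sum>j\<in>J. V c i j * (cnj (ip Q (f i) (e z)) * ip Q (f j) (e z)))" for c z
    unfolding p_def mv_sum mv_scale ip_sum_left ip_sum_right ip_scale_left ip_scale_right V_def
    by (simp add: sum_distrib_left mult_ac)
  have "(\<Sum>c\<in>C. \<Sum>z\<in>?Z1. w c z * ip Q (p z) (mv Q (W c) (p z)))
      = (\<Sum>c\<in>C. \<Sum>i\<in>J. \<Sum>j\<in>J. V c i j * G c i j)"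
  proof (intro sum.cong refl)
    fix c
    have "(\<Sum>z\<in>?Z1. w c z * ip Q (p z) (mv Q (W c) (p z)))
        = (\<Sum>z\<in>?Z1. \<Sum>i\<in>J. \<Sum>j\<in>J. V c i j * (w c z * (cnj (ip Q (f i) (e z)) * ip Q (f j) (e z))))"
      unfolding pWp by (simp add: sum_distrib_left mult_ac)
    also have "\<dots> = (\<Sum>i\<in>J. \<Sum>j\<in>J. \<Sum>z\<in>?Z1. V c i j * (w c z * (cnj (ip Q (f i) (e z)) * ip Q (f j) (e z))))"
      by (subst sum.swap, rule sum.cong[OF refl], rule sum.swap)
    finally show "(\<Sum>z\<in>?Z1. w c z * ip Q (p z) (mv Q (W c) (p z))) = (\<Sum>i\<in>J. \<Sum>j\<in>J. V c i j * G c i j)"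
      by (simp add: G_def sum_distrib_left)
  qed
  \<comment> \<open>One Cauchy-Schwarz inequality over all triples: the entries \<open>V\<close>
    have total square at most \<open>card C * card J\<close>, because each column of a compressed
    contraction has length at most 1.\<close>
  also have "\<dots> = (\<Sum>t\<in>C \<times> J \<times> J. (case t of (c, i, j) \<Rightarrow> V c i j) * (case t of (c, i, j) \<Rightarrow> G c i j))"
    by (simp add: sum.cartesian_product case_prod_unfold)
  finally have "cmod (\<Sum>c\<in>C. \<Sum>z\<in>?Z1. w c z * ip Q (p z) (mv Q (W c) (p z)))
      \<le> sqrt (\<Sum>t\<in>C \<times> J \<times> J. (cmod (case t of (c, i, j) \<Rightarrow> V c i j))\<^sup>2)
        * sqrt (\<Sum>t\<in>C \<times> J \<times> J. (cmod (case t of (c, i, j) \<Rightarrow> G c i j))\<^sup>2)"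
    using cmod_sum_mult_le_sqrt by metis
  also have "(\<Sum>t\<in>C \<times> J \<times> J. (cmod (case t of (c, i, j) \<Rightarrow> G c i j))\<^sup>2) = (\<Sum>c\<in>C. \<Sum>i\<in>J. \<Sum>j\<in>J. (cmod (G c i j))\<^sup>2)"
    by (simp add: sum.cartesian_product case_prod_unfold)
  also have "(\<Sum>t\<in>C \<times> J \<times> J. (cmod (case t of (c, i, j) \<Rightarrow> V c i j))\<^sup>2) = (\<Sum>c\<in>C. \<Sum>j\<in>J. \<Sum>i\<in>J. (cmod (V c i j))\<^sup>2)"
  proof -
    have "(\<Sum>t\<in>C \<times> J \<times> J. (cmod (case t of (c, i, j) \<Rightarrow> V c i j))\<^sup>2) = (\<Sum>c\<in>C. \<Sum>i\<in>J. \<Sum>j\<in>J. (cmod (V c i j))\<^sup>2)"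
      by (simp add: sum.cartesian_product case_prod_unfold)
    also have "\<dots> = (\<Sum>c\<in>C. \<Sum>j\<in>J. \<Sum>i\<in>J. (cmod (V c i j))\<^sup>2)"
      by (rule sum.cong[OF refl], rule sum.swap)
    finally show ?thesis .
  qed
  also have "sqrt \<dots> \<le> sqrt (card C * card J)"
  proof -
    have "(\<Sum>c\<in>C. \<Sum>j\<in>J. \<Sum>i\<in>J. (cmod (V c i j))\<^sup>2) \<le> (\<Sum>c\<in>C. \<Sum>j\<in>J. 1)"
      unfolding V_def using W f fin by (intro sum_mono contraction_compress_le) auto
    then show ?thesis by simp
  qed
  finally have main: "cmod (\<Sum>c\<in>C. \<Sum>z\<in>?Z1. w c z * ip Q (p z) (mv Q (W c) (p z)))
      \<le> sqrt (card C * card J) * sqrt (\<Sum>c\<in>C. \<Sum>i\<in>J. \<Sum>j\<in>J. (cmod (G c i j))\<^sup>2)"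
    by (simp add: mult_right_mono sum_nonneg)
  have Zs: "(\<Sum>z\<in>Z. F z) = (\<Sum>z\<in>?Z0. F z) + (\<Sum>z\<in>?Z1. F z)" for F :: "'z \<Rightarrow> complex"
  proof -
    have u: "?Z0 \<union> ?Z1 = Z" by auto
    have "(\<Sum>z\<in>?Z0 \<union> ?Z1. F z) = (\<Sum>z\<in>?Z0. F z) + (\<Sum>z\<in>?Z1. F z)"
      by (rule sum.union_disjoint) (use fin in auto)
    then show ?thesis unfolding u .
  qed
  have "(\<Sum>c\<in>C. \<Sum>z\<in>Z. w c z * ip Q (e z) (mv Q (W c) (e z)))
      = (\<Sum>c\<in>C. \<Sum>z\<in>?Z0. w c z * ip Q (e z) (mv Q (W c) (e z)))
      + ((\<Sum>c\<in>C. \<Sum>z\<in>?Z1. w c z * ip Q (p z) (mv Q (W c) (p z)))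
      + (\<Sum>c\<in>C. \<Sum>z\<in>?Z1. w c z * (ip Q (p z) (mv Q (W c) (r z)) + ip Q (r z) (mv Q (W c) (e z)))))"
    unfolding Zs sum.distrib[symmetric] by (intro sum.cong refl arg_cong2[where f = "(+)"])
      (simp only: split distrib_left)
  then have "cmod (\<Sum>c\<in>C. \<Sum>z\<in>Z. w c z * ip Q (e z) (mv Q (W c) (e z)))
      \<le> cmod (\<Sum>c\<in>C. \<Sum>z\<in>?Z0. w c z * ip Q (e z) (mv Q (W c) (e z)))
      + (cmod (\<Sum>c\<in>C. \<Sum>z\<in>?Z1. w c z * ip Q (p z) (mv Q (W c) (p z)))
      + cmod (\<Sum>c\<in>C. \<Sum>z\<in>?Z1. w c z * (ip Q (p z) (mv Q (W c) (r z)) + ip Q (r z) (mv Q (W c) (e z)))))"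
    by (simp only:) (intro order_trans[OF norm_triangle_ineq] add_left_mono norm_triangle_ineq)
  then show ?thesis using atyp errs main unfolding G_def w_def by linarith
qed

text \<open>Compression cannot increase the Hilbert-Schmidt norm: Bessel in \<open>j'\<close>
  against the vector collected in \<open>?w\<close>, orthonormality of the \<open>e i\<close> to
  evaluate its norm, and Bessel in \<open>j\<close> at the end. It is applied to one outcome at a
  time, since eigenvectors of different outcomes need not be orthogonal.\<close>

lemma compressed_ensemble_bound:
  fixes l :: "'i \<Rightarrow> real"
  assumes fin: "finite I" "finite J"
    and e: "\<And>i j. i \<in> I \<Longrightarrow> j \<in> I \<Longrightarrow> ip Q (e i) (e j) = (if i = j then 1 else 0)"
    and f: "\<And>i j. i \<in> J \<Longrightarrow> j \<in> J \<Longrightarrow> ip Q (f i) (f j) = (if i = j then 1 else 0)"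
  shows "(\<Sum>j\<in>J. \<Sum>j'\<in>J. (cmod (\<Sum>i\<in>I. l i * (cnj (ip Q (f j) (e i)) * ip Q (f j') (e i))))\<^sup>2) \<le> (\<Sum>i\<in>I. (l i)\<^sup>2)"
proof -
  have "(\<Sum>j'\<in>J. (cmod (\<Sum>i\<in>I. l i * (cnj (ip Q (f j) (e i)) * ip Q (f j') (e i))))\<^sup>2)
      \<le> (\<Sum>i\<in>I. (l i)\<^sup>2 * (cmod (ip Q (f j) (e i)))\<^sup>2)" if "j \<in> J" for j
  proof -
    let ?w = "\<lambda>a. \<Sum>i\<in>I. (l i * cnj (ip Q (f j) (e i))) * e i a"
    have "(\<Sum>i\<in>I. l i * (cnj (ip Q (f j) (e i)) * ip Q (f j') (e i))) = ip Q (f j') ?w" for j'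
      unfolding ip_sum_right ip_scale_right by (simp add: mult_ac)
    then have "(\<Sum>j'\<in>J. (cmod (\<Sum>i\<in>I. l i * (cnj (ip Q (f j) (e i)) * ip Q (f j') (e i))))\<^sup>2)
        = (\<Sum>j'\<in>J. (cmod (ip Q (f j') ?w))\<^sup>2)" by simp
    also have "\<dots> \<le> (nrm Q ?w)\<^sup>2" using fin f by (intro bessel) auto
    also have "\<dots> = (\<Sum>i\<in>I. (cmod (l i * cnj (ip Q (f j) (e i))))\<^sup>2)"
      using fin e by (intro nrm_combination) auto
    finally show ?thesis by (simp add: norm_mult power_mult_distrib)
  qed
  then have "(\<Sum>j\<in>J. \<Sum>j'\<in>J. (cmod (\<Sum>i\<in>I. l i * (cnj (ip Q (f j) (e i)) * ip Q (f j') (e i))))\<^sup>2)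
      \<le> (\<Sum>j\<in>J. \<Sum>i\<in>I. (l i)\<^sup>2 * (cmod (ip Q (f j) (e i)))\<^sup>2)" by (intro sum_mono)
  also have "\<dots> = (\<Sum>i\<in>I. (l i)\<^sup>2 * (\<Sum>j\<in>J. (cmod (ip Q (f j) (e i)))\<^sup>2))"
    by (subst sum.swap) (simp add: sum_distrib_left)
  also have "\<dots> \<le> (\<Sum>i\<in>I. (l i)\<^sup>2 * 1)"
  proof (intro sum_mono mult_left_mono)
    fix i assume "i \<in> I"
    then have "nrm Q (e i) = 1" using e by (intro nrm_unit) simp
    then show "(\<Sum>j\<in>J. (cmod (ip Q (f j) (e i)))\<^sup>2) \<le> 1" using bessel[OF fin(2) f, of "e i"] by simp
  qed simp
  finally show ?thesis by simp
qed

text \<open>By trace-norm duality this bounds the trace distance between the joint state of the key \<open>K\<close>, the announcement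
  \<open>h\<close> and the quantum system, and the same state with the key replaced by an independent uniform one; \<open>W\<close> ranges
  over the diagonal blocks of the contractions on the whole system.\<close>

definition key_insecurity_le ::
  "nat \<Rightarrow> 'y set \<Rightarrow> 'q set \<Rightarrow> 'z set \<Rightarrow> ('z \<Rightarrow> real) \<Rightarrow> ('z \<Rightarrow> 'q \<Rightarrow> complex) \<Rightarrow> ('z \<Rightarrow> 'y) \<Rightarrow> ('z \<Rightarrow> nat) \<Rightarrow> real \<Rightarrow> bool" where
  "key_insecurity_le \<kappa> Y Q Z l e h K B \<longleftrightarrow> (\<forall>W. (\<forall>c\<in>{..<\<kappa>} \<times> Y. contraction Q (W c)) \<longrightarrow>
    cmod (\<Sum>c\<in>{..<\<kappa>} \<times> Y. \<Sum>z\<in>Z.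
      complex_of_real ((if h z = snd c then (if K z = fst c then 1 else 0) - 1 / \<kappa> else 0) * l z)
        * ip Q (e z) (mv Q (W c) (e z))) \<le> B)"

lemma key_insecurity_le_mono: "key_insecurity_le \<kappa> Y Q Z l e h K B \<Longrightarrow> B \<le> B' \<Longrightarrow> key_insecurity_le \<kappa> Y Q Z l e h K B'"
  unfolding key_insecurity_le_def by (meson order_trans)

text \<open>The three terms are the discarded weights, the part of the eigenvectors outside the span
  of the \<open>f j\<close>, and the Hilbert-Schmidt estimate on that span. The announcement is a
  fixed function of the outcome: in the average over \<open>F\<close> each outcome contributes at a
  single announcement, so \<open>card Y\<close> enters only through the Cauchy-Schwarz
  factor.\<close>

lemma privacy_amplification:
  fixes l :: "'x \<times> 'i \<Rightarrow> real" and \<kappa> :: nat and \<tau> :: real and h :: "'x \<Rightarrow> 'y" and J :: "'j set"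
  assumes fin: "finite X" "finite I" "finite Y" "finite J" and \<kappa>: "\<kappa> \<ge> 1"
    and l: "\<And>z. z \<in> X \<times> I \<Longrightarrow> 0 \<le> l z" and l1: "(\<Sum>z\<in>X \<times> I. l z) = 1"
    and e: "\<And>x i j. x \<in> X \<Longrightarrow> i \<in> I \<Longrightarrow> j \<in> I \<Longrightarrow> ip Q (e (x, i)) (e (x, j)) = (if i = j then 1 else 0)"
    and f: "\<And>i j. i \<in> J \<Longrightarrow> j \<in> J \<Longrightarrow> ip Q (f i) (f j) = (if i = j then 1 else 0)"
    and h: "\<And>x. x \<in> X \<Longrightarrow> h x \<in> Y"
    and T: "\<And>z. z \<in> X \<times> I \<Longrightarrow> T z \<Longrightarrow> l z \<le> \<tau>" and \<tau>: "0 \<le> \<tau>"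
  shows "\<exists>F\<in>PiE X (\<lambda>_. {..<\<kappa>}). key_insecurity_le \<kappa> Y Q (X \<times> I) l e (\<lambda>z. h (fst z)) (\<lambda>z. F (fst z))
      (2 * (\<Sum>z\<in>{z\<in>X \<times> I. \<not> T z}. l z)
      + 4 * sqrt (\<Sum>z\<in>X \<times> I. l z * (1 - (\<Sum>j\<in>J. (cmod (ip Q (f j) (e z)))\<^sup>2)))
      + sqrt (\<kappa> * card Y * card J * \<tau>))"
proof -
  define b where "b = (\<lambda>(F :: 'x \<Rightarrow> nat) (c::nat \<times> _) (z :: 'x \<times> 'i). (if h (fst z) = snd c then (if F (fst z) = fst c then 1 else 0) - 1 / real \<kappa> else 0))"
  \<comment> \<open>The truncated and compressed operator of outcome x, placed at the announcement
    \<open>h x\<close> and zero elsewhere. It contains no \<open>F\<close>, as the second-moment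
    bound demands.\<close>
  define g where "g = (\<lambda>y i j x. if h x = y then
      (\<Sum>n\<in>{n\<in>I. T (x, n)}. complex_of_real (l (x, n)) * (cnj (ip Q (f i) (e (x, n))) * ip Q (f j) (e (x, n)))) else 0)"
  define S where "S = (\<lambda>F. \<Sum>c\<in>{..<\<kappa>} \<times> Y. \<Sum>i\<in>J. \<Sum>j\<in>J.
     (cmod (\<Sum>z\<in>{z\<in>X \<times> I. T z}. complex_of_real (b F c z * l z) * (cnj (ip Q (f i) (e z)) * ip Q (f j) (e z))))\<^sup>2)"
  let ?P = "PiE X (\<lambda>_. {..<\<kappa>})"
  have cardP: "card ?P = \<kappa> ^ card X" using fin by (simp add: card_PiE)
  have inner: "(\<Sum>z\<in>{z\<in>X \<times> I. T z}. complex_of_real (b F (k, y) z * l z) * (cnj (ip Q (f i) (e z)) * ip Q (f j) (e z)))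
      = (\<Sum>x\<in>X. complex_of_real ((if F x = k then 1 else 0) - 1 / \<kappa>) * g y i j x)" for F k y i j
  proof -
    have "{z\<in>X \<times> I. T z} = Sigma X (\<lambda>x. {n\<in>I. T (x, n)})" by auto
    then have "(\<Sum>z\<in>{z\<in>X \<times> I. T z}. complex_of_real (b F (k, y) z * l z) * (cnj (ip Q (f i) (e z)) * ip Q (f j) (e z)))
      = (\<Sum>x\<in>X. \<Sum>n\<in>{n\<in>I. T (x, n)}. complex_of_real (b F (k, y) (x, n) * l (x, n)) * (cnj (ip Q (f i) (e (x, n))) * ip Q (f j) (e (x, n))))"
      using fin by (simp add: sum.Sigma case_prod_unfold)
    also have "\<dots> = (\<Sum>x\<in>X. complex_of_real ((if F x = k then 1 else 0) - 1 / \<kappa>) * g y i j x)"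
      by (intro sum.cong refl) (auto simp: b_def g_def sum_distrib_left mult_ac)
    finally show ?thesis .
  qed
  have "(\<Sum>F\<in>?P. S F) = (\<Sum>F\<in>?P. \<Sum>k<\<kappa>. \<Sum>y\<in>Y. \<Sum>i\<in>J. \<Sum>j\<in>J.
     (cmod (\<Sum>x\<in>X. complex_of_real ((if F x = k then 1 else 0) - 1 / \<kappa>) * g y i j x))\<^sup>2)"
  proof -
    have pairs: "(\<Sum>c\<in>{..<\<kappa>} \<times> Y. Z c) = (\<Sum>k<\<kappa>. \<Sum>y\<in>Y. Z (k, y))" for Z :: "nat \<times> 'y \<Rightarrow> real"
      by (simp add: sum.cartesian_product case_prod_unfold)
    show ?thesis unfolding S_def pairs inner ..
  qed
  also have "\<dots> = (\<Sum>F\<in>?P. \<Sum>t\<in>Y \<times> J \<times> J. \<Sum>k<\<kappa>.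
     (cmod (\<Sum>x\<in>X. complex_of_real ((if F x = k then 1 else 0) - 1 / \<kappa>) * g (fst t) (fst (snd t)) (snd (snd t)) x))\<^sup>2)"
  proof (intro sum.cong refl)
    fix F
    have "(\<Sum>k<\<kappa>. \<Sum>y\<in>Y. \<Sum>i\<in>J. \<Sum>j\<in>J. Z k y i j) = (\<Sum>t\<in>Y \<times> J \<times> J. \<Sum>k<\<kappa>. Z k (fst t) (fst (snd t)) (snd (snd t)))"
      for Z :: "nat \<Rightarrow> 'y \<Rightarrow> 'j \<Rightarrow> 'j \<Rightarrow> real"
      by (subst (2) sum.swap) (simp add: sum.cartesian_product case_prod_unfold)
    then show "(\<Sum>k<\<kappa>. \<Sum>y\<in>Y. \<Sum>i\<in>J. \<Sum>j\<in>J.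
     (cmod (\<Sum>x\<in>X. complex_of_real ((if F x = k then 1 else 0) - 1 / \<kappa>) * g y i j x))\<^sup>2)
     = (\<Sum>t\<in>Y \<times> J \<times> J. \<Sum>k<\<kappa>.
     (cmod (\<Sum>x\<in>X. complex_of_real ((if F x = k then 1 else 0) - 1 / \<kappa>) * g (fst t) (fst (snd t)) (snd (snd t)) x))\<^sup>2)" .
  qed
  also have "\<dots> = (\<Sum>t\<in>Y \<times> J \<times> J. \<Sum>F\<in>?P. \<Sum>k<\<kappa>.
     (cmod (\<Sum>x\<in>X. complex_of_real ((if F x = k then 1 else 0) - 1 / \<kappa>) * g (fst t) (fst (snd t)) (snd (snd t)) x))\<^sup>2)"
    by (rule sum.swap)
  also have "\<dots> \<le> (\<Sum>t\<in>Y \<times> J \<times> J. real (\<kappa> ^ card X) * (\<Sum>x\<in>X. (cmod (g (fst t) (fst (snd t)) (snd (snd t)) x))\<^sup>2))"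
    using fin \<kappa> by (intro sum_mono random_key_second_moment)
  also have "\<dots> = real (\<kappa> ^ card X) * (\<Sum>x\<in>X. \<Sum>y\<in>Y. \<Sum>i\<in>J. \<Sum>j\<in>J. (cmod (g y i j x))\<^sup>2)"
    unfolding sum_distrib_left[symmetric] by (subst sum.swap) (simp add: sum.cartesian_product case_prod_unfold)
  also have "\<dots> \<le> real (\<kappa> ^ card X) * (\<Sum>x\<in>X. \<Sum>n\<in>{n\<in>I. T (x, n)}. (l (x, n))\<^sup>2)"
  proof (intro mult_left_mono sum_mono)
    fix x assume x: "x \<in> X"
    have "(\<Sum>y\<in>Y. \<Sum>i\<in>J. \<Sum>j\<in>J. (cmod (g y i j x))\<^sup>2)
       = (\<Sum>y\<in>Y. if y = h x then (\<Sum>i\<in>J. \<Sum>j\<in>J. (cmod (g (h x) i j x))\<^sup>2) else 0)"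
      by (intro sum.cong refl) (auto simp: g_def)
    also have "\<dots> = (\<Sum>i\<in>J. \<Sum>j\<in>J. (cmod (g (h x) i j x))\<^sup>2)" using fin h[OF x] by simp
    also have "\<dots> \<le> (\<Sum>n\<in>{n\<in>I. T (x, n)}. (l (x, n))\<^sup>2)"
    proof -
      have gh: "g (h x) i j x = (\<Sum>n\<in>{n\<in>I. T (x, n)}. complex_of_real (l (x, n))
          * (cnj (ip Q (f i) (e (x, n))) * ip Q (f j) (e (x, n))))" for i j
        by (simp add: g_def)
      show ?thesis unfolding gh
        by (rule compressed_ensemble_bound[where l = "\<lambda>n. l (x, n)" and e = "\<lambda>n. e (x, n)"])
          (use fin e[OF x] f in auto)
    qed
    finally show "(\<Sum>y\<in>Y. \<Sum>i\<in>J. \<Sum>j\<in>J. (cmod (g y i j x))\<^sup>2) \<le> (\<Sum>n\<in>{n\<in>I. T (x, n)}. (l (x, n))\<^sup>2)" .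
  qed simp
  also have "\<dots> \<le> real (\<kappa> ^ card X) * \<tau>"
  proof (intro mult_left_mono)
    \<comment> \<open>The truncation acts here: on \<open>T\<close> a squared weight is at most
      \<tau> times the weight, and the weights sum to 1.\<close>
    have "(\<Sum>x\<in>X. \<Sum>n\<in>{n\<in>I. T (x, n)}. (l (x, n))\<^sup>2) \<le> (\<Sum>x\<in>X. \<Sum>n\<in>{n\<in>I. T (x, n)}. \<tau> * l (x, n))"
      using l T by (intro sum_mono) (auto simp: power2_eq_square intro!: mult_right_mono)
    also have "\<dots> \<le> (\<Sum>x\<in>X. \<Sum>n\<in>I. \<tau> * l (x, n))"
      using l \<tau> fin by (intro sum_mono sum_mono2) auto
    also have "\<dots> = \<tau> * (\<Sum>z\<in>X \<times> I. l z)"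
      by (simp add: sum_distrib_left sum.cartesian_product case_prod_unfold)
    finally show "(\<Sum>x\<in>X. \<Sum>n\<in>{n\<in>I. T (x, n)}. (l (x, n))\<^sup>2) \<le> \<tau>" using l1 by simp
  qed simp
  finally have "(\<Sum>F\<in>?P. S F) \<le> real (card ?P) * \<tau>" unfolding cardP .
  moreover have "?P \<noteq> {}" using \<kappa> by (auto simp: PiE_eq_empty_iff lessThan_empty_iff)
  ultimately obtain F where F: "F \<in> ?P" and SF: "S F \<le> \<tau>"
    using exists_le_average[of ?P S \<tau>] fin by (auto simp: finite_PiE)
  \<comment> \<open>The indicator contributes 1 and its mean contributes \<kappa> times 1/\<kappa>,
    all at the one announcement \<open>h (fst z)\<close>.\<close>
  have b2: "(\<Sum>c\<in>{..<\<kappa>} \<times> Y. \<bar>b F c z\<bar>) \<le> 2" if "z \<in> X \<times> I" for z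
  proof -
    have hz: "h (fst z) \<in> Y" and Fz: "F (fst z) < \<kappa>" using that h F by auto
    have "(\<Sum>c\<in>{..<\<kappa>} \<times> Y. \<bar>b F c z\<bar>) = (\<Sum>k<\<kappa>. \<Sum>y\<in>Y. \<bar>b F (k, y) z\<bar>)"
      by (simp add: sum.cartesian_product case_prod_unfold)
    also have "\<dots> = (\<Sum>k<\<kappa>. \<Sum>y\<in>Y. if y = h (fst z) then \<bar>(if F (fst z) = k then 1 else 0) - 1 / real \<kappa>\<bar> else 0)"
      by (intro sum.cong refl) (auto simp: b_def)
    also have "\<dots> = (\<Sum>k<\<kappa>. \<bar>(if F (fst z) = k then 1 else 0) - 1 / real \<kappa>\<bar>)"
      using fin hz by simp
    also have "\<dots> \<le> (\<Sum>k<\<kappa>. (if F (fst z) = k then 1 else 0) + 1 / real \<kappa>)"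
      by (intro sum_mono) auto
    also have "\<dots> = 2" using Fz \<kappa> by (simp add: sum.distrib)
    finally show ?thesis .
  qed
  show ?thesis
    unfolding key_insecurity_le_def
  proof (intro bexI[of _ F] allI impI F)
    fix W assume W: "\<forall>c\<in>{..<\<kappa>} \<times> Y. contraction Q (W c)"
    have "cmod (\<Sum>c\<in>{..<\<kappa>} \<times> Y. \<Sum>z\<in>X \<times> I. complex_of_real (b F c z * l z) * ip Q (e z) (mv Q (W c) (e z)))
      \<le> 2 * (\<Sum>z\<in>{z\<in>X \<times> I. \<not> T z}. l z)
      + 4 * sqrt (\<Sum>z\<in>X \<times> I. l z * (1 - (\<Sum>j\<in>J. (cmod (ip Q (f j) (e z)))\<^sup>2)))
      + sqrt (card ({..<\<kappa>} \<times> Y) * card J) * sqrt (S F)"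
      unfolding S_def by (rule contraction_sum_bound[OF _ _ _ b2 l l1 _ f]) (use fin e W in auto)
    also have "sqrt (card ({..<\<kappa>} \<times> Y) * card J) * sqrt (S F) \<le> sqrt (\<kappa> * card Y * card J * \<tau>)"
      using SF unfolding real_sqrt_mult[symmetric] by (simp add: card_cartesian_product mult_left_mono)
    finally show "cmod (\<Sum>c\<in>{..<\<kappa>} \<times> Y. \<Sum>z\<in>X \<times> I.
      complex_of_real ((if h (fst z) = snd c then (if F (fst z) = fst c then 1 else 0) - 1 / \<kappa> else 0) * l z)
        * ip Q (e z) (mv Q (W c) (e z)))
      \<le> 2 * (\<Sum>z\<in>{z\<in>X \<times> I. \<not> T z}. l z)
      + 4 * sqrt (\<Sum>z\<in>X \<times> I. l z * (1 - (\<Sum>j\<in>J. (cmod (ip Q (f j) (e z)))\<^sup>2)))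
      + sqrt (\<kappa> * card Y * card J * \<tau>)" unfolding b_def by linarith
  qed
qed

section \<open>Mixed-radix blocks and i.i.d. sums\<close>

lemma tuples_Nil [simp]: "tuples [] = {[]}"
  by (auto simp: tuples_def)

lemma tuples_Cons: "tuples (d # ds) = (\<lambda>(a, xs). a # xs) ` ({..<d} \<times> tuples ds)"
proof (intro equalityI subsetI)
  fix x assume x: "x \<in> tuples (d # ds)"
  then obtain a xs where "x = a # xs" by (cases x) (auto simp: tuples_def)
  moreover have "a < d" using x calculation by (auto simp: tuples_def)
  moreover have "xs ! j < ds ! j" if "j < length ds" for j
    using x that unfolding \<open>x = a # xs\<close> tuples_def by (auto dest!: spec[of _ "Suc j"])
  ultimately show "x \<in> (\<lambda>(a, xs). a # xs) ` ({..<d} \<times> tuples ds)"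
    using x by (auto simp: tuples_def)
next
  fix x assume "x \<in> (\<lambda>(a, xs). a # xs) ` ({..<d} \<times> tuples ds)"
  then show "x \<in> tuples (d # ds)" by (auto simp: tuples_def nth_Cons split: nat.splits)
qed

lemma finite_tuples [simp]: "finite (tuples ds)"
  by (induction ds) (auto simp: tuples_Cons)

lemma card_tuples: "card (tuples ds) = prod_list ds"
proof (induction ds)
  case (Cons d ds)
  have "inj_on (\<lambda>(a, xs). a # xs) ({..<d} \<times> tuples ds)" by (auto simp: inj_on_def)
  then show ?case using Cons by (simp add: tuples_Cons card_image card_cartesian_product)
qed simp

lemma length_tuples: "x \<in> tuples ds \<Longrightarrow> length x = length ds"
  by (simp add: tuples_def)

lemma nth_tuples: "x \<in> tuples ds \<Longrightarrow> j < length ds \<Longrightarrow> x ! j < ds ! j"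
  by (simp add: tuples_def)

lemma length_mr_dec [simp]: "length (mr_dec ds i) = length ds"
  by (induction ds arbitrary: i) auto

lemma mr_dec_in_tuples: "i < prod_list ds \<Longrightarrow> mr_dec ds i \<in> tuples ds"
proof (induction ds arbitrary: i)
  case (Cons d ds)
  have pos: "0 < prod_list ds"
    using Cons.prems by (metis mult_0_right not_less_zero neq0_conv prod_list.Cons)
  then have "i div prod_list ds < d" using Cons.prems by (simp add: less_mult_imp_div_less)
  moreover have "mr_dec ds (i mod prod_list ds) \<in> tuples ds" using Cons.IH pos by simp
  ultimately show ?case by (auto simp: tuples_Cons)
qed simp

lemma mr_enc_mr_dec: "i < prod_list ds \<Longrightarrow> mr_enc ds (mr_dec ds i) = i"
proof (induction ds arbitrary: i)
  case (Cons d ds)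
  have pos: "0 < prod_list ds"
    using Cons.prems by (metis mult_0_right not_less_zero neq0_conv prod_list.Cons)
  then show ?case using Cons.IH by simp
qed simp

lemma mr_enc_less: "x \<in> tuples ds \<Longrightarrow> mr_enc ds x < prod_list ds"
proof (induction ds arbitrary: x)
  case (Cons d ds)
  then obtain a xs where x: "x = a # xs" "a < d" "xs \<in> tuples ds" by (auto simp: tuples_Cons)
  have "a * prod_list ds + mr_enc ds xs < a * prod_list ds + prod_list ds"
    using Cons.IH[OF x(3)] by simp
  also have "\<dots> = Suc a * prod_list ds" by simp
  also have "\<dots> \<le> d * prod_list ds" using x(2) by (intro mult_right_mono) auto
  finally show ?case using x by simp
qed simp

lemma mr_dec_mr_enc: "x \<in> tuples ds \<Longrightarrow> mr_dec ds (mr_enc ds x) = x"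
proof (induction ds arbitrary: x)
  case (Cons d ds)
  then obtain a xs where x: "x = a # xs" "a < d" "xs \<in> tuples ds" by (auto simp: tuples_Cons)
  have lt: "mr_enc ds xs < prod_list ds" using mr_enc_less[OF x(3)] .
  then have "(a * prod_list ds + mr_enc ds xs) div prod_list ds = a"
    by (metis add.commute add.right_neutral div_less div_mult_self1 not_less_zero)
  then show ?case using x lt Cons.IH[OF x(3)] by simp
qed simp

lemma bij_mr_dec: "bij_betw (mr_dec ds) {..<prod_list ds} (tuples ds)"
  by (rule bij_betw_byWitness[where f' = "mr_enc ds"])
    (auto simp: mr_enc_mr_dec mr_dec_mr_enc mr_enc_less mr_dec_in_tuples)

lemma sum_mr_dec: "(\<Sum>i<prod_list ds. g (mr_dec ds i)) = (\<Sum>x\<in>tuples ds. g x)"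
  by (rule sum.reindex_bij_betw[OF bij_mr_dec])

lemma sum_tuples_mr_enc: "(\<Sum>x\<in>tuples ds. g (mr_enc ds x)) = (\<Sum>i<prod_list ds. g i)"
proof -
  have "(\<Sum>x\<in>tuples ds. g (mr_enc ds x)) = (\<Sum>i<prod_list ds. g (mr_enc ds (mr_dec ds i)))"
    by (rule sum_mr_dec[symmetric])
  also have "\<dots> = (\<Sum>i<prod_list ds. g i)"
    by (intro sum.cong refl) (auto simp: mr_enc_mr_dec)
  finally show ?thesis .
qed

lemma sum_lessThan_mult:
  fixes g :: "nat \<Rightarrow> 'a :: comm_monoid_add"
  shows "(\<Sum>i<a * b. g i) = (\<Sum>x<a. \<Sum>y<b. g (x * b + y))"
proof -
  have "(\<Sum>i<a * b. g i) = (\<Sum>x<a. sum g {x * b..<x * b + b})" by (simp add: sum.nat_group)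
  also have "\<dots> = (\<Sum>x<a. \<Sum>y<b. g (x * b + y))"
  proof (rule sum.cong[OF refl])
    fix x
    show "sum g {x * b..<x * b + b} = (\<Sum>y<b. g (x * b + y))"
      using sum.shift_bounds_nat_ivl[of g 0 "x * b" b]
      by (simp only: add_0 add_0_right add.commute[of _ "x * b"] atLeast0LessThan)
  qed
  finally show ?thesis .
qed

text \<open>The eavesdropper's system is the last factor, hence the least significant digit:
  splitting an index as \<open>b * d + e\<close> separates it from the players' systems.\<close>

lemma mr_dec_snoc:
  assumes "e < d" "b < prod_list ds"
  shows "mr_dec (ds @ [d]) (b * d + e) = mr_dec ds b @ [e]"
  using assms(2)
proof (induction ds arbitrary: b)
  case (Cons a ds)
  have pos: "0 < prod_list ds"
    using Cons.prems by (metis mult_0_right not_less_zero neq0_conv prod_list.Cons)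
  have div: "(b * d + e) div (prod_list ds * d) = b div prod_list ds"
    using assms by (simp add: mult.commute[of "prod_list ds"] div_mult2_eq)
  have mod: "(b * d + e) mod (prod_list ds * d) = (b mod prod_list ds) * d + e"
    using assms by (simp add: mult.commute[of "prod_list ds"] mod_mult2_eq mult.commute)
  show ?case using Cons.IH[of "b mod prod_list ds"] pos by (simp add: div mod)
qed simp

lemma mr_enc_snoc: "length x = length ds \<Longrightarrow> mr_enc (ds @ [d]) (x @ [e]) = mr_enc ds x * d + e"
proof (induction ds arbitrary: x)
  case (Cons a ds)
  then obtain y ys where "x = y # ys" by (cases x) auto
  then show ?case using Cons by (simp add: algebra_simps)
qed simp

lemma dim_tensor_list [simp]:
  "dim_row (tensor_list As) = prod_list (map dim_row As)"
  "dim_col (tensor_list As) = prod_list (map dim_col As)"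
  by (simp_all add: tensor_list_def Let_def)

lemma index_less_mult_add: "q < a \<Longrightarrow> e < b \<Longrightarrow> q * b + e < a * (b::nat)"
proof -
  assume "q < a" "e < b"
  then have "q * b + e < Suc q * b" by simp
  also have "\<dots> \<le> a * b" using \<open>q < a\<close> by (intro mult_right_mono) auto
  finally show ?thesis .
qed

text \<open>The identity on the last factor turns into a delta on the last digit. Every operator
  applied by the players has this form.\<close>

lemma tensor_list_snoc_one:
  assumes "q < prod_list (map dim_row As)" "r < prod_list (map dim_col As)" "e < d" "e' < d"
  shows "tensor_list (As @ [1\<^sub>m d]) $$ (q * d + e, r * d + e')
    = (if e = e' then \<Prod>t<length As. (As ! t) $$ (mr_dec (map dim_row As) q ! t, mr_dec (map dim_col As) r ! t) else 0)"
  using assms index_less_mult_add[OF assms(1,3)] index_less_mult_add[OF assms(2,4)]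
  by (auto simp: tensor_list_def Let_def mr_dec_snoc nth_append prod_zero_iff intro!: prod.cong)

section \<open>Blocks of letters stored as single numbers\<close>

definition digit :: "nat \<Rightarrow> nat \<Rightarrow> nat \<Rightarrow> nat \<Rightarrow> nat" where
  "digit d n b t = mr_dec (replicate n d) b ! t"

text \<open>Transposes the two indexings of n copies: \<open>c\<close> has one number per player,
  each encoding that player's n letters, and the result is the tuple of all players' letters in copy
  t.\<close>

definition letters :: "nat list \<Rightarrow> nat \<Rightarrow> nat list \<Rightarrow> nat \<Rightarrow> nat list" where
  "letters ds n c t = map (\<lambda>(d, b). digit d n b t) (zip ds c)"

abbreviation blocks :: "nat list \<Rightarrow> nat \<Rightarrow> nat list set" where
  "blocks ds n \<equiv> tuples (map (\<lambda>d. d ^ n) ds)"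

lemma prod_list_replicate_nat [simp]: "prod_list (replicate n (d::nat)) = d ^ n"
  by (induction n) auto

lemma digit_less: "b < d ^ n \<Longrightarrow> t < n \<Longrightarrow> digit d n b t < d"
  unfolding digit_def using mr_dec_in_tuples[of b "replicate n d"] by (auto simp: tuples_def)

lemma digit_inject:
  assumes "b < d ^ n" "b' < d ^ n" "\<And>t. t < n \<Longrightarrow> digit d n b t = digit d n b' t"
  shows "b = b'"
proof -
  have "mr_dec (replicate n d) b = mr_dec (replicate n d) b'"
    using assms(3) by (intro nth_equalityI) (auto simp: digit_def)
  then show ?thesis using assms(1,2) by (metis mr_enc_mr_dec prod_list_replicate_nat)
qed

lemma length_letters [simp]: "length c = length ds \<Longrightarrow> length (letters ds n c t) = length ds"
  by (simp add: letters_def)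

lemma nth_letters: "length c = length ds \<Longrightarrow> j < length ds \<Longrightarrow> letters ds n c t ! j = digit (ds ! j) n (c ! j) t"
  by (simp add: letters_def)

lemma letters_in_tuples: "c \<in> blocks ds n \<Longrightarrow> t < n \<Longrightarrow> letters ds n c t \<in> tuples ds"
  by (auto simp: tuples_def nth_letters digit_less)

lemma bij_digit: "bij_betw (\<lambda>b. restrict (digit d n b) {..<n}) {..<d ^ n} (PiE {..<n} (\<lambda>_. {..<d}))"
proof -
  let ?f = "\<lambda>b. restrict (digit d n b) {..<n}"
  have inj: "inj_on ?f {..<d ^ n}"
  proof (rule inj_onI)
    fix b b' assume b: "b \<in> {..<d ^ n}" "b' \<in> {..<d ^ n}" and eq: "?f b = ?f b'"
    have "digit d n b t = digit d n b' t" if "t < n" for t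
      using fun_cong[OF eq, of t] that by simp
    then show "b = b'" using b by (intro digit_inject[of b d n b']) auto
  qed
  have sub: "?f ` {..<d ^ n} \<subseteq> PiE {..<n} (\<lambda>_. {..<d})"
    by (rule image_subsetI) (simp add: restrict_PiE_iff digit_less)
  have "card (?f ` {..<d ^ n}) = card (PiE {..<n} (\<lambda>_. {..<d}))"
    using inj by (simp add: card_image card_PiE)
  then have "?f ` {..<d ^ n} = PiE {..<n} (\<lambda>_. {..<d})"
    using sub by (intro card_subset_eq) (auto simp: finite_PiE)
  then show ?thesis using inj by (simp add: bij_betw_def)
qed

lemma prod_list_map_power: "prod_list (map (\<lambda>d. d ^ n) ds) = prod_list ds ^ (n::nat)" for ds :: "nat list"
  by (induction ds) (auto simp: power_mult_distrib)

text \<open>Injectivity and equal cardinalities give surjectivity, so no inverse encoding is written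
  down.\<close>

lemma bij_letters: "bij_betw (\<lambda>c. restrict (letters ds n c) {..<n}) (blocks ds n) (PiE {..<n} (\<lambda>_. tuples ds))"
proof -
  let ?f = "\<lambda>c. restrict (letters ds n c) {..<n}"
  have inj: "inj_on ?f (blocks ds n)"
  proof (rule inj_onI)
    fix c c' assume c: "c \<in> blocks ds n" and c': "c' \<in> blocks ds n" and eq: "?f c = ?f c'"
    have lt: "letters ds n c t = letters ds n c' t" if "t < n" for t
      using fun_cong[OF eq, of t] that by simp
    have len: "length c = length ds" "length c' = length ds" using c c' by (auto dest: length_tuples)
    show "c = c'"
    proof (rule nth_equalityI)
      fix j assume "j < length c"
      then have j: "j < length ds" using len by simp
      have "digit (ds ! j) n (c ! j) t = digit (ds ! j) n (c' ! j) t" if "t < n" for t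
        using arg_cong[OF lt[OF that], of "\<lambda>l. l ! j"] by (simp add: nth_letters len j)
      moreover have "c ! j < ds ! j ^ n" "c' ! j < ds ! j ^ n" using c c' j by (auto simp: tuples_def)
      ultimately show "c ! j = c' ! j" by (rule digit_inject[rotated 2])
    qed (use len in simp)
  qed
  have sub: "?f ` blocks ds n \<subseteq> PiE {..<n} (\<lambda>_. tuples ds)"
    by (rule image_subsetI) (simp add: restrict_PiE_iff letters_in_tuples)
  have "card (?f ` blocks ds n) = card (PiE {..<n} (\<lambda>_. tuples ds))"
    using inj by (simp add: card_image card_PiE card_tuples prod_list_map_power)
  then have "?f ` blocks ds n = PiE {..<n} (\<lambda>_. tuples ds)"
    using sub by (intro card_subset_eq) (auto simp: finite_PiE)
  then show ?thesis using inj by (simp add: bij_betw_def)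
qed

text \<open>The workhorse for n copies: inner products, traces, completeness relations and
  probabilities of product objects reduce to one copy through this interchange.\<close>

lemma sum_prod_digit:
  fixes g :: "nat \<Rightarrow> nat \<Rightarrow> 'a :: comm_semiring_1"
  shows "(\<Sum>b<d ^ n. \<Prod>t<n. g t (digit d n b t)) = (\<Prod>t<n. \<Sum>a<d. g t a)"
proof -
  have "(\<Prod>t<n. \<Sum>a<d. g t a) = (\<Sum>s\<in>PiE {..<n} (\<lambda>_. {..<d}). \<Prod>t<n. g t (s t))"
    by (rule prod_sum_PiE) auto
  also have "\<dots> = (\<Sum>b<d ^ n. \<Prod>t<n. g t (restrict (digit d n b) {..<n} t))"
    by (rule sum.reindex_bij_betw[OF bij_digit, symmetric])
  finally show ?thesis by simp
qed

lemma sum_prod_letters: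
  fixes g :: "nat \<Rightarrow> nat list \<Rightarrow> 'a :: comm_semiring_1"
  shows "(\<Sum>c\<in>blocks ds n. \<Prod>t<n. g t (letters ds n c t)) = (\<Prod>t<n. \<Sum>x\<in>tuples ds. g t x)"
proof -
  have "(\<Prod>t<n. \<Sum>x\<in>tuples ds. g t x) = (\<Sum>s\<in>PiE {..<n} (\<lambda>_. tuples ds). \<Prod>t<n. g t (s t))"
    by (rule prod_sum_PiE) auto
  also have "\<dots> = (\<Sum>c\<in>blocks ds n. \<Prod>t<n. g t (restrict (letters ds n c) {..<n} t))"
    by (rule sum.reindex_bij_betw[OF bij_letters, symmetric])
  finally show ?thesis by simp
qed

lemma sum_prod_letters_digit:
  fixes g :: "nat \<Rightarrow> nat list \<times> nat \<Rightarrow> 'a :: comm_semiring_1"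
  shows "(\<Sum>z\<in>blocks ds n \<times> {..<d ^ n}. \<Prod>t<n. g t (letters ds n (fst z) t, digit d n (snd z) t))
    = (\<Prod>t<n. \<Sum>z\<in>tuples ds \<times> {..<d}. g t z)"
proof -
  have "(\<Sum>z\<in>blocks ds n \<times> {..<d ^ n}. \<Prod>t<n. g t (letters ds n (fst z) t, digit d n (snd z) t))
     = (\<Sum>c\<in>blocks ds n. \<Sum>b<d ^ n. \<Prod>t<n. g t (letters ds n c t, digit d n b t))"
    by (simp add: sum.cartesian_product case_prod_unfold)
  also have "\<dots> = (\<Sum>c\<in>blocks ds n. \<Prod>t<n. \<Sum>a<d. g t (letters ds n c t, a))"
    by (simp add: sum_prod_digit[of "\<lambda>t a. g t (letters ds n _ t, a)"])
  also have "\<dots> = (\<Prod>t<n. \<Sum>x\<in>tuples ds. \<Sum>a<d. g t (x, a))"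
    by (rule sum_prod_letters)
  finally show ?thesis by (simp add: sum.cartesian_product case_prod_unfold)
qed

text \<open>The product structure of an i.i.d. source enters only through the interchange rule \<open>SP\<close>, so that it
  applies to encoded blocks of letters without decoding them.\<close>

lemma iid_second_moment:
  fixes q \<phi> :: "'z \<Rightarrow> real"
  assumes SP: "\<And>g :: nat \<Rightarrow> 'z \<Rightarrow> real. (\<Sum>s\<in>S. \<Prod>t<n. g t (zz s t)) = (\<Prod>t<n. \<Sum>z\<in>Z. g t z)"
    and q1: "(\<Sum>z\<in>Z. q z) = 1" and mean: "(\<Sum>z\<in>Z. q z * \<phi> z) = 0"
  shows "(\<Sum>s\<in>S. (\<Prod>t<n. q (zz s t)) * (\<Sum>t<n. \<phi> (zz s t))\<^sup>2) = n * (\<Sum>z\<in>Z. q z * (\<phi> z)\<^sup>2)"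
proof -
  \<comment> \<open>The product weight with \<phi> inserted at times t and t'. The insertions meet
    in one factor when the times coincide, which gives the square; otherwise a factor of mean zero
    stands alone.\<close>
  define g where "g = (\<lambda>(t::nat) t' r z. q z * (if r = t then \<phi> z else 1) * (if r = t' then \<phi> z else (1::real)))"
  have pg: "(\<Prod>r<n. q (zz s r)) * (\<phi> (zz s t) * \<phi> (zz s t')) = (\<Prod>r<n. g t t' r (zz s r))"
    if "t < n" "t' < n" for s t t'
    using that by (simp add: g_def prod.distrib)
  have cov: "(\<Prod>r<n. \<Sum>z\<in>Z. g t t' r z) = (if t = t' then \<Sum>z\<in>Z. q z * (\<phi> z)\<^sup>2 else 0)"
    if t: "t < n" "t' < n" for t t'
  proof (cases "t = t'")
    case True
    have "(\<Prod>r<n. \<Sum>z\<in>Z. g t t' r z) = (\<Prod>r<n. if r = t then \<Sum>z\<in>Z. q z * (\<phi> z)\<^sup>2 else 1)"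
      unfolding g_def True using q1 by (intro prod.cong refl) (auto simp: power2_eq_square mult.assoc)
    then show ?thesis using t True by simp
  next
    case False
    have "(\<Sum>z\<in>Z. g t t' t z) = 0" using mean False by (simp add: g_def)
    then show ?thesis using t False by (auto simp: prod_zero_iff)
  qed
  have "(\<Sum>s\<in>S. (\<Prod>t<n. q (zz s t)) * (\<Sum>t<n. \<phi> (zz s t))\<^sup>2)
      = (\<Sum>s\<in>S. \<Sum>t<n. \<Sum>t'<n. \<Prod>r<n. g t t' r (zz s r))"
  proof (rule sum.cong[OF refl])
    fix s
    have "(\<Prod>t<n. q (zz s t)) * (\<Sum>t<n. \<phi> (zz s t))\<^sup>2
        = (\<Sum>t<n. \<Sum>t'<n. (\<Prod>r<n. q (zz s r)) * (\<phi> (zz s t) * \<phi> (zz s t')))"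
      unfolding power2_eq_square sum_product by (simp only: sum_distrib_left)
    also have "\<dots> = (\<Sum>t<n. \<Sum>t'<n. \<Prod>r<n. g t t' r (zz s r))"
      by (intro sum.cong refl pg) auto
    finally show "(\<Prod>t<n. q (zz s t)) * (\<Sum>t<n. \<phi> (zz s t))\<^sup>2 = (\<Sum>t<n. \<Sum>t'<n. \<Prod>r<n. g t t' r (zz s r))" .
  qed
  also have "\<dots> = (\<Sum>t<n. \<Sum>t'<n. \<Sum>s\<in>S. \<Prod>r<n. g t t' r (zz s r))"
    by (subst sum.swap, rule sum.cong[OF refl], rule sum.swap)
  also have "\<dots> = (\<Sum>t<n. \<Sum>t'<n. if t = t' then \<Sum>z\<in>Z. q z * (\<phi> z)\<^sup>2 else 0)"
    unfolding SP using cov by (intro sum.cong refl) auto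
  also have "\<dots> = n * (\<Sum>z\<in>Z. q z * (\<phi> z)\<^sup>2)" by simp
  finally show ?thesis .
qed

text \<open>Markov's inequality for the squared deviation. The variance is that of a single letter,
  so the bound decays like 1/n with a constant free of n.\<close>

lemma iid_chebyshev:
  fixes q \<phi> :: "'z \<Rightarrow> real"
  assumes SP: "\<And>g :: nat \<Rightarrow> 'z \<Rightarrow> real. (\<Sum>s\<in>S. \<Prod>t<n. g t (zz s t)) = (\<Prod>t<n. \<Sum>z\<in>Z. g t z)"
    and q1: "(\<Sum>z\<in>Z. q z) = 1" and q0: "\<And>z. z \<in> Z \<Longrightarrow> 0 \<le> q z"
    and zz: "\<And>s t. s \<in> S \<Longrightarrow> t < n \<Longrightarrow> zz s t \<in> Z" and S: "finite S"
    and mean: "(\<Sum>z\<in>Z. q z * \<phi> z) = \<mu>" and n: "n \<ge> 1" and \<delta>: "\<delta> > 0"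
  shows "(\<Sum>s\<in>{s\<in>S. \<not> \<bar>(\<Sum>t<n. \<phi> (zz s t)) - n * \<mu>\<bar> \<le> n * \<delta>}. \<Prod>t<n. q (zz s t))
    \<le> (\<Sum>z\<in>Z. q z * (\<phi> z - \<mu>)\<^sup>2) / (n * \<delta>\<^sup>2)"
proof -
  let ?V = "\<Sum>z\<in>Z. q z * (\<phi> z - \<mu>)\<^sup>2"
  let ?B = "{s\<in>S. \<not> \<bar>(\<Sum>t<n. \<phi> (zz s t)) - n * \<mu>\<bar> \<le> n * \<delta>}"
  have "(\<Sum>z\<in>Z. q z * (\<phi> z - \<mu>)) = 0"
    using mean q1 by (simp add: right_diff_distrib sum_subtractf flip: sum_distrib_right)
  from iid_second_moment[OF SP q1 this]
  have sm: "(\<Sum>s\<in>S. (\<Prod>t<n. q (zz s t)) * ((\<Sum>t<n. \<phi> (zz s t)) - n * \<mu>)\<^sup>2) = n * ?V"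
    by (simp add: sum_subtractf)
  have w: "0 \<le> (\<Prod>t<n. q (zz s t))" if "s \<in> S" for s using q0 zz that by (intro prod_nonneg) auto
  have "(\<Sum>s\<in>?B. \<Prod>t<n. q (zz s t)) * (n * \<delta>)\<^sup>2 \<le> (\<Sum>s\<in>?B. (\<Prod>t<n. q (zz s t)) * ((\<Sum>t<n. \<phi> (zz s t)) - n * \<mu>)\<^sup>2)"
    unfolding sum_distrib_right
  proof (intro sum_mono mult_left_mono)
    fix s assume "s \<in> ?B"
    then have "\<bar>n * \<delta>\<bar> \<le> \<bar>(\<Sum>t<n. \<phi> (zz s t)) - n * \<mu>\<bar>" using \<delta> by auto
    then show "(n * \<delta>)\<^sup>2 \<le> ((\<Sum>t<n. \<phi> (zz s t)) - n * \<mu>)\<^sup>2" by (simp only: abs_le_square_iff)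
  qed (use w in auto)
  also have "\<dots> \<le> n * ?V"
    unfolding sm[symmetric] using S w by (intro sum_mono2) auto
  finally have "(\<Sum>s\<in>?B. \<Prod>t<n. q (zz s t)) * (n * \<delta>\<^sup>2) * n \<le> ?V * n"
    by (simp add: power2_eq_square mult_ac)
  then have "(\<Sum>s\<in>?B. \<Prod>t<n. q (zz s t)) * (n * \<delta>\<^sup>2) \<le> ?V"
    by (rule mult_right_le_imp_le) (use n in simp)
  moreover have "0 < n * \<delta>\<^sup>2" using n \<delta> by simp
  ultimately show ?thesis by (simp add: pos_le_divide_eq)
qed

section \<open>Random binning\<close>

text \<open>Fixing \<open>f\<close> away from x leaves exactly one colliding value at x out of
  \<open>L\<close>.\<close>

lemma random_binning_collision:
  assumes X: "finite X" and xy: "x \<in> X" "y \<in> X" "x \<noteq> y" and L: "L \<ge> (1::nat)"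
  shows "(\<Sum>f\<in>PiE X (\<lambda>_. {..<L}). if f x = f y then 1 else (0::real)) = real L ^ card X / L"
proof -
  define X' where "X' = X - {x}"
  have X': "X = insert x X'" "x \<notin> X'" "finite X'" "y \<in> X'" using X xy by (auto simp: X'_def)
  have "(\<Sum>f\<in>PiE X (\<lambda>_. {..<L}). if f x = f y then 1 else (0::real))
      = (\<Sum>c<L. \<Sum>f\<in>PiE X' (\<lambda>_. {..<L}). if c = f y then 1 else 0)"
    unfolding X'(1) using X' xy(3) by (subst sum_PiE_insert) auto
  also have "\<dots> = (\<Sum>f\<in>PiE X' (\<lambda>_. {..<L}). \<Sum>c<L. if c = f y then 1 else 0)"
    by (rule sum.swap)
  also have "\<dots> = (\<Sum>f\<in>PiE X' (\<lambda>_. {..<L}). 1)"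
    using X'(4) by (intro sum.cong refl) auto
  also have "\<dots> = real L ^ card X'" using X' by (simp add: card_PiE)
  finally show ?thesis using X' L by simp
qed

text \<open>Bins of different players are independent, so the count factorises: each player in
  \<open>I\<close> contributes a factor \<open>1 / L j\<close>, every other player keeps all
  functions.\<close>

lemma random_binning_joint_collision:
  fixes L :: "nat \<Rightarrow> nat"
  assumes fin: "\<And>j. j < m \<Longrightarrow> finite (X j)" and L: "\<And>j. j < m \<Longrightarrow> L j \<ge> 1" and I: "I \<subseteq> {..<m}"
    and xy: "\<And>j. j \<in> I \<Longrightarrow> x j \<in> X j \<and> y j \<in> X j \<and> x j \<noteq> y j"
  shows "(\<Sum>h\<in>PiE {..<m} (\<lambda>j. PiE (X j) (\<lambda>_. {..<L j})). if \<forall>j\<in>I. h j (x j) = h j (y j) then 1 else (0::real))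
    = card (PiE {..<m} (\<lambda>j. PiE (X j) (\<lambda>_. {..<L j}))) / (\<Prod>j\<in>I. real (L j))"
proof -
  let ?P = "\<lambda>j. PiE (X j) (\<lambda>_. {..<L j})"
  have finP: "finite (?P j)" if "j < m" for j using fin[OF that] by (auto intro!: finite_PiE)
  have cardP: "card (?P j) = L j ^ card (X j)" if "j < m" for j using fin[OF that] by (simp add: card_PiE)
  have ind: "(if \<forall>j\<in>I. h j (x j) = h j (y j) then 1 else (0::real))
      = (\<Prod>j<m. if j \<in> I \<and> h j (x j) \<noteq> h j (y j) then 0 else 1)" for h :: "nat \<Rightarrow> 'a \<Rightarrow> nat"
    using I by (auto simp: prod_zero_iff intro!: prod.neutral[symmetric])
  have "(\<Sum>h\<in>PiE {..<m} ?P. if \<forall>j\<in>I. h j (x j) = h j (y j) then 1 else (0::real))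
      = (\<Prod>j<m. \<Sum>f\<in>?P j. if j \<in> I \<and> f (x j) \<noteq> f (y j) then 0 else 1)"
    unfolding ind using finP by (intro prod_sum_PiE[symmetric]) auto
  also have "\<dots> = (\<Prod>j<m. real (card (?P j)) / (if j \<in> I then real (L j) else 1))"
  proof (intro prod.cong refl)
    fix j assume "j \<in> {..<m}"
    then have j: "j < m" by simp
    show "(\<Sum>f\<in>?P j. if j \<in> I \<and> f (x j) \<noteq> f (y j) then 0 else 1) = real (card (?P j)) / (if j \<in> I then real (L j) else 1)"
    proof (cases "j \<in> I")
      case True
      have "(\<Sum>f\<in>?P j. if j \<in> I \<and> f (x j) \<noteq> f (y j) then 0 else 1) = (\<Sum>f\<in>?P j. if f (x j) = f (y j) then 1 else (0::real))"
        using True by (intro sum.cong refl) auto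
      also have "\<dots> = real (L j) ^ card (X j) / L j"
        using random_binning_collision[OF fin[OF j], of "x j" "y j" "L j"] xy[OF True] L[OF j] by simp
      finally show ?thesis using True cardP[OF j] by simp
    qed simp
  qed
  also have "\<dots> = real (card (PiE {..<m} ?P)) / (\<Prod>j<m. if j \<in> I then real (L j) else 1)"
    by (simp add: prod_dividef card_PiE)
  also have "(\<Prod>j<m. if j \<in> I then real (L j) else 1) = (\<Prod>j\<in>I. real (L j))"
    using I by (subst prod.inter_restrict[symmetric]) (auto simp: Int_absorb1)
  finally show ?thesis .
qed

text \<open>Player \<open>i\<close> knows \<open>x ! i\<close> and all bins; decoding fails if this does not single out \<open>x\<close> in the codebook \<open>T\<close>
  for some player.\<close>

definition decoding_failures :: "nat \<Rightarrow> (nat \<Rightarrow> nat \<Rightarrow> nat) \<Rightarrow> nat list set \<Rightarrow> nat list set \<Rightarrow> nat list set" where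
  "decoding_failures m h T CS = {x\<in>CS. x \<notin> T \<or> (\<exists>x'\<in>T. x' \<noteq> x \<and> (\<exists>i<m. x' ! i = x ! i) \<and> (\<forall>j<m. h j (x' ! j) = h j (x ! j)))}"

text \<open>A wrong candidate is sorted by the set \<open>I\<close> of coordinates where it differs
  from x. This set is non-empty because the candidate is wrong, and proper because the candidate
  shares the own block of the player it misleads. What remains is a union bound over such
  \<open>I\<close> and at most \<open>B I\<close> candidates for each.\<close>

lemma binning_lemma:
  fixes L :: "nat \<Rightarrow> nat" and p :: "nat list \<Rightarrow> real" and B :: "nat set \<Rightarrow> real"
  assumes CS: "finite CS" "\<And>x. x \<in> CS \<Longrightarrow> length x = m" "\<And>x j. x \<in> CS \<Longrightarrow> j < m \<Longrightarrow> x ! j \<in> X j"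
    and X: "\<And>j. j < m \<Longrightarrow> finite (X j)" and T: "T \<subseteq> CS" and L: "\<And>j. j < m \<Longrightarrow> L j \<ge> 1"
    and p: "\<And>x. x \<in> CS \<Longrightarrow> 0 \<le> p x" and p1: "(\<Sum>x\<in>CS. p x) = 1"
    and B: "\<And>x I. x \<in> T \<Longrightarrow> I \<subset> {..<m} \<Longrightarrow> I \<noteq> {} \<Longrightarrow>
        real (card {x'\<in>T. \<forall>j<m. j \<notin> I \<longrightarrow> x' ! j = x ! j}) \<le> B I"
    and B0: "\<And>I. 0 \<le> B I"
  shows "\<exists>h\<in>PiE {..<m} (\<lambda>j. PiE (X j) (\<lambda>_. {..<L j})).
    (\<Sum>x\<in>decoding_failures m h T CS. p x)
    \<le> (\<Sum>x\<in>CS - T. p x) + (\<Sum>I\<in>{I. I \<subset> {..<m} \<and> I \<noteq> {}}. B I / (\<Prod>j\<in>I. real (L j)))"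
proof -
  let ?H = "PiE {..<m} (\<lambda>j. PiE (X j) (\<lambda>_. {..<L j}))"
  let ?\<I> = "{I. I \<subset> {..<m} \<and> I \<noteq> {}}"
  let ?bad = "\<lambda>h x. x \<notin> T \<or> (\<exists>x'\<in>T. x' \<noteq> x \<and> (\<exists>i<m. x' ! i = x ! i) \<and> (\<forall>j<m. h j (x' ! j) = h j (x ! j)))"
  define N where "N = (\<lambda>I x. {x'\<in>T. (\<forall>j<m. j \<notin> I \<longrightarrow> x' ! j = x ! j) \<and> (\<forall>j\<in>I. x' ! j \<noteq> x ! j)})"
  define col where "col = (\<lambda>(h :: nat \<Rightarrow> nat \<Rightarrow> nat) x. \<Sum>I\<in>?\<I>. \<Sum>x'\<in>N I x. if \<forall>j\<in>I. h j (x' ! j) = h j (x ! j) then 1 else (0::real))"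
  have fT: "finite T" using CS(1) T by (rule finite_subset[rotated])
  have f\<I>: "finite ?\<I>" by (rule finite_subset[of _ "Pow {..<m}"]) auto
  have fN: "finite (N I x)" for I x using fT by (simp add: N_def)
  have finH: "finite ?H" using X by (intro finite_PiE) auto
  have neH: "?H \<noteq> {}"
  proof -
    have "PiE (X j) (\<lambda>_. {..<L j}) \<noteq> {}" if "j < m" for j
      using L[OF that] by (auto simp: PiE_eq_empty_iff lessThan_empty_iff)
    then show ?thesis by (auto simp: PiE_eq_empty_iff)
  qed
  have col0: "0 \<le> col h x" for h x unfolding col_def by (intro sum_nonneg) auto
  \<comment> \<open>Blocks outside \<open>T\<close> count as failures outright; inside
    \<open>T\<close> the indicator is bounded by the number of colliding candidates.\<close>
  have bad_le: "(if ?bad h x then 1 else 0) \<le> (if x \<in> T then col h x else 1)" if x: "x \<in> CS" for h x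
  proof (cases "x \<in> T \<and> ?bad h x")
    case True
    then obtain x' where x': "x' \<in> T" "x' \<noteq> x" "\<exists>i<m. x' ! i = x ! i" and hx': "\<forall>j<m. h j (x' ! j) = h j (x ! j)"
      by auto
    define I where "I = {j. j < m \<and> x' ! j \<noteq> x ! j}"
    have "length x' = m" "length x = m" using CS T x' x by auto
    then have "I \<noteq> {}" using x'(2) nth_equalityI[of x' x] by (auto simp: I_def)
    then have I: "I \<in> ?\<I>" using x'(3) by (auto simp: I_def)
    have "x' \<in> N I x" using x'(1) by (auto simp: N_def I_def)
    have "1 = (if \<forall>j\<in>I. h j (x' ! j) = h j (x ! j) then 1 else (0::real))"
      using hx' by (auto simp: I_def)
    also have "\<dots> \<le> (\<Sum>x'\<in>N I x. if \<forall>j\<in>I. h j (x' ! j) = h j (x ! j) then 1 else (0::real))"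
      using fN \<open>x' \<in> N I x\<close> by (intro member_le_sum) auto
    also have "\<dots> \<le> col h x" unfolding col_def
      by (rule member_le_sum[OF I _ f\<I>]) (intro sum_nonneg, simp)
    finally show ?thesis using True by simp
  qed (use col0 in auto)
  have col_avg: "(\<Sum>h\<in>?H. col h x) \<le> real (card ?H) * (\<Sum>I\<in>?\<I>. B I / (\<Prod>j\<in>I. real (L j)))" if x: "x \<in> T" for x
  proof -
    have "(\<Sum>h\<in>?H. col h x) = (\<Sum>I\<in>?\<I>. \<Sum>x'\<in>N I x. \<Sum>h\<in>?H. if \<forall>j\<in>I. h j (x' ! j) = h j (x ! j) then 1 else (0::real))"
      unfolding col_def by (subst sum.swap, rule sum.cong[OF refl], rule sum.swap)
    also have "\<dots> = (\<Sum>I\<in>?\<I>. \<Sum>x'\<in>N I x. card ?H / (\<Prod>j\<in>I. real (L j)))"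
    proof (rule sum.cong[OF refl], rule sum.cong[OF refl])
      fix I x' assume I: "I \<in> ?\<I>" and x': "x' \<in> N I x"
      show "(\<Sum>h\<in>?H. if \<forall>j\<in>I. h j (x' ! j) = h j (x ! j) then 1 else (0::real)) = card ?H / (\<Prod>j\<in>I. real (L j))"
      proof (rule random_binning_joint_collision)
        fix j assume j: "j \<in> I"
        have "x' \<in> CS" "x \<in> CS" "j < m" using x' x T I j by (auto simp: N_def)
        then show "x' ! j \<in> X j \<and> x ! j \<in> X j \<and> x' ! j \<noteq> x ! j"
          using CS(3) x' j by (auto simp: N_def)
      qed (use I X L in auto)
    qed
    also have "\<dots> = (\<Sum>I\<in>?\<I>. card (N I x) * (card ?H / (\<Prod>j\<in>I. real (L j))))" by simp
    also have "\<dots> \<le> (\<Sum>I\<in>?\<I>. B I * (card ?H / (\<Prod>j\<in>I. real (L j))))"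
    proof (intro sum_mono mult_right_mono)
      fix I assume I: "I \<in> ?\<I>"
      \<comment> \<open>The collision probability speaks of candidates that differ on all of
        \<open>I\<close>; the bound \<open>B I\<close> counts the larger set of those agreeing off
        \<open>I\<close>.\<close>
      have "card (N I x) \<le> card {x'\<in>T. \<forall>j<m. j \<notin> I \<longrightarrow> x' ! j = x ! j}"
        using fT by (intro card_mono) (auto simp: N_def)
      then show "real (card (N I x)) \<le> B I" using B[OF x, of I] I by simp
    qed (auto intro!: divide_nonneg_nonneg prod_nonneg)
    also have "\<dots> = real (card ?H) * (\<Sum>I\<in>?\<I>. B I / (\<Prod>j\<in>I. real (L j)))"
      by (simp add: sum_distrib_left mult_ac)
    finally show ?thesis .
  qed
  have S0: "0 \<le> (\<Sum>I\<in>?\<I>. B I / (\<Prod>j\<in>I. real (L j)))"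
    using B0 by (intro sum_nonneg divide_nonneg_nonneg prod_nonneg) auto
  have "(\<Sum>h\<in>?H. \<Sum>x\<in>{x\<in>CS. ?bad h x}. p x) = (\<Sum>h\<in>?H. \<Sum>x\<in>CS. p x * (if ?bad h x then 1 else 0))"
  proof (rule sum.cong[OF refl])
    fix h
    have filt: "(\<Sum>x\<in>{x\<in>CS. P x}. p x) = (\<Sum>x\<in>CS. p x * (if P x then 1 else 0))" for P
      unfolding sum.inter_filter[OF CS(1)] by (intro sum.cong refl) simp
    show "(\<Sum>x\<in>{x\<in>CS. ?bad h x}. p x) = (\<Sum>x\<in>CS. p x * (if ?bad h x then 1 else 0))"
      by (rule filt)
  qed
  also have "\<dots> \<le> (\<Sum>h\<in>?H. \<Sum>x\<in>CS. p x * (if x \<in> T then col h x else 1))"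
    using bad_le p by (intro sum_mono mult_left_mono) auto
  also have "\<dots> = (\<Sum>x\<in>CS. p x * (\<Sum>h\<in>?H. if x \<in> T then col h x else 1))"
    by (subst sum.swap) (simp add: sum_distrib_left)
  also have "\<dots> \<le> (\<Sum>x\<in>CS. p x * (real (card ?H) * (if x \<in> T then \<Sum>I\<in>?\<I>. B I / (\<Prod>j\<in>I. real (L j)) else 1)))"
    using col_avg p by (intro sum_mono mult_left_mono) auto
  also have "\<dots> = real (card ?H) * ((\<Sum>x\<in>CS - T. p x) + (\<Sum>x\<in>T. p x) * (\<Sum>I\<in>?\<I>. B I / (\<Prod>j\<in>I. real (L j))))"
  proof -
    have "(\<Sum>x\<in>CS. p x * (c * (if x \<in> T then S else 1))) = c * ((\<Sum>x\<in>CS - T. p x) + (\<Sum>x\<in>T. p x) * S)"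
      for c S :: real
      using T CS(1) by (subst sum.subset_diff[of T])
        (auto simp: sum_distrib_right sum_distrib_left distrib_left mult_ac intro!: arg_cong2[where f = "(+)"] sum.cong)
    then show ?thesis .
  qed
  also have "\<dots> \<le> real (card ?H) * ((\<Sum>x\<in>CS - T. p x) + (\<Sum>I\<in>?\<I>. B I / (\<Prod>j\<in>I. real (L j))))"
  proof -
    have "(\<Sum>x\<in>T. p x) \<le> 1" unfolding p1[symmetric] using T CS(1) p by (intro sum_mono2) auto
    then show ?thesis using S0
      by (intro mult_left_mono add_left_mono mult_left_le_one_le) (use p T in \<open>auto intro!: sum_nonneg\<close>)
  qed
  finally show ?thesis
    unfolding decoding_failures_def using exists_le_average[OF finH neH] by blast
qed

section \<open>Slepian--Wolf coding\<close>

text \<open>\<open>restr\<close> pads with 0 instead of deleting coordinates, so the marginal laws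
  for all \<open>J\<close> live on lists of full length.\<close>

definition marginal :: "nat list \<Rightarrow> (nat list \<Rightarrow> real) \<Rightarrow> nat set \<Rightarrow> nat list \<Rightarrow> real" where
  "marginal Ns p J y = (\<Sum>x\<in>{x\<in>tuples Ns. restr J x = y}. p x)"

lemma eta_nonneg_arg: "0 \<le> x \<Longrightarrow> eta x = x * log 2 x"
  by (auto simp: eta_def)

lemma length_restr [simp]: "length (restr J x) = length x"
  by (simp add: restr_def)

lemma restr_cong_iff:
  assumes "length x = length y"
  shows "restr J x = restr J y \<longleftrightarrow> (\<forall>j<length x. j \<in> J \<longrightarrow> x ! j = y ! j)"
  unfolding restr_def assms[symmetric] map_eq_conv by auto

text \<open>Entropy as a mean of negative logarithms under the full law. In this form the deviation
  bounds for all \<open>J\<close> use the same blocks and the same weights.\<close>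

lemma shannon_marg_eq:
  assumes p: "\<And>x. x \<in> tuples Ns \<Longrightarrow> 0 \<le> p x"
  shows "(\<Sum>x\<in>tuples Ns. p x * (- log 2 (marginal Ns p J (restr J x)))) = shannon_marg Ns p J"
proof -
  have m0: "0 \<le> marginal Ns p J y" for y unfolding marginal_def using p by (intro sum_nonneg) auto
  have "(\<Sum>x\<in>tuples Ns. p x * (- log 2 (marginal Ns p J (restr J x))))
      = (\<Sum>y\<in>restr J ` tuples Ns. \<Sum>x\<in>{x\<in>tuples Ns. restr J x = y}. p x * (- log 2 (marginal Ns p J (restr J x))))"
    by (rule sum.image_gen) simp
  also have "\<dots> = (\<Sum>y\<in>restr J ` tuples Ns. - eta (marginal Ns p J y))"
  proof (rule sum.cong[OF refl])
    fix y
    have "(\<Sum>x\<in>{x\<in>tuples Ns. restr J x = y}. p x * (- log 2 (marginal Ns p J (restr J x))))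
        = marginal Ns p J y * (- log 2 (marginal Ns p J y))"
      unfolding marginal_def[of Ns p J y] sum_distrib_right
      by (intro sum.cong refl) (auto simp: marginal_def)
    then show "(\<Sum>x\<in>{x\<in>tuples Ns. restr J x = y}. p x * (- log 2 (marginal Ns p J (restr J x)))) = - eta (marginal Ns p J y)"
      using eta_nonneg_arg[OF m0] by simp
  qed
  finally show ?thesis by (simp add: shannon_marg_def marginal_def sum_negf)
qed

lemma prod_eq_powr_sum_log:
  assumes "\<And>t. t < n \<Longrightarrow> 0 < f t"
  shows "(\<Prod>t<n. f t) = 2 powr (- (\<Sum>t<n. - log 2 (f t)))"
proof -
  have "(\<Prod>t<n. f t) = (\<Prod>t<n. 2 powr (log 2 (f t)))"
    using assms by (intro prod.cong refl) auto
  then show ?thesis by (simp add: powr_sum sum_negf)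
qed

text \<open>Typicality is imposed for every marginal at once. A typical block has weight at least 2
  powr (- n (H(all) + \<delta>)), while the blocks agreeing with x on \<open>J\<close> weigh at most
  2 powr (- n (H(J) - \<delta>)) together; the quotient bounds the number of competitors.
  \<open>V\<close> does not depend on n or \<open>L\<close>, and \<open>L\<close> is only bounded
  from below, which leaves rounding to the caller.\<close>

lemma slepian_wolf:
  fixes R :: "nat \<Rightarrow> real"
  assumes p: "\<And>x. x \<in> tuples Ns \<Longrightarrow> 0 \<le> p x" and p1: "(\<Sum>x\<in>tuples Ns. p x) = 1"
    and R: "R \<in> rate_region_CO (length Ns) Ns p" and \<delta>: "\<delta> > 0"
  shows "\<exists>V. \<forall>n\<ge>1. \<forall>L. (\<forall>j<length Ns. 2 powr (real n * (R j + 3 * \<delta>)) \<le> real (L j)) \<longrightarrow>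
    (\<exists>h\<in>PiE {..<length Ns} (\<lambda>j. PiE {..<(Ns ! j) ^ n} (\<lambda>_. {..<L j})). \<exists>T\<subseteq>blocks Ns n.
      (\<Sum>x\<in>decoding_failures (length Ns) h T (blocks Ns n). \<Prod>t<n. p (letters Ns n x t))
       \<le> V / n + 2 ^ length Ns * 2 powr (- (n * \<delta>)))"
proof -
  define m where "m = length Ns"
  define \<phi> where "\<phi> = (\<lambda>J x. - log 2 (marginal Ns p J (restr J x)))"
  define H where "H = (\<lambda>J. shannon_marg Ns p J)"
  define V where "V = (\<Sum>J\<in>Pow {..<m}. (\<Sum>z\<in>tuples Ns. p z * (\<phi> J z - H J)\<^sup>2) / \<delta>\<^sup>2)"
  have mean: "(\<Sum>x\<in>tuples Ns. p x * \<phi> J x) = H J" for J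
    unfolding \<phi>_def H_def by (rule shannon_marg_eq) (rule p)
  show ?thesis
  proof (intro exI[of _ V] allI impI)
    fix n :: nat and L :: "nat \<Rightarrow> nat"
    assume n: "1 \<le> n" and L: "\<forall>j<length Ns. 2 powr (real n * (R j + 3 * \<delta>)) \<le> real (L j)"
    define P where "P = (\<lambda>c. \<Prod>t<n. p (letters Ns n c t))"
    \<comment> \<open>Positivity is part of typicality because the logarithm of a zero probability
      is only a default value. Blocks of weight zero fall outside \<open>T\<close> at no
      cost.\<close>
    define T where "T = {c\<in>blocks Ns n. 0 < P c \<and> (\<forall>J\<in>Pow {..<m}. \<bar>(\<Sum>t<n. \<phi> J (letters Ns n c t)) - n * H J\<bar> \<le> n * \<delta>)}"
    have P0: "0 \<le> P c" if "c \<in> blocks Ns n" for c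
      unfolding P_def using p letters_in_tuples[OF that] by (intro prod_nonneg) auto
    have P1: "(\<Sum>c\<in>blocks Ns n. P c) = 1"
      unfolding P_def using sum_prod_letters[where g = "\<lambda>_. p" and ds = Ns and n = n] p1 by simp
    have pos: "0 < p (letters Ns n c t)" if c: "c \<in> T" and t: "t < n" for c t
    proof -
      have "P c \<noteq> 0" and cb: "c \<in> blocks Ns n" using c by (auto simp: T_def)
      then have "p (letters Ns n c t) \<noteq> 0" unfolding P_def using t by (auto simp: prod_zero_iff)
      moreover have "0 \<le> p (letters Ns n c t)" using p letters_in_tuples[OF cb t] by blast
      ultimately show ?thesis by simp
    qed
    have marg_full: "marginal Ns p {..<m} (restr {..<m} x) = p x" if "x \<in> tuples Ns" for x
    proof -
      have "{x'\<in>tuples Ns. restr {..<m} x' = restr {..<m} x} = {x}"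
      proof (intro equalityI subsetI)
        fix x' assume "x' \<in> {x'\<in>tuples Ns. restr {..<m} x' = restr {..<m} x}"
        then have x': "x' \<in> tuples Ns" "restr {..<m} x' = restr {..<m} x" by auto
        have "length x' = m" "length x = m" using x'(1) that by (auto simp: m_def dest: length_tuples)
        then show "x' \<in> {x}" using x'(2) by (simp add: restr_cong_iff nth_equalityI)
      qed (use that in auto)
      then show ?thesis by (simp add: marginal_def)
    qed
    have marg_ge: "p x \<le> marginal Ns p J (restr J x)" if "x \<in> tuples Ns" for x J
      unfolding marginal_def using that p by (intro member_le_sum) auto
    have T_blocks: "T \<subseteq> blocks Ns n" by (auto simp: T_def)
    have P_low: "2 powr (- (n * (H {..<m} + \<delta>))) \<le> P c" if c: "c \<in> T" for c
    proof -
      have cb: "c \<in> blocks Ns n" using c T_blocks by auto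
      have "P c = 2 powr (- (\<Sum>t<n. - log 2 (p (letters Ns n c t))))"
        unfolding P_def using pos[OF c] by (intro prod_eq_powr_sum_log) auto
      also have "(\<Sum>t<n. - log 2 (p (letters Ns n c t))) = (\<Sum>t<n. \<phi> {..<m} (letters Ns n c t))"
        unfolding \<phi>_def using marg_full letters_in_tuples[OF cb] by (intro sum.cong refl) simp
      also have "2 powr (- (n * (H {..<m} + \<delta>))) \<le> 2 powr (- \<dots>)"
      proof -
        have "\<bar>(\<Sum>t<n. \<phi> {..<m} (letters Ns n c t)) - n * H {..<m}\<bar> \<le> n * \<delta>" using c by (auto simp: T_def)
        then show ?thesis by (intro powr_mono) (auto simp: algebra_simps)
      qed
      finally show ?thesis .
    qed
    define B where "B = (\<lambda>I. 2 powr (n * (H {..<m} - H ({..<m} - I) + 2 * \<delta>)))"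
    have count: "real (card {x'\<in>T. \<forall>j<m. j \<notin> I \<longrightarrow> x' ! j = x ! j}) \<le> B I"
      if x: "x \<in> T" and I: "I \<subset> {..<m}" "I \<noteq> {}" for x I
    proof -
      define J where "J = {..<m} - I"
      define A where "A = {x'\<in>T. \<forall>j<m. j \<notin> I \<longrightarrow> x' ! j = x ! j}"
      have xb: "x \<in> blocks Ns n" using x T_blocks by auto
      have fA: "finite A" unfolding A_def using T_blocks by (auto intro: finite_subset[of _ "blocks Ns n"])
      have agree: "restr J (letters Ns n x' t) = restr J (letters Ns n x t)" if x': "x' \<in> A" for x' t
      proof -
        have "length x' = length Ns" "length x = length Ns"
          using x' xb T_blocks by (auto simp: A_def dest!: length_tuples)
        then show ?thesis using x' by (subst restr_cong_iff) (auto simp: nth_letters A_def J_def m_def)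
      qed
      have "card A * 2 powr (- (n * (H {..<m} + \<delta>))) \<le> (\<Sum>x'\<in>A. P x')"
        using P_low by (subst sum_constant[symmetric], intro sum_mono) (auto simp: A_def)
      \<comment> \<open>The agreement on \<open>J\<close> is written inside the product, so that
        after enlarging the sum to all blocks it factorises into letter marginals.\<close>
      also have "\<dots> = (\<Sum>x'\<in>A. \<Prod>t<n. if restr J (letters Ns n x' t) = restr J (letters Ns n x t) then p (letters Ns n x' t) else 0)"
        unfolding P_def using agree by (intro sum.cong prod.cong refl) simp
      also have "\<dots> \<le> (\<Sum>x'\<in>blocks Ns n. \<Prod>t<n. if restr J (letters Ns n x' t) = restr J (letters Ns n x t) then p (letters Ns n x' t) else 0)"
        using T_blocks p letters_in_tuples by (intro sum_mono2) (auto simp: A_def intro!: prod_nonneg)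
      also have "\<dots> = (\<Prod>t<n. \<Sum>y\<in>tuples Ns. if restr J y = restr J (letters Ns n x t) then p y else 0)"
        by (rule sum_prod_letters)
      also have "\<dots> = (\<Prod>t<n. marginal Ns p J (restr J (letters Ns n x t)))"
        unfolding marginal_def by (intro prod.cong refl) (simp add: sum.inter_filter)
      also have "\<dots> = 2 powr (- (\<Sum>t<n. - log 2 (marginal Ns p J (restr J (letters Ns n x t)))))"
        using pos[OF x] marg_ge letters_in_tuples[OF xb]
        by (intro prod_eq_powr_sum_log) (meson less_le_trans)
      also have "\<dots> \<le> 2 powr (- (n * (H J - \<delta>)))"
      proof -
        have "J \<in> Pow {..<m}" by (auto simp: J_def)
        then have "\<bar>(\<Sum>t<n. \<phi> J (letters Ns n x t)) - n * H J\<bar> \<le> n * \<delta>" using x unfolding T_def by blast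
        then show ?thesis unfolding \<phi>_def by (intro powr_mono) (auto simp: algebra_simps)
      qed
      finally have "card A * 2 powr (- (n * (H {..<m} + \<delta>))) \<le> 2 powr (- (n * (H J - \<delta>)))" .
      then have "card A * 2 powr (- (n * (H {..<m} + \<delta>))) * 2 powr (n * (H {..<m} + \<delta>))
          \<le> 2 powr (- (n * (H J - \<delta>))) * 2 powr (n * (H {..<m} + \<delta>))"
        by (intro mult_right_mono) auto
      then have "card A \<le> 2 powr (- (n * (H J - \<delta>)) + n * (H {..<m} + \<delta>))"
        by (simp add: mult.assoc powr_add[symmetric])
      also have "- (n * (H J - \<delta>)) + n * (H {..<m} + \<delta>) = n * (H {..<m} - H J + 2 * \<delta>)"
        by (simp add: algebra_simps)
      finally show ?thesis by (simp add: B_def A_def J_def)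
    qed
    have Lpos: "1 \<le> L j" if "j < m" for j
    proof -
      have "0 < real (L j)" using L that unfolding m_def by (metis less_le_trans powr_gt_zero zero_neq_numeral)
      then show ?thesis by simp
    qed
    have atyp: "(\<Sum>c\<in>blocks Ns n - T. P c) \<le> V / n"
    proof -
      \<comment> \<open>A block of positive weight outside \<open>T\<close> deviates for some
        \<open>J\<close>, and Chebyshev's inequality is summed over the finitely many
        \<open>J\<close>.\<close>
      let ?bad = "\<lambda>J c. \<not> \<bar>(\<Sum>t<n. \<phi> J (letters Ns n c t)) - n * H J\<bar> \<le> n * \<delta>"
      have "(\<Sum>c\<in>blocks Ns n - T. P c) \<le> (\<Sum>c\<in>blocks Ns n - T. \<Sum>J\<in>Pow {..<m}. if ?bad J c then P c else 0)"
      proof (rule sum_mono)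
        fix c assume c: "c \<in> blocks Ns n - T"
        show "P c \<le> (\<Sum>J\<in>Pow {..<m}. if ?bad J c then P c else 0)"
        proof (cases "P c = 0")
          case True
          then show ?thesis by (simp add: sum.neutral)
        next
          case False
          then obtain J where J: "J \<in> Pow {..<m}" "?bad J c" using c P0 by (force simp: T_def)
          have "P c = (if ?bad J c then P c else 0)" using J by simp
          also have "\<dots> \<le> (\<Sum>J\<in>Pow {..<m}. if ?bad J c then P c else 0)"
            by (rule member_le_sum[OF J(1)]) (use P0 c in auto)
          finally show ?thesis .
        qed
      qed
      also have "\<dots> \<le> (\<Sum>c\<in>blocks Ns n. \<Sum>J\<in>Pow {..<m}. if ?bad J c then P c else 0)"
        using P0 by (intro sum_mono2) (auto intro!: sum_nonneg)
      also have "\<dots> = (\<Sum>J\<in>Pow {..<m}. \<Sum>c\<in>{c\<in>blocks Ns n. ?bad J c}. P c)"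
        by (subst sum.swap) (simp add: sum.inter_filter)
      also have "\<dots> \<le> (\<Sum>J\<in>Pow {..<m}. (\<Sum>z\<in>tuples Ns. p z * (\<phi> J z - H J)\<^sup>2) / (n * \<delta>\<^sup>2))"
        unfolding P_def using p p1 n \<delta> mean
        by (intro sum_mono iid_chebyshev sum_prod_letters) (auto simp: letters_in_tuples)
      also have "\<dots> = V / n" by (simp add: V_def sum_divide_distrib mult.commute)
      finally show ?thesis .
    qed
    have ex: "\<exists>h\<in>PiE {..<m} (\<lambda>j. PiE {..<(Ns ! j) ^ n} (\<lambda>_. {..<L j})).
      (\<Sum>x\<in>decoding_failures m h T (blocks Ns n). P x)
      \<le> (\<Sum>x\<in>blocks Ns n - T. P x) + (\<Sum>I\<in>{I. I \<subset> {..<m} \<and> I \<noteq> {}}. B I / (\<Prod>j\<in>I. real (L j)))"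
    proof (rule binning_lemma)
      show "length x = m" if "x \<in> blocks Ns n" for x using length_tuples[OF that] by (simp add: m_def)
      show "x ! j \<in> {..<(Ns ! j) ^ n}" if "x \<in> blocks Ns n" "j < m" for x j
        using nth_tuples[OF that(1), of j] that(2) by (simp add: m_def)
    qed (use T_blocks Lpos P0 P1 count in \<open>auto simp: B_def\<close>)
    have col: "(\<Sum>I\<in>{I. I \<subset> {..<m} \<and> I \<noteq> {}}. B I / (\<Prod>j\<in>I. real (L j))) \<le> 2 ^ m * 2 powr (- (n * \<delta>))"
    proof -
      let ?\<I> = "{I. I \<subset> {..<m} \<and> I \<noteq> {}}"
      have "B I / (\<Prod>j\<in>I. real (L j)) \<le> 2 powr (- (n * \<delta>))" if "I \<in> ?\<I>" for I
      proof -
        have I: "I \<subset> {..<m}" "I \<noteq> {}" "finite I" using that by (auto intro: finite_subset[of _ "{..<m}"])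
        have un: "I \<union> ({..<m} - I) = {..<m}" using I by auto
        have rate: "H {..<m} - H ({..<m} - I) \<le> (\<Sum>j\<in>I. R j)"
        proof -
          have "shannon_cond Ns p I ({..<m} - I) \<le> (\<Sum>j\<in>I. R j)"
            using R I(1) unfolding rate_region_CO_def m_def by blast
          then show ?thesis unfolding shannon_cond_def H_def un .
        qed
        \<comment> \<open>Since \<open>I\<close> is non-empty, the surplus of 3\<delta> per player
          is at least 3\<delta> in total; \<open>B\<close> uses up 2\<delta> and the last \<delta>
          makes collisions decay.\<close>
        have "1 \<le> card I" using I by (metis One_nat_def Suc_leI card_gt_0_iff)
        then have "3 * \<delta> * 1 \<le> 3 * \<delta> * real (card I)" using \<delta> by (intro mult_left_mono) auto
        then have "n * (H {..<m} - H ({..<m} - I) + 3 * \<delta>) \<le> n * (\<Sum>j\<in>I. R j + 3 * \<delta>)"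
        proof (intro mult_left_mono)
          have "(\<Sum>j\<in>I. R j + 3 * \<delta>) = (\<Sum>j\<in>I. R j) + 3 * \<delta> * real (card I)"
            by (simp add: sum.distrib mult_ac)
          then show "H {..<m} - H ({..<m} - I) + 3 * \<delta> \<le> (\<Sum>j\<in>I. R j + 3 * \<delta>)"
            using rate \<open>3 * \<delta> * 1 \<le> 3 * \<delta> * real (card I)\<close> by linarith
        qed simp
        then have "2 powr (n * (H {..<m} - H ({..<m} - I) + 3 * \<delta>)) \<le> 2 powr (\<Sum>j\<in>I. n * (R j + 3 * \<delta>))"
          unfolding sum_distrib_left by (intro powr_mono) simp_all
        also have "\<dots> = (\<Prod>j\<in>I. 2 powr (n * (R j + 3 * \<delta>)))" using I by (simp add: powr_sum)
        also have "\<dots> \<le> (\<Prod>j\<in>I. real (L j))" using L I by (intro prod_mono) (auto simp: m_def)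
        finally have low: "2 powr (n * (H {..<m} - H ({..<m} - I) + 3 * \<delta>)) \<le> (\<Prod>j\<in>I. real (L j))" .
        have "B I = 2 powr (- (n * \<delta>)) * 2 powr (n * (H {..<m} - H ({..<m} - I) + 3 * \<delta>))"
          unfolding B_def powr_add[symmetric] by (simp add: algebra_simps)
        also have "\<dots> \<le> 2 powr (- (n * \<delta>)) * (\<Prod>j\<in>I. real (L j))"
          using low by (intro mult_left_mono) auto
        finally show ?thesis
          using less_le_trans[OF _ low, of 0] by (simp add: pos_divide_le_eq)
      qed
      then have "(\<Sum>I\<in>?\<I>. B I / (\<Prod>j\<in>I. real (L j))) \<le> card ?\<I> * 2 powr (- (n * \<delta>))"
        by (rule sum_bounded_above)
      also have "\<dots> \<le> 2 ^ m * 2 powr (- (n * \<delta>))"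
      proof (rule mult_right_mono)
        have "card ?\<I> \<le> card (Pow {..<m})" by (intro card_mono) auto
        then show "real (card ?\<I>) \<le> 2 ^ m" by (simp add: card_Pow)
      qed simp
      finally show ?thesis .
    qed
    show "\<exists>h\<in>PiE {..<length Ns} (\<lambda>j. PiE {..<(Ns ! j) ^ n} (\<lambda>_. {..<L j})). \<exists>T\<subseteq>blocks Ns n.
      (\<Sum>x\<in>decoding_failures (length Ns) h T (blocks Ns n). \<Prod>t<n. p (letters Ns n x t))
       \<le> V / n + 2 ^ length Ns * 2 powr (- (n * \<delta>))"
      unfolding m_def[symmetric] P_def[symmetric]
    proof -
      from ex obtain h where h: "h \<in> PiE {..<m} (\<lambda>j. PiE {..<(Ns ! j) ^ n} (\<lambda>_. {..<L j}))"
        and le: "(\<Sum>x\<in>decoding_failures m h T (blocks Ns n). P x)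
      \<le> (\<Sum>x\<in>blocks Ns n - T. P x) + (\<Sum>I\<in>{I. I \<subset> {..<m} \<and> I \<noteq> {}}. B I / (\<Prod>j\<in>I. real (L j)))"
        by (elim bexE)
      from le have "(\<Sum>x\<in>decoding_failures m h T (blocks Ns n). P x)
         \<le> V / n + 2 ^ m * 2 powr (- (n * \<delta>))" using atyp col by linarith
      then show "\<exists>h\<in>PiE {..<m} (\<lambda>j. PiE {..<(Ns ! j) ^ n} (\<lambda>_. {..<L j})). \<exists>T\<subseteq>blocks Ns n.
        (\<Sum>x\<in>decoding_failures m h T (blocks Ns n). P x)
         \<le> V / n + 2 ^ m * 2 powr (- (n * \<delta>))"
        by (intro bexI[OF _ h] exI[of _ T] conjI T_blocks)
    qed
  qed
qed

section \<open>Matrix blocks\<close>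

lemma sum_prod_tuples:
  fixes g :: "nat \<Rightarrow> nat \<Rightarrow> 'a :: comm_semiring_1"
  shows "(\<Sum>c\<in>tuples ds. \<Prod>j<length ds. g j (c ! j)) = (\<Prod>j<length ds. \<Sum>v<ds ! j. g j v)"
proof (induction ds arbitrary: g)
  case (Cons d ds)
  have "(\<Sum>c\<in>tuples (d # ds). \<Prod>j<length (d # ds). g j (c ! j))
      = (\<Sum>z\<in>{..<d} \<times> tuples ds. g 0 (fst z) * (\<Prod>j<length ds. g (Suc j) (snd z ! j)))"
    unfolding tuples_Cons
    by (subst sum.reindex) (auto simp: inj_on_def prod.lessThan_Suc_shift case_prod_unfold simp del: prod.lessThan_Suc)
  also have "\<dots> = (\<Sum>v<d. g 0 v) * (\<Sum>c\<in>tuples ds. \<Prod>j<length ds. g (Suc j) (c ! j))"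
    by (simp add: sum_product sum.cartesian_product case_prod_unfold)
  also have "\<dots> = (\<Prod>j<length (d # ds). \<Sum>v<(d # ds) ! j. g j v)"
    using Cons[of "\<lambda>j. g (Suc j)"] by (simp add: prod.lessThan_Suc_shift del: prod.lessThan_Suc)
  finally show ?case .
qed simp

text \<open>Testing positivity on the eigenvector \<open>u k\<close> returns its eigenvalue.\<close>

lemma psd_spectral:
  assumes A: "A \<in> carrier_mat n n" "psd A"
  obtains u and a :: "nat \<Rightarrow> real" where
    "\<And>i j. i < n \<Longrightarrow> j < n \<Longrightarrow> ip {..<n} (u i) (u j) = (if i = j then 1 else 0)"
    "\<And>x y. x < n \<Longrightarrow> y < n \<Longrightarrow> (\<Sum>k<n. u k x * cnj (u k y)) = (if x = y then 1 else 0)"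
    "\<And>x y. x < n \<Longrightarrow> y < n \<Longrightarrow> A $$ (x, y) = (\<Sum>k<n. complex_of_real (a k) * u k x * cnj (u k y))"
    "\<And>k. k < n \<Longrightarrow> 0 \<le> a k"
proof -
  have dA: "dim_row A = n" using A by auto
  have h: "adj A = A" using A(2) by (simp add: psd_def)
  from spectral_theorem[OF A(1) h] obtain u and a :: "nat \<Rightarrow> real" where
    on: "\<And>i j. i < n \<Longrightarrow> j < n \<Longrightarrow> ip {..<n} (u i) (u j) = (if i = j then 1 else 0)" and
    compl: "\<And>x y. x < n \<Longrightarrow> y < n \<Longrightarrow> (\<Sum>k<n. u k x * cnj (u k y)) = (if x = y then 1 else 0)" and
    ent: "\<And>x y. x < n \<Longrightarrow> y < n \<Longrightarrow> A $$ (x, y) = (\<Sum>k<n. complex_of_real (a k) * u k x * cnj (u k y))"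
    by blast
  have "0 \<le> a k" if k: "k < n" for k
  proof -
    let ?v = "vec n (u k)"
    have Av: "(A *\<^sub>v ?v) $ x = a k * u k x" if x: "x < n" for x
    proof -
      have "(A *\<^sub>v ?v) $ x = (\<Sum>y<n. A $$ (x, y) * u k y)"
        using A(1) x by (simp add: scalar_prod_def atLeast0LessThan)
      also have "\<dots> = (\<Sum>y<n. \<Sum>l<n. a l * u l x * (cnj (u l y) * u k y))"
        using ent x by (intro sum.cong refl) (simp add: sum_distrib_right mult.assoc)
      also have "\<dots> = (\<Sum>l<n. a l * u l x * ip {..<n} (u l) (u k))"
        unfolding ip_def sum_distrib_left by (rule sum.swap)
      also have "\<dots> = (\<Sum>l<n. if l = k then a l * u l x else 0)"
        using on k by (intro sum.cong refl) auto
      finally show ?thesis using k by simp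
    qed
    have "(\<Sum>i<n. cnj (?v $ i) * (A *\<^sub>v ?v) $ i) = (\<Sum>i<n. a k * (cnj (u k i) * u k i))"
      using Av by (intro sum.cong refl) (simp add: mult_ac)
    also have "\<dots> = a k * ip {..<n} (u k) (u k)" by (simp add: ip_def sum_distrib_left)
    also have "\<dots> = a k" using on k by simp
    finally have "Re (\<Sum>i<n. cnj (?v $ i) * (A *\<^sub>v ?v) $ i) = a k" by simp
    moreover have "?v \<in> carrier_vec n" by simp
    ultimately show ?thesis using A(2) unfolding psd_def dA by metis
  qed
  then show ?thesis using that[OF on compl ent] by blast
qed

lemma psd_gram:
  assumes A: "A \<in> carrier_mat n n"
    and ent: "\<And>x y. x < n \<Longrightarrow> y < n \<Longrightarrow> A $$ (x, y) = (\<Sum>s\<in>S. g s x * cnj (g s y))"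
  shows "psd A"
  unfolding psd_def
proof (intro conjI ballI)
  have dA: "dim_row A = n" "dim_col A = n" using A by auto
  show "A \<in> carrier_mat (dim_row A) (dim_row A)" using A by simp
  show "adj A = A" using A ent by (intro eq_matI) (auto simp: adj_def mult.commute)
  fix v :: "complex vec" assume "v \<in> carrier_vec (dim_row A)"
  then have v: "v \<in> carrier_vec n" using dA by simp
  have "(\<Sum>x<n. cnj (v $ x) * (A *\<^sub>v v) $ x) = (\<Sum>x<n. \<Sum>y<n. \<Sum>s\<in>S. (cnj (v $ x) * g s x) * cnj (cnj (v $ y) * g s y))"
    using v A ent by (intro sum.cong refl)
      (simp add: scalar_prod_def atLeast0LessThan sum_distrib_left sum_distrib_right mult_ac)
  also have "\<dots> = (\<Sum>s\<in>S. \<Sum>x<n. \<Sum>y<n. (cnj (v $ x) * g s x) * cnj (cnj (v $ y) * g s y))"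
    by (subst sum.swap, subst (2) sum.swap, rule refl)
  also have "\<dots> = (\<Sum>s\<in>S. (\<Sum>x<n. cnj (v $ x) * g s x) * cnj (\<Sum>y<n. cnj (v $ y) * g s y))"
    by (simp only: sum_product cnj_sum)
  also have "\<dots> = complex_of_real (\<Sum>s\<in>S. (cmod (\<Sum>x<n. cnj (v $ x) * g s x))\<^sup>2)"
    by (simp only: mult_cnj_self of_real_sum of_real_power)
  finally show "0 \<le> Re (\<Sum>i<dim_row A. cnj (v $ i) * (A *\<^sub>v v) $ i)"
    unfolding dA by (simp add: sum_nonneg)
qed

lemma msum_carrier [simp]: "msum r c f S \<in> carrier_mat r c"
  by (simp add: msum_def)

lemma msum_index: "i < r \<Longrightarrow> j < c \<Longrightarrow> msum r c f S $$ (i, j) = (\<Sum>x\<in>S. f x $$ (i, j))"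
  by (simp add: msum_def)

text \<open>\<open>Y\<close> is \<open>Z\<close> tensored with the identity on the second factor, so
  the partial trace of a product involves \<open>Z\<close> on the first factor alone.\<close>

lemma ptrace_first_mult:
  assumes X: "X \<in> carrier_mat (D * d) (D * d)" and Y: "Y \<in> carrier_mat (D * d) (D * d)" and D: "0 < D"
    and Yent: "\<And>q f a e'. q < D \<Longrightarrow> a < D \<Longrightarrow> f < d \<Longrightarrow> e' < d \<Longrightarrow>
        Y $$ (q * d + f, a * d + e') = (if f = e' then Z q a else 0)"
  shows "ptrace_first D (X * Y) \<in> carrier_mat d d"
    and "e < d \<Longrightarrow> e' < d \<Longrightarrow> ptrace_first D (X * Y) $$ (e, e') = (\<Sum>a<D. \<Sum>q<D. X $$ (a * d + e, q * d + e') * Z q a)"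
proof -
  have dB: "dim_row X div D = d" using X D by simp
  show "ptrace_first D (X * Y) \<in> carrier_mat d d" by (simp add: ptrace_first_def Let_def dB)
  assume e: "e < d" "e' < d"
  have "ptrace_first D (X * Y) $$ (e, e') = (\<Sum>a<D. (X * Y) $$ (a * d + e, a * d + e'))"
    using e dB by (simp add: ptrace_first_def Let_def)
  also have "\<dots> = (\<Sum>a<D. \<Sum>q<D. X $$ (a * d + e, q * d + e') * Z q a)"
  proof (rule sum.cong[OF refl])
    fix a assume "a \<in> {..<D}"
    then have a: "a < D" by simp
    have "(X * Y) $$ (a * d + e, a * d + e') = (\<Sum>i<D * d. X $$ (a * d + e, i) * Y $$ (i, a * d + e'))"
      using X Y index_less_mult_add[OF a e(1)] index_less_mult_add[OF a e(2)]
      by (simp add: scalar_prod_def atLeast0LessThan)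
    also have "\<dots> = (\<Sum>q<D. \<Sum>f<d. X $$ (a * d + e, q * d + f) * Y $$ (q * d + f, a * d + e'))"
      by (rule sum_lessThan_mult)
    also have "\<dots> = (\<Sum>q<D. \<Sum>f<d. if f = e' then X $$ (a * d + e, q * d + e') * Z q a else 0)"
      using Yent a e by (intro sum.cong refl) auto
    also have "\<dots> = (\<Sum>q<D. X $$ (a * d + e, q * d + e') * Z q a)" using e by simp
    finally show "(X * Y) $$ (a * d + e, a * d + e') = (\<Sum>q<D. X $$ (a * d + e, q * d + e') * Z q a)" .
  qed
  finally show "ptrace_first D (X * Y) $$ (e, e') = (\<Sum>a<D. \<Sum>q<D. X $$ (a * d + e, q * d + e') * Z q a)" .
qed

text \<open>\<open>T\<close> is \<open>K\<close> tensored with the identity, so the sandwich acts on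
  the first factor and leaves the indices of the second untouched.\<close>

lemma sandwich_index:
  assumes T: "T \<in> carrier_mat (D' * d) (D * d)" and X: "X \<in> carrier_mat (D * d) (D * d)"
    and Tent: "\<And>a b e f. a < D' \<Longrightarrow> b < D \<Longrightarrow> e < d \<Longrightarrow> f < d \<Longrightarrow>
        T $$ (a * d + e, b * d + f) = (if e = f then K a b else 0)"
    and a: "a < D'" "q < D'" and e: "e < d" "f < d"
  shows "(T * X * adj T) $$ (a * d + e, q * d + f)
    = (\<Sum>b<D. \<Sum>b'<D. K a b * X $$ (b * d + e, b' * d + f) * cnj (K q b'))"
proof -
  have ia: "a * d + e < D' * d" and iq: "q * d + f < D' * d"
    using a e by (auto intro: index_less_mult_add)
  have TX: "(T * X) $$ (a * d + e, i) = (\<Sum>b<D. K a b * X $$ (b * d + e, i))" if i: "i < D * d" for i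
  proof -
    have "(T * X) $$ (a * d + e, i) = (\<Sum>k<D * d. T $$ (a * d + e, k) * X $$ (k, i))"
      using T X ia i by (simp add: scalar_prod_def atLeast0LessThan)
    also have "\<dots> = (\<Sum>b<D. \<Sum>g<d. T $$ (a * d + e, b * d + g) * X $$ (b * d + g, i))"
      by (rule sum_lessThan_mult)
    also have "\<dots> = (\<Sum>b<D. \<Sum>g<d. if g = e then K a b * X $$ (b * d + e, i) else 0)"
      using Tent a e by (intro sum.cong refl) auto
    finally show ?thesis using e by simp
  qed
  have "(T * X * adj T) $$ (a * d + e, q * d + f) = (\<Sum>i<D * d. (T * X) $$ (a * d + e, i) * adj T $$ (i, q * d + f))"
    using T X ia iq by (simp add: scalar_prod_def atLeast0LessThan adj_def)
  also have "\<dots> = (\<Sum>i<D * d. (T * X) $$ (a * d + e, i) * cnj (T $$ (q * d + f, i)))"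
    using T iq by (intro sum.cong refl) (simp add: adj_def)
  also have "\<dots> = (\<Sum>b'<D. \<Sum>g<d. (T * X) $$ (a * d + e, b' * d + g) * cnj (T $$ (q * d + f, b' * d + g)))"
    by (rule sum_lessThan_mult)
  also have "\<dots> = (\<Sum>b'<D. \<Sum>g<d. if g = f then (T * X) $$ (a * d + e, b' * d + f) * cnj (K q b') else 0)"
    using Tent a e by (intro sum.cong refl) auto
  also have "\<dots> = (\<Sum>b'<D. (T * X) $$ (a * d + e, b' * d + f) * cnj (K q b'))" using e by simp
  also have "\<dots> = (\<Sum>b'<D. \<Sum>b<D. K a b * X $$ (b * d + e, b' * d + f) * cnj (K q b'))"
    using TX index_less_mult_add[OF _ e(2)] by (intro sum.cong refl) (simp add: sum_distrib_right)
  finally show ?thesis by (subst sum.swap)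
qed

lemma mr_dec_blocks_snoc:
  assumes "b \<in> blocks ds n" "e < dE ^ n"
  shows "mr_dec (map (\<lambda>d. d ^ n) (ds @ [dE])) (mr_enc (map (\<lambda>d. d ^ n) ds) b * dE ^ n + e) = b @ [e]"
  using assms by (simp add: mr_dec_snoc mr_enc_less mr_dec_mr_enc)

lemma rho_pow_carrier: "rho_pow (ds @ [dE]) \<rho> n \<in> carrier_mat (prod_list (map (\<lambda>d. d ^ n) ds) * dE ^ n) (prod_list (map (\<lambda>d. d ^ n) ds) * dE ^ n)"
  by (simp add: rho_pow_def Let_def)

text \<open>Undoes the regrouping in \<open>rho_pow\<close>: the block index of each system is read
  letter by letter, and copy t sees the t-th letter of every system.\<close>

lemma rho_pow_index:
  assumes b: "b \<in> blocks ds n" "b' \<in> blocks ds n" and e: "e < dE ^ n" "e' < dE ^ n"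
  shows "rho_pow (ds @ [dE]) \<rho> n $$ (mr_enc (map (\<lambda>d. d ^ n) ds) b * dE ^ n + e, mr_enc (map (\<lambda>d. d ^ n) ds) b' * dE ^ n + e')
    = (\<Prod>t<n. \<rho> $$ (mr_enc ds (letters ds n b t) * dE + digit dE n e t, mr_enc ds (letters ds n b' t) * dE + digit dE n e' t))"
proof -
  have idx: "mr_enc (ds @ [dE]) (map (\<lambda>(d, b). mr_dec (replicate n d) b ! t) (zip (ds @ [dE]) (b @ [e])))
      = mr_enc ds (letters ds n b t) * dE + digit dE n e t" if "b \<in> blocks ds n" for b e t
  proof -
    have l: "length b = length ds" using length_tuples[OF that] by simp
    then have "map (\<lambda>(d, b). mr_dec (replicate n d) b ! t) (zip (ds @ [dE]) (b @ [e])) = letters ds n b t @ [digit dE n e t]"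
      by (simp add: letters_def digit_def)
    then show ?thesis using l by (simp add: mr_enc_snoc)
  qed
  have lt: "mr_enc (map (\<lambda>d. d ^ n) ds) b * dE ^ n + e < prod_list (map (\<lambda>d. d ^ n) (ds @ [dE]))"
    if "b \<in> blocks ds n" "e < dE ^ n" for b e
    using index_less_mult_add[OF mr_enc_less[OF that(1)] that(2)] by simp
  show ?thesis
    unfolding rho_pow_def Let_def
    using lt[OF b(1) e(1)] lt[OF b(2) e(2)]
    by (simp only: index_mat case_prod_conv mr_dec_blocks_snoc[OF b(1) e(1)] mr_dec_blocks_snoc[OF b(2) e(2)] idx[OF b(1)] idx[OF b(2)])
qed

section \<open>Measured states\<close>

lemma mtrace_ptrace_first:
  assumes X: "X \<in> carrier_mat (D * d) (D * d)" and D: "0 < D"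
  shows "mtrace (ptrace_first D X) = mtrace X"
proof -
  have dB: "dim_row X div D = d" using X D by simp
  have "mtrace X = (\<Sum>i<D * d. X $$ (i, i))" using X by (simp add: mtrace_def)
  also have "\<dots> = (\<Sum>a<D. \<Sum>e<d. X $$ (a * d + e, a * d + e))" by (rule sum_lessThan_mult)
  also have "\<dots> = (\<Sum>e<d. \<Sum>a<D. X $$ (a * d + e, a * d + e))" by (rule sum.swap)
  also have "\<dots> = mtrace (ptrace_first D X)" by (simp add: mtrace_def ptrace_first_def Let_def dB)
  finally show ?thesis ..
qed

text \<open>The square roots of the eigenvalues are absorbed into the eigenvectors. With such Gram
  forms positivity can be carried through products and partial traces entrywise.\<close>

lemma psd_factor:
  assumes "A \<in> carrier_mat n n" "psd A"
  shows "\<exists>w. \<forall>x<n. \<forall>y<n. A $$ (x, y) = (\<Sum>i<n. w i x * cnj (w i y))"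
proof -
  show ?thesis
  proof (rule psd_spectral[OF assms])
    fix u and a :: "nat \<Rightarrow> real"
    assume ent: "\<And>x y. x < n \<Longrightarrow> y < n \<Longrightarrow> A $$ (x, y) = (\<Sum>k<n. complex_of_real (a k) * u k x * cnj (u k y))"
      and pos: "\<And>k. k < n \<Longrightarrow> 0 \<le> a k"
    have "A $$ (x, y) = (\<Sum>i<n. (complex_of_real (sqrt (a i)) * u i x) * cnj (complex_of_real (sqrt (a i)) * u i y))"
      if "x < n" "y < n" for x y
      unfolding ent[OF that]
    proof (rule sum.cong[OF refl])
      fix k assume "k \<in> {..<n}"
      then have "complex_of_real (a k) = complex_of_real (sqrt (a k)) * complex_of_real (sqrt (a k))"
        using pos by (simp flip: of_real_mult)
      then show "complex_of_real (a k) * u k x * cnj (u k y)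
          = (complex_of_real (sqrt (a k)) * u k x) * cnj (complex_of_real (sqrt (a k)) * u k y)"
        by (simp add: mult_ac)
    qed
    then show "\<exists>w. \<forall>x<n. \<forall>y<n. A $$ (x, y) = (\<Sum>i<n. w i x * cnj (w i y))"
      by (intro exI[of _ "\<lambda>i x. complex_of_real (sqrt (a i)) * u i x"]) simp
  qed
qed

locale measured_state =
  fixes ds :: "nat list" and dE :: nat and \<rho> :: "complex mat" and Ns :: "nat list"
    and M :: "nat \<Rightarrow> nat \<Rightarrow> complex mat"
  assumes rho: "density (prod_list ds * dE) \<rho>"
    and len_Ns: "length Ns = length ds"
    and povm_M: "\<And>j. j < length ds \<Longrightarrow> povm (ds ! j) (Ns ! j) (M j)"
begin

abbreviation "D \<equiv> prod_list ds"
abbreviation "m \<equiv> length ds"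

lemma rho_carrier: "\<rho> \<in> carrier_mat (D * dE) (D * dE)"
  using rho by (simp add: density_def)

text \<open>A zero-dimensional space carries no operator of trace 1.\<close>

lemma dims_pos: "0 < D" "0 < dE"
proof -
  have "mtrace \<rho> = 1" using rho by (simp add: density_def)
  moreover have "mtrace \<rho> = 0" if "D * dE = 0"
    using carrier_matD(1)[OF rho_carrier] unfolding that by (simp add: mtrace_def)
  ultimately have "D * dE \<noteq> 0" by fastforce
  then show "0 < D" "0 < dE" by (metis mult_0 neq0_conv, metis mult_0_right neq0_conv)
qed

lemma M_carrier: "j < m \<Longrightarrow> x < Ns ! j \<Longrightarrow> M j x \<in> carrier_mat (ds ! j) (ds ! j)"
  and M_psd: "j < m \<Longrightarrow> x < Ns ! j \<Longrightarrow> psd (M j x)"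
  using povm_M by (auto simp: povm_def)

lemma M_sum:
  assumes "j < m" "b < ds ! j" "b' < ds ! j"
  shows "(\<Sum>x<Ns ! j. M j x $$ (b, b')) = (if b = b' then 1 else 0)"
proof -
  have "msum (ds ! j) (ds ! j) (M j) {..<Ns ! j} = 1\<^sub>m (ds ! j)" using povm_M[OF assms(1)] by (simp add: povm_def)
  then have "msum (ds ! j) (ds ! j) (M j) {..<Ns ! j} $$ (b, b') = 1\<^sub>m (ds ! j) $$ (b, b')" by simp
  then show ?thesis using assms by (simp add: msum_index)
qed

text \<open>\<open>M j x\<close> is the adjoint of V times V, where V has the entry
  \<open>v j x i b\<close> in row i and column b. Such a V is a measurement operator for outcome x,
  and its rows supply the Kraus operators of the instrument.\<close>

definition meas_factor :: "(nat \<Rightarrow> nat \<Rightarrow> nat \<Rightarrow> nat \<Rightarrow> complex) \<Rightarrow> bool" where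
  "meas_factor v \<longleftrightarrow> (\<forall>j<m. \<forall>x<Ns ! j. \<forall>b<ds ! j. \<forall>b'<ds ! j.
     M j x $$ (b', b) = (\<Sum>i<ds ! j. v j x i b * cnj (v j x i b')))"

lemma exists_meas_factor: "\<exists>v. meas_factor v"
proof -
  have "\<exists>w. j < m \<and> x < Ns ! j \<longrightarrow> (\<forall>b<ds ! j. \<forall>b'<ds ! j. M j x $$ (b', b) = (\<Sum>i<ds ! j. w i b' * cnj (w i b)))" for j x
    using psd_factor[OF M_carrier M_psd, of j x] by blast
  then obtain w where w: "\<And>j x. j < m \<and> x < Ns ! j \<longrightarrow> (\<forall>b<ds ! j. \<forall>b'<ds ! j. M j x $$ (b', b) = (\<Sum>i<ds ! j. w j x i b' * cnj (w j x i b)))"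
    by metis
  show ?thesis
    by (rule exI[of _ "\<lambda>j x i b. cnj (w j x i b)"]) (use w in \<open>simp add: meas_factor_def mult.commute\<close>)
qed

lemma meas_tensor_carrier:
  assumes x: "x \<in> tuples Ns"
  shows "meas_tensor ds dE M x \<in> carrier_mat (D * dE) (D * dE)"
    and "map dim_row (map (\<lambda>j. M j (x ! j)) [0..<m]) = ds"
    and "map dim_col (map (\<lambda>j. M j (x ! j)) [0..<m]) = ds"
proof -
  have c: "M j (x ! j) \<in> carrier_mat (ds ! j) (ds ! j)" if "j < m" for j
    using M_carrier[OF that] nth_tuples[OF x, of j] that len_Ns by simp
  show r: "map dim_row (map (\<lambda>j. M j (x ! j)) [0..<m]) = ds"
    and k: "map dim_col (map (\<lambda>j. M j (x ! j)) [0..<m]) = ds"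
    using carrier_matD[OF c] by (auto intro!: nth_equalityI)
  show "meas_tensor ds dE M x \<in> carrier_mat (D * dE) (D * dE)"
    using r k unfolding meas_tensor_def by (intro carrier_matI) (simp_all del: map_map)
qed

lemma meas_tensor_index:
  assumes x: "x \<in> tuples Ns" and "q < D" "a < D" "f < dE" "e' < dE"
  shows "meas_tensor ds dE M x $$ (q * dE + f, a * dE + e')
    = (if f = e' then \<Prod>j<m. M j (x ! j) $$ (mr_dec ds q ! j, mr_dec ds a ! j) else 0)"
  using tensor_list_snoc_one[of q "map (\<lambda>j. M j (x ! j)) [0..<m]" a f dE e'] assms
  unfolding meas_tensor_carrier(2,3)[OF x] meas_tensor_def by (auto intro!: prod.cong)

lemma cq_block_carrier: "x \<in> tuples Ns \<Longrightarrow> cq_block ds dE \<rho> M x \<in> carrier_mat dE dE"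
  unfolding cq_block_def using meas_tensor_index
  by (intro ptrace_first_mult(1)[OF rho_carrier meas_tensor_carrier(1) dims_pos(1)])

lemma cq_block_index:
  assumes x: "x \<in> tuples Ns" and e: "e < dE" "e' < dE"
  shows "cq_block ds dE \<rho> M x $$ (e, e') = (\<Sum>a\<in>tuples ds. \<Sum>b\<in>tuples ds.
     \<rho> $$ (mr_enc ds a * dE + e, mr_enc ds b * dE + e') * (\<Prod>j<m. M j (x ! j) $$ (b ! j, a ! j)))"
proof -
  have "cq_block ds dE \<rho> M x $$ (e, e') = (\<Sum>a<D. \<Sum>b<D. \<rho> $$ (a * dE + e, b * dE + e')
      * (\<Prod>j<m. M j (x ! j) $$ (mr_dec ds b ! j, mr_dec ds a ! j)))"
    unfolding cq_block_def using meas_tensor_index[OF x]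
    by (intro ptrace_first_mult(2)[OF rho_carrier meas_tensor_carrier(1)[OF x] dims_pos(1)] e)
  also have "\<dots> = (\<Sum>a\<in>tuples ds. \<Sum>b\<in>tuples ds.
     \<rho> $$ (mr_enc ds a * dE + e, mr_enc ds b * dE + e') * (\<Prod>j<m. M j (x ! j) $$ (b ! j, a ! j)))"
    unfolding sum_tuples_mr_enc[symmetric] by (intro sum.cong refl) (simp add: mr_dec_mr_enc)
  finally show ?thesis .
qed

text \<open>Both \<rho> and the POVM elements are Gram matrices. Multiplying the two expansions and
  summing over the players' indices leaves a Gram matrix on the eavesdropper's system, indexed by a
  Gram vector of \<rho> and a tuple of rows of the factors.\<close>

lemma cq_block_psd:
  assumes x: "x \<in> tuples Ns"
  shows "psd (cq_block ds dE \<rho> M x)"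
proof -
  obtain v where v: "meas_factor v" using exists_meas_factor by blast
  have "psd \<rho>" using rho by (simp add: density_def)
  from psd_factor[OF rho_carrier this] obtain w where
    w: "\<And>i j. i < D * dE \<Longrightarrow> j < D * dE \<Longrightarrow> \<rho> $$ (i, j) = (\<Sum>s<D * dE. w s i * cnj (w s j))" by blast
  define K where "K = (\<lambda>ii a. \<Prod>j<m. v j (x ! j) (ii ! j) (a ! j))"
  have Mp: "(\<Prod>j<m. M j (x ! j) $$ (b ! j, a ! j)) = (\<Sum>ii\<in>tuples ds. K ii a * cnj (K ii b))"
    if "a \<in> tuples ds" "b \<in> tuples ds" for a b
  proof -
    have "(\<Prod>j<m. M j (x ! j) $$ (b ! j, a ! j)) = (\<Prod>j<m. \<Sum>i<ds ! j. v j (x ! j) i (a ! j) * cnj (v j (x ! j) i (b ! j)))"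
      using v that x len_Ns by (intro prod.cong refl) (auto simp: meas_factor_def dest!: nth_tuples)
    also have "\<dots> = (\<Sum>ii\<in>tuples ds. \<Prod>j<m. v j (x ! j) (ii ! j) (a ! j) * cnj (v j (x ! j) (ii ! j) (b ! j)))"
      by (rule sum_prod_tuples[symmetric])
    finally show ?thesis by (simp add: K_def prod.distrib)
  qed
  define g where "g = (\<lambda>(s, ii) e. \<Sum>a\<in>tuples ds. w s (mr_enc ds a * dE + e) * K ii a)"
  have "cq_block ds dE \<rho> M x $$ (e, e') = (\<Sum>t\<in>{..<D * dE} \<times> tuples ds. g t e * cnj (g t e'))"
    if e: "e < dE" "e' < dE" for e e'
  proof -
    have "cq_block ds dE \<rho> M x $$ (e, e') = (\<Sum>a\<in>tuples ds. \<Sum>b\<in>tuples ds.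
       (\<Sum>s<D * dE. w s (mr_enc ds a * dE + e) * cnj (w s (mr_enc ds b * dE + e')))
       * (\<Sum>ii\<in>tuples ds. K ii a * cnj (K ii b)))"
      unfolding cq_block_index[OF x e]
      using Mp w index_less_mult_add[OF mr_enc_less e(1)] index_less_mult_add[OF mr_enc_less e(2)]
      by (intro sum.cong refl) simp
    also have "\<dots> = (\<Sum>a\<in>tuples ds. \<Sum>b\<in>tuples ds. \<Sum>t\<in>{..<D * dE} \<times> tuples ds.
        (w (fst t) (mr_enc ds a * dE + e) * K (snd t) a) * cnj (w (fst t) (mr_enc ds b * dE + e') * K (snd t) b))"
    proof -
      have sp: "(\<Sum>s\<in>S. X s) * (\<Sum>i\<in>I. Y i) = (\<Sum>t\<in>S \<times> I. X (fst t) * Y (snd t))"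
        for S :: "nat set" and I :: "nat list set" and X Y :: "_ \<Rightarrow> complex"
        by (simp only: sum_product sum.cartesian_product case_prod_unfold)
      show ?thesis unfolding sp by (simp only: complex_cnj_mult mult_ac)
    qed
    also have "\<dots> = (\<Sum>t\<in>{..<D * dE} \<times> tuples ds. \<Sum>a\<in>tuples ds. \<Sum>b\<in>tuples ds.
        (w (fst t) (mr_enc ds a * dE + e) * K (snd t) a) * cnj (w (fst t) (mr_enc ds b * dE + e') * K (snd t) b))"
      by (subst sum.swap, subst (2) sum.swap, rule refl)
    also have "\<dots> = (\<Sum>t\<in>{..<D * dE} \<times> tuples ds. g t e * cnj (g t e'))"
      by (intro sum.cong refl) (simp only: g_def case_prod_unfold sum_product cnj_sum)
    finally show ?thesis .
  qed
  then show ?thesis by (rule psd_gram[OF cq_block_carrier[OF x]])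
qed

text \<open>Nothing relates the eigenbases of different outcomes; the pair \<open>(x, i)\<close> is
  one classical index. Completeness stands beside orthonormality because evaluating
  \<open>spec_sum\<close> asks for both.\<close>

lemma cq_block_spectrum:
  "\<exists>(l :: nat list \<times> nat \<Rightarrow> real) e. \<forall>x\<in>tuples Ns. (\<forall>i<dE. 0 \<le> l (x, i))
    \<and> (\<forall>i<dE. \<forall>j<dE. ip {..<dE} (e (x, i)) (e (x, j)) = (if i = j then 1 else 0))
    \<and> (\<forall>r<dE. \<forall>s<dE. (\<Sum>i<dE. e (x, i) r * cnj (e (x, i) s)) = (if r = s then 1 else 0))
    \<and> (\<forall>r<dE. \<forall>s<dE. cq_block ds dE \<rho> M x $$ (r, s) = (\<Sum>i<dE. complex_of_real (l (x, i)) * e (x, i) r * cnj (e (x, i) s)))"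
proof -
  define Pr where "Pr = (\<lambda>x (l :: nat \<Rightarrow> real) u. (\<forall>i<dE. 0 \<le> l i)
    \<and> (\<forall>i<dE. \<forall>j<dE. ip {..<dE} (u i) (u j) = (if i = j then 1 else 0))
    \<and> (\<forall>r<dE. \<forall>s<dE. (\<Sum>i<dE. u i r * cnj (u i s)) = (if r = s then 1 else 0))
    \<and> (\<forall>r<dE. \<forall>s<dE. cq_block ds dE \<rho> M x $$ (r, s) = (\<Sum>i<dE. complex_of_real (l i) * u i r * cnj (u i s))))"
  have "\<exists>l u. Pr x l u" if x: "x \<in> tuples Ns" for x
  proof (rule psd_spectral[OF cq_block_carrier[OF x] cq_block_psd[OF x]])
    fix u and a :: "nat \<Rightarrow> real"
    assume "\<And>i j. i < dE \<Longrightarrow> j < dE \<Longrightarrow> ip {..<dE} (u i) (u j) = (if i = j then 1 else 0)"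
      "\<And>r s. r < dE \<Longrightarrow> s < dE \<Longrightarrow> (\<Sum>k<dE. u k r * cnj (u k s)) = (if r = s then 1 else 0)"
      "\<And>r s. r < dE \<Longrightarrow> s < dE \<Longrightarrow> cq_block ds dE \<rho> M x $$ (r, s) = (\<Sum>k<dE. complex_of_real (a k) * u k r * cnj (u k s))"
      "\<And>k. k < dE \<Longrightarrow> 0 \<le> a k"
    then have "Pr x a u" by (simp add: Pr_def)
    then show "\<exists>l u. Pr x l u" by blast
  qed
  then obtain l u where "\<And>x. x \<in> tuples Ns \<Longrightarrow> Pr x (l x) (u x)" by metis
  then show ?thesis unfolding Pr_def
    by (intro exI[of _ "\<lambda>(x, i). l x i"] exI[of _ "\<lambda>(x, i). u x i"] ballI) (simp only: case_prod_conv)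
qed

text \<open>Completeness of every player's POVM reduces the product over players to a delta, so
  averaging over outcomes gives the reduced state of \<rho>, whatever is measured.\<close>

lemma sum_cq_block_index:
  assumes e: "e < dE" "e' < dE"
  shows "(\<Sum>x\<in>tuples Ns. cq_block ds dE \<rho> M x $$ (e, e')) = (\<Sum>a<D. \<rho> $$ (a * dE + e, a * dE + e'))"
proof -
  have tot: "(\<Sum>x\<in>tuples Ns. \<Prod>j<m. M j (x ! j) $$ (b ! j, a ! j)) = (if a = b then 1 else 0)"
    if a: "a \<in> tuples ds" "b \<in> tuples ds" for a b
  proof -
    have "(\<Sum>x\<in>tuples Ns. \<Prod>j<m. M j (x ! j) $$ (b ! j, a ! j)) = (\<Prod>j<m. \<Sum>v<Ns ! j. M j v $$ (b ! j, a ! j))"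
      using sum_prod_tuples[where g = "\<lambda>j v. M j v $$ (b ! j, a ! j)" and ds = Ns] len_Ns by simp
    also have "\<dots> = (\<Prod>j<m. if b ! j = a ! j then 1 else 0)"
      using M_sum nth_tuples[OF a(1)] nth_tuples[OF a(2)] by (intro prod.cong refl) simp
    also have "\<dots> = (if a = b then 1 else 0)"
    proof (cases "a = b")
      case False
      then obtain j where "j < m" "b ! j \<noteq> a ! j"
        using a by (metis length_tuples nth_equalityI)
      then show ?thesis using False by (auto simp: prod_zero_iff)
    qed simp
    finally show ?thesis .
  qed
  have "(\<Sum>x\<in>tuples Ns. cq_block ds dE \<rho> M x $$ (e, e')) = (\<Sum>x\<in>tuples Ns. \<Sum>a\<in>tuples ds. \<Sum>b\<in>tuples ds.
     \<rho> $$ (mr_enc ds a * dE + e, mr_enc ds b * dE + e') * (\<Prod>j<m. M j (x ! j) $$ (b ! j, a ! j)))"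
    using cq_block_index[OF _ e] by simp
  also have "\<dots> = (\<Sum>a\<in>tuples ds. \<Sum>b\<in>tuples ds. \<Sum>x\<in>tuples Ns.
     \<rho> $$ (mr_enc ds a * dE + e, mr_enc ds b * dE + e') * (\<Prod>j<m. M j (x ! j) $$ (b ! j, a ! j)))"
    by (subst sum.swap, rule sum.cong[OF refl], rule sum.swap)
  also have "\<dots> = (\<Sum>a\<in>tuples ds. \<Sum>b\<in>tuples ds. if a = b then \<rho> $$ (mr_enc ds a * dE + e, mr_enc ds b * dE + e') else 0)"
    unfolding sum_distrib_left[symmetric] using tot by (intro sum.cong refl) auto
  also have "\<dots> = (\<Sum>a\<in>tuples ds. \<rho> $$ (mr_enc ds a * dE + e, mr_enc ds a * dE + e'))"
    by simp
  finally show ?thesis by (simp only: sum_tuples_mr_enc[of "\<lambda>a. \<rho> $$ (a * dE + e, a * dE + e')"])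
qed

abbreviation "prob \<equiv> joint_prob ds dE \<rho> M"

text \<open>\<open>joint_prob\<close> takes a real part, which loses nothing because the diagonal of
  a Hermitian block is real.\<close>

lemma joint_prob_trace:
  assumes x: "x \<in> tuples Ns"
  shows "complex_of_real (prob x) = (\<Sum>e<dE. cq_block ds dE \<rho> M x $$ (e, e))"
proof -
  have X: "\<rho> * meas_tensor ds dE M x \<in> carrier_mat (D * dE) (D * dE)"
    using rho_carrier meas_tensor_carrier(1)[OF x] by simp
  have "mtrace (\<rho> * meas_tensor ds dE M x) = (\<Sum>e<dE. cq_block ds dE \<rho> M x $$ (e, e))"
    using mtrace_ptrace_first[OF X dims_pos(1)] cq_block_carrier[OF x]
    by (simp add: cq_block_def mtrace_def[of "ptrace_first _ _"])
  moreover have "complex_of_real (Re (cq_block ds dE \<rho> M x $$ (e, e))) = cq_block ds dE \<rho> M x $$ (e, e)" if "e < dE" for e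
    using hermitian_index[OF cq_block_carrier[OF x] _ that that] cq_block_psd[OF x]
    by (metis Reals_cnj_iff of_real_Re psd_def)
  ultimately show ?thesis unfolding joint_prob_def by (simp add: Re_sum)
qed

lemma sum_joint_prob: "(\<Sum>x\<in>tuples Ns. prob x) = 1"
proof -
  have "complex_of_real (\<Sum>x\<in>tuples Ns. prob x) = (\<Sum>e<dE. \<Sum>x\<in>tuples Ns. cq_block ds dE \<rho> M x $$ (e, e))"
    using joint_prob_trace by (subst sum.swap) simp
  also have "\<dots> = (\<Sum>a<D. \<Sum>e<dE. \<rho> $$ (a * dE + e, a * dE + e))"
    using sum_cq_block_index by (subst sum.swap) simp
  also have "\<dots> = mtrace \<rho>"
    using rho_carrier by (simp add: mtrace_def sum_lessThan_mult)
  also have "\<dots> = 1" using rho by (simp add: density_def)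
  finally show ?thesis using of_real_eq_1_iff by blast
qed

section \<open>Measuring n copies and announcing bins\<close>

definition block_state :: "nat \<Rightarrow> nat list \<Rightarrow> nat \<Rightarrow> nat \<Rightarrow> complex" where
  "block_state n a e e' = (\<Prod>t<n. cq_block ds dE \<rho> M (letters Ns n a t) $$ (digit dE n e t, digit dE n e' t))"

text \<open>Exchanging the product over players with the product over copies makes the double sum
  factorise over copies, and each factor is \<open>cq_block\<close> of one letter tuple.\<close>

lemma block_state_eq:
  assumes a: "a \<in> blocks Ns n" and e: "e < dE ^ n" "e' < dE ^ n"
  shows "(\<Sum>b\<in>blocks ds n. \<Sum>b'\<in>blocks ds n.
      rho_pow (ds @ [dE]) \<rho> n $$ (mr_enc (map (\<lambda>d. d ^ n) ds) b * dE ^ n + e, mr_enc (map (\<lambda>d. d ^ n) ds) b' * dE ^ n + e')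
      * (\<Prod>j<m. \<Prod>t<n. M j (digit (Ns ! j) n (a ! j) t) $$ (digit (ds ! j) n (b' ! j) t, digit (ds ! j) n (b ! j) t)))
    = block_state n a e e'"
proof -
  define G where "G = (\<lambda>t x y. \<rho> $$ (mr_enc ds x * dE + digit dE n e t, mr_enc ds y * dE + digit dE n e' t)
     * (\<Prod>j<m. M j (letters Ns n a t ! j) $$ (y ! j, x ! j)))"
  have "rho_pow (ds @ [dE]) \<rho> n $$ (mr_enc (map (\<lambda>d. d ^ n) ds) b * dE ^ n + e, mr_enc (map (\<lambda>d. d ^ n) ds) b' * dE ^ n + e')
      * (\<Prod>j<m. \<Prod>t<n. M j (digit (Ns ! j) n (a ! j) t) $$ (digit (ds ! j) n (b' ! j) t, digit (ds ! j) n (b ! j) t))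
      = (\<Prod>t<n. G t (letters ds n b t) (letters ds n b' t))" if b: "b \<in> blocks ds n" "b' \<in> blocks ds n" for b b'
  proof -
    have len: "length b = m" "length b' = m" "length a = length Ns" using length_tuples[OF b(1)] length_tuples[OF b(2)] length_tuples[OF a] by auto
    have "(\<Prod>j<m. \<Prod>t<n. M j (digit (Ns ! j) n (a ! j) t) $$ (digit (ds ! j) n (b' ! j) t, digit (ds ! j) n (b ! j) t))
       = (\<Prod>t<n. \<Prod>j<m. M j (letters Ns n a t ! j) $$ (letters ds n b' t ! j, letters ds n b t ! j))"
      using len len_Ns by (subst prod.swap) (simp add: nth_letters)
    then show ?thesis unfolding rho_pow_index[OF b e] G_def prod.distrib by simp
  qed
  then have "(\<Sum>b\<in>blocks ds n. \<Sum>b'\<in>blocks ds n.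
      rho_pow (ds @ [dE]) \<rho> n $$ (mr_enc (map (\<lambda>d. d ^ n) ds) b * dE ^ n + e, mr_enc (map (\<lambda>d. d ^ n) ds) b' * dE ^ n + e')
      * (\<Prod>j<m. \<Prod>t<n. M j (digit (Ns ! j) n (a ! j) t) $$ (digit (ds ! j) n (b' ! j) t, digit (ds ! j) n (b ! j) t)))
     = (\<Sum>b\<in>blocks ds n. \<Sum>b'\<in>blocks ds n. \<Prod>t<n. G t (letters ds n b t) (letters ds n b' t))"
    by (intro sum.cong refl) simp
  also have "\<dots> = (\<Sum>b\<in>blocks ds n. \<Prod>t<n. \<Sum>y\<in>tuples ds. G t (letters ds n b t) y)"
    by (intro sum.cong refl sum_prod_letters[where g = "\<lambda>t. G t (letters ds n _ t)"])
  also have "\<dots> = (\<Prod>t<n. \<Sum>x\<in>tuples ds. \<Sum>y\<in>tuples ds. G t x y)"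
    by (rule sum_prod_letters)
  also have "\<dots> = block_state n a e e'"
    unfolding block_state_def G_def
    using letters_in_tuples[OF a] digit_less[OF e(1)] digit_less[OF e(2)]
    by (intro prod.cong refl) (simp add: cq_block_index)
  finally show ?thesis .
qed

definition block_factor :: "(nat \<Rightarrow> nat \<Rightarrow> nat \<Rightarrow> nat \<Rightarrow> complex) \<Rightarrow> nat \<Rightarrow> nat \<Rightarrow> nat \<Rightarrow> nat \<Rightarrow> nat \<Rightarrow> complex" where
  "block_factor v n j a i b = (\<Prod>t<n. v j (digit (Ns ! j) n a t) (digit (ds ! j) n i t) (digit (ds ! j) n b t))"

lemma block_factor_gram:
  assumes v: "meas_factor v" and j: "j < m" and a: "a < (Ns ! j) ^ n" and b: "b < (ds ! j) ^ n" "b' < (ds ! j) ^ n"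
  shows "(\<Sum>i<(ds ! j) ^ n. block_factor v n j a i b * cnj (block_factor v n j a i b'))
    = (\<Prod>t<n. M j (digit (Ns ! j) n a t) $$ (digit (ds ! j) n b' t, digit (ds ! j) n b t))"
proof -
  have "(\<Sum>i<(ds ! j) ^ n. block_factor v n j a i b * cnj (block_factor v n j a i b'))
    = (\<Sum>i<(ds ! j) ^ n. \<Prod>t<n. (\<lambda>t i. v j (digit (Ns ! j) n a t) i (digit (ds ! j) n b t)
       * cnj (v j (digit (Ns ! j) n a t) i (digit (ds ! j) n b' t))) t (digit (ds ! j) n i t))"
    by (simp add: block_factor_def prod.distrib)
  also have "\<dots> = (\<Prod>t<n. \<Sum>i<ds ! j. v j (digit (Ns ! j) n a t) i (digit (ds ! j) n b t)
       * cnj (v j (digit (Ns ! j) n a t) i (digit (ds ! j) n b' t)))"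
    by (rule sum_prod_digit)
  also have "\<dots> = (\<Prod>t<n. M j (digit (Ns ! j) n a t) $$ (digit (ds ! j) n b' t, digit (ds ! j) n b t))"
    using v j digit_less[OF a] digit_less[OF b(1)] digit_less[OF b(2)]
    by (intro prod.cong refl) (simp add: meas_factor_def)
  finally show ?thesis .
qed

text \<open>Player j's instrument: measuring the block coherently and announcing only the bin \<open>h j a\<close> of the outcome a
  needs one Kraus operator for every row of the measurement's factor, rather than one for every outcome and row.\<close>

definition bin_kraus :: "(nat \<Rightarrow> nat \<Rightarrow> nat \<Rightarrow> nat \<Rightarrow> complex) \<Rightarrow> nat \<Rightarrow> (nat \<Rightarrow> nat \<Rightarrow> nat) \<Rightarrow> nat \<Rightarrow> nat \<Rightarrow> complex mat list" where
  "bin_kraus v n h j l = map (\<lambda>i. mat ((Ns ! j) ^ n) ((ds ! j) ^ n)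
     (\<lambda>(a, b). if h j a = l then block_factor v n j a i b else 0)) [0..<(ds ! j) ^ n]"

text \<open>After the instrument the outcome block sits in the computational basis, in superposition
  with other blocks of its bin. This measurement is diagonal in that basis, so these coherences
  never show.\<close>

definition key_povm :: "nat \<Rightarrow> (nat \<Rightarrow> nat list \<Rightarrow> nat \<Rightarrow> nat) \<Rightarrow> nat \<Rightarrow> nat list \<Rightarrow> nat \<Rightarrow> complex mat" where
  "key_povm n g j ls k = mat ((Ns ! j) ^ n) ((Ns ! j) ^ n) (\<lambda>(q, a). if q = a \<and> g j ls a = k then 1 else 0)"

text \<open>The diagonal key measurement keeps only the diagonal of the evolved operator, and
  summing over the Kraus index restores the POVM elements of the whole block. Coherent binning thus
  gives the same operator as measuring classically, applying \<open>h\<close> and \<open>g\<close>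
  to the outcome and discarding it.\<close>

lemma prot_block_index:
  fixes n :: nat and h :: "nat \<Rightarrow> nat \<Rightarrow> nat" and g :: "nat \<Rightarrow> nat list \<Rightarrow> nat \<Rightarrow> nat"
  assumes v: "meas_factor v"
  defines "P \<equiv> prot_block ds dE \<rho> n (map (\<lambda>d. d ^ n) Ns) (bin_kraus v n h) (key_povm n g)"
  shows "P k ls \<in> carrier_mat (dE ^ n) (dE ^ n)"
    and "e < dE ^ n \<Longrightarrow> e' < dE ^ n \<Longrightarrow> P k ls $$ (e, e') = (\<Sum>a\<in>blocks Ns n.
      if \<forall>j<m. h j (a ! j) = ls ! j \<and> g j ls (a ! j) = k ! j then block_state n a e e' else 0)"
proof -
  let ?NN = "map (\<lambda>d. d ^ n) Ns" and ?dd = "map (\<lambda>d. d ^ n) ds" and ?dn = "dE ^ n"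
  define KR where "KR = (\<lambda>c. map (\<lambda>j. bin_kraus v n h j (ls ! j) ! (c ! j)) [0..<m])"
  define DM where "DM = map (\<lambda>j. key_povm n g j ls (k ! j)) [0..<m]"
  define T where "T = (\<lambda>c. tensor_list (KR c @ [1\<^sub>m ?dn]))"
  \<comment> \<open>The tensor product of the players' Kraus operators acts as \<open>K c\<close> on
    their systems and trivially on the eavesdropper's.\<close>
  define K where "K = (\<lambda>c a b. \<Prod>j<m. if h j (mr_dec ?NN a ! j) = ls ! j
      then block_factor v n j (mr_dec ?NN a ! j) (c ! j) (mr_dec ?dd b ! j) else 0)"
  have C: "map (\<lambda>j. length (bin_kraus v n h j (ls ! j))) [0..<m] = ?dd"
    by (rule nth_equalityI) (auto simp: bin_kraus_def)
  have NN: "map (\<lambda>j. (Ns ! j) ^ n) [0..<m] = ?NN"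
    by (rule nth_equalityI) (auto simp: len_Ns)
  have dd: "map (\<lambda>j. (ds ! j) ^ n) [0..<m] = ?dd"
    by (rule nth_equalityI) auto
  have KR_dims: "map dim_row (KR c) = ?NN" "map dim_col (KR c) = ?dd" if c: "c \<in> blocks ds n" for c
  proof -
    have "c ! j < (ds ! j) ^ n" if "j < m" for j using nth_tuples[OF c, of j] that by simp
    then have "dim_row (bin_kraus v n h j (ls ! j) ! (c ! j)) = (Ns ! j) ^ n"
      "dim_col (bin_kraus v n h j (ls ! j) ! (c ! j)) = (ds ! j) ^ n" if "j < m" for j
      using that by (simp_all add: bin_kraus_def)
    then show "map dim_row (KR c) = ?NN" "map dim_col (KR c) = ?dd"
      unfolding KR_def NN[symmetric] dd[symmetric] by auto
  qed
  have DM_dims: "map dim_row DM = ?NN" "map dim_col DM = ?NN"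
    unfolding DM_def NN[symmetric] by (auto simp: key_povm_def)
  have T_carrier: "T c \<in> carrier_mat (prod_list ?NN * ?dn) (prod_list ?dd * ?dn)" if "c \<in> blocks ds n" for c
    unfolding T_def using KR_dims[OF that] by (intro carrier_matI) simp_all
  have T_ent: "T c $$ (a * ?dn + e, b * ?dn + f) = (if e = f then K c a b else 0)"
    if c: "c \<in> blocks ds n" and "a < prod_list ?NN" "b < prod_list ?dd" "e < ?dn" "f < ?dn" for c a b e f
  proof -
    have "(\<Prod>t<length (KR c). (KR c ! t) $$ (mr_dec ?NN a ! t, mr_dec ?dd b ! t)) = K c a b"
    proof -
      have "(KR c ! j) $$ (mr_dec ?NN a ! j, mr_dec ?dd b ! j) = (if h j (mr_dec ?NN a ! j) = ls ! j
          then block_factor v n j (mr_dec ?NN a ! j) (c ! j) (mr_dec ?dd b ! j) else 0)" if j: "j < m" for j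
      proof -
        have "mr_dec ?NN a ! j < (Ns ! j) ^ n" "mr_dec ?dd b ! j < (ds ! j) ^ n" "c ! j < (ds ! j) ^ n"
          using nth_tuples[OF mr_dec_in_tuples[OF \<open>a < prod_list ?NN\<close>], of j] nth_tuples[OF mr_dec_in_tuples[OF \<open>b < prod_list ?dd\<close>], of j]
            nth_tuples[OF c, of j] j len_Ns by auto
        then show ?thesis using j by (simp add: KR_def bin_kraus_def)
      qed
      then show ?thesis unfolding K_def by (intro prod.cong) (auto simp: KR_def)
    qed
    then show ?thesis unfolding T_def using that KR_dims[OF c] by (subst tensor_list_snoc_one) simp_all
  qed
  define Dk where "Dk = tensor_list (DM @ [1\<^sub>m ?dn])"
  have Dk_carrier: "Dk \<in> carrier_mat (prod_list ?NN * ?dn) (prod_list ?NN * ?dn)"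
    unfolding Dk_def using DM_dims by (intro carrier_matI) simp_all
  define Z where "Z = (\<lambda>q a. if q = a \<and> (\<forall>j<m. g j ls (mr_dec ?NN a ! j) = k ! j) then 1 else (0::complex))"
  have Dk_ent: "Dk $$ (q * ?dn + f, a * ?dn + e') = (if f = e' then Z q a else 0)"
    if q: "q < prod_list ?NN" "a < prod_list ?NN" and f: "f < ?dn" "e' < ?dn" for q a f e'
  proof -
    have "(\<Prod>t<length DM. (DM ! t) $$ (mr_dec ?NN q ! t, mr_dec ?NN a ! t))
       = (\<Prod>j<m. if mr_dec ?NN q ! j = mr_dec ?NN a ! j \<and> g j ls (mr_dec ?NN a ! j) = k ! j then 1 else 0)"
    proof (intro prod.cong)
      fix j assume "j \<in> {..<m}"
      then have j: "j < m" by simp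
      then have "mr_dec ?NN a ! j < (Ns ! j) ^ n" "mr_dec ?NN q ! j < (Ns ! j) ^ n"
        using nth_tuples[OF mr_dec_in_tuples[OF q(1)], of j] nth_tuples[OF mr_dec_in_tuples[OF q(2)], of j] len_Ns by auto
      then show "(DM ! j) $$ (mr_dec ?NN q ! j, mr_dec ?NN a ! j)
         = (if mr_dec ?NN q ! j = mr_dec ?NN a ! j \<and> g j ls (mr_dec ?NN a ! j) = k ! j then 1 else 0)"
        using j by (simp add: DM_def key_povm_def)
    qed (simp add: DM_def)
    also have "\<dots> = Z q a"
    proof (cases "q = a")
      case True
      then show ?thesis by (auto simp: Z_def prod_zero_iff)
    next
      case False
      have "mr_dec ?NN q \<noteq> mr_dec ?NN a" using False q mr_enc_mr_dec by metis
      then obtain j where "j < m" "mr_dec ?NN q ! j \<noteq> mr_dec ?NN a ! j"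
        using nth_equalityI[of "mr_dec ?NN q" "mr_dec ?NN a"] len_Ns by auto
      then show ?thesis using False by (auto simp: Z_def prod_zero_iff)
    qed
    finally show ?thesis unfolding Dk_def using q f DM_dims by (subst tensor_list_snoc_one) simp_all
  qed
  define E where "E = msum (prod_list ?NN * ?dn) (prod_list ?NN * ?dn) (\<lambda>c. T c * rho_pow (ds @ [dE]) \<rho> n * adj (T c)) (blocks ds n)"
  have E_carrier: "E \<in> carrier_mat (prod_list ?NN * ?dn) (prod_list ?NN * ?dn)" by (simp add: E_def)
  have P_eq: "P k ls = ptrace_first (prod_list ?NN) (E * Dk)"
    unfolding P_def prot_block_def Let_def E_def Dk_def T_def KR_def DM_def C ..
  have NN_pos: "0 < prod_list ?NN"
  proof -
    have "tuples Ns \<noteq> {}" using sum_joint_prob by auto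
    then have "0 < card (tuples Ns)" by (simp add: card_gt_0_iff)
    then show ?thesis by (simp add: card_tuples prod_list_map_power del: prod_list_zero_iff)
  qed
  show "P k ls \<in> carrier_mat ?dn ?dn"
    unfolding P_eq by (rule ptrace_first_mult(1)[OF E_carrier Dk_carrier NN_pos Dk_ent])
  assume e: "e < ?dn" "e' < ?dn"
  let ?r = "\<lambda>b b'. rho_pow (ds @ [dE]) \<rho> n $$ (b * ?dn + e, b' * ?dn + e')"
  have "P k ls $$ (e, e') = (\<Sum>a<prod_list ?NN. \<Sum>q<prod_list ?NN. E $$ (a * ?dn + e, q * ?dn + e') * Z q a)"
    unfolding P_eq by (rule ptrace_first_mult(2)[OF E_carrier Dk_carrier NN_pos Dk_ent e])
  also have "\<dots> = (\<Sum>a<prod_list ?NN. E $$ (a * ?dn + e, a * ?dn + e') * Z a a)"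
  proof (rule sum.cong[OF refl])
    fix a assume a: "a \<in> {..<prod_list ?NN}"
    have "(\<Sum>q<prod_list ?NN. E $$ (a * ?dn + e, q * ?dn + e') * Z q a)
        = (\<Sum>q<prod_list ?NN. if q = a then E $$ (a * ?dn + e, a * ?dn + e') * Z a a else 0)"
      by (intro sum.cong refl) (auto simp: Z_def)
    then show "(\<Sum>q<prod_list ?NN. E $$ (a * ?dn + e, q * ?dn + e') * Z q a) = E $$ (a * ?dn + e, a * ?dn + e') * Z a a"
      using a by simp
  qed
  also have "\<dots> = (\<Sum>a<prod_list ?NN. (\<Sum>c\<in>blocks ds n. \<Sum>b<prod_list ?dd. \<Sum>b'<prod_list ?dd.
      K c a b * ?r b b' * cnj (K c a b')) * Z a a)"
  proof (rule sum.cong[OF refl])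
    fix a assume "a \<in> {..<prod_list ?NN}"
    then have a: "a < prod_list ?NN" by simp
    have "E $$ (a * ?dn + e, a * ?dn + e') = (\<Sum>c\<in>blocks ds n. (T c * rho_pow (ds @ [dE]) \<rho> n * adj (T c)) $$ (a * ?dn + e, a * ?dn + e'))"
      unfolding E_def by (rule msum_index) (use a e in \<open>auto intro: index_less_mult_add\<close>)
    also have "\<dots> = (\<Sum>c\<in>blocks ds n. \<Sum>b<prod_list ?dd. \<Sum>b'<prod_list ?dd. K c a b * ?r b b' * cnj (K c a b'))"
      by (rule sum.cong[OF refl], rule sandwich_index[OF T_carrier rho_pow_carrier T_ent a a e])
    finally show "E $$ (a * ?dn + e, a * ?dn + e') * Z a a = (\<Sum>c\<in>blocks ds n. \<Sum>b<prod_list ?dd. \<Sum>b'<prod_list ?dd.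
      K c a b * ?r b b' * cnj (K c a b')) * Z a a" by simp
  qed
  also have "\<dots> = (\<Sum>a\<in>blocks Ns n. (\<Sum>c\<in>blocks ds n. \<Sum>b\<in>blocks ds n. \<Sum>b'\<in>blocks ds n.
      K c (mr_enc ?NN a) (mr_enc ?dd b) * ?r (mr_enc ?dd b) (mr_enc ?dd b') * cnj (K c (mr_enc ?NN a) (mr_enc ?dd b'))) * Z (mr_enc ?NN a) (mr_enc ?NN a))"
    unfolding sum_tuples_mr_enc[symmetric] ..
  also have "\<dots> = (\<Sum>a\<in>blocks Ns n.
      if \<forall>j<m. h j (a ! j) = ls ! j \<and> g j ls (a ! j) = k ! j then block_state n a e e' else 0)"
  proof (rule sum.cong[OF refl])
    fix a assume a: "a \<in> blocks Ns n"
    have an: "a ! j < (Ns ! j) ^ n" if "j < m" for j using nth_tuples[OF a, of j] that len_Ns by simp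
    have KK: "(\<Sum>c\<in>blocks ds n. K c (mr_enc ?NN a) (mr_enc ?dd b) * cnj (K c (mr_enc ?NN a) (mr_enc ?dd b')))
       = (if \<forall>j<m. h j (a ! j) = ls ! j then (\<Prod>j<m. \<Prod>t<n. M j (digit (Ns ! j) n (a ! j) t) $$ (digit (ds ! j) n (b' ! j) t, digit (ds ! j) n (b ! j) t)) else 0)"
      if b: "b \<in> blocks ds n" "b' \<in> blocks ds n" for b b'
    proof -
      have bn: "b ! j < (ds ! j) ^ n" "b' ! j < (ds ! j) ^ n" if "j < m" for j
        using nth_tuples[OF b(1), of j] nth_tuples[OF b(2), of j] that by auto
      have "(\<Sum>c\<in>blocks ds n. K c (mr_enc ?NN a) (mr_enc ?dd b) * cnj (K c (mr_enc ?NN a) (mr_enc ?dd b')))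
         = (\<Sum>c\<in>blocks ds n. \<Prod>j<length ?dd. (\<lambda>j i. if h j (a ! j) = ls ! j then block_factor v n j (a ! j) i (b ! j) * cnj (block_factor v n j (a ! j) i (b' ! j)) else 0) j (c ! j))"
        unfolding K_def mr_dec_mr_enc[OF a] mr_dec_mr_enc[OF b(1)] mr_dec_mr_enc[OF b(2)] cnj_prod prod.distrib[symmetric] length_map
        by (intro sum.cong prod.cong refl) auto
      also have "\<dots> = (\<Prod>j<length ?dd. \<Sum>i<?dd ! j. if h j (a ! j) = ls ! j then block_factor v n j (a ! j) i (b ! j) * cnj (block_factor v n j (a ! j) i (b' ! j)) else 0)"
        by (rule sum_prod_tuples)
      also have "\<dots> = (\<Prod>j<m. if h j (a ! j) = ls ! j then \<Prod>t<n. M j (digit (Ns ! j) n (a ! j) t) $$ (digit (ds ! j) n (b' ! j) t, digit (ds ! j) n (b ! j) t) else 0)"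
        using block_factor_gram[OF v _ an bn] by (intro prod.cong) auto
      also have "\<dots> = (if \<forall>j<m. h j (a ! j) = ls ! j then (\<Prod>j<m. \<Prod>t<n. M j (digit (Ns ! j) n (a ! j) t) $$ (digit (ds ! j) n (b' ! j) t, digit (ds ! j) n (b ! j) t)) else 0)"
      proof (cases "\<forall>j<m. h j (a ! j) = ls ! j")
        case False
        then obtain j where "j < m" "h j (a ! j) \<noteq> ls ! j" by auto
        then show ?thesis using False by (auto simp: prod_zero_iff)
      qed simp
      finally show ?thesis .
    qed
    have "(\<Sum>c\<in>blocks ds n. \<Sum>b\<in>blocks ds n. \<Sum>b'\<in>blocks ds n.
      K c (mr_enc ?NN a) (mr_enc ?dd b) * ?r (mr_enc ?dd b) (mr_enc ?dd b') * cnj (K c (mr_enc ?NN a) (mr_enc ?dd b')))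
      = (\<Sum>b\<in>blocks ds n. \<Sum>b'\<in>blocks ds n. \<Sum>c\<in>blocks ds n.
      K c (mr_enc ?NN a) (mr_enc ?dd b) * ?r (mr_enc ?dd b) (mr_enc ?dd b') * cnj (K c (mr_enc ?NN a) (mr_enc ?dd b')))"
      by (subst sum.swap, rule sum.cong[OF refl], rule sum.swap)
    also have "\<dots> = (\<Sum>b\<in>blocks ds n. \<Sum>b'\<in>blocks ds n. ?r (mr_enc ?dd b) (mr_enc ?dd b') * (\<Sum>c\<in>blocks ds n.
      K c (mr_enc ?NN a) (mr_enc ?dd b) * cnj (K c (mr_enc ?NN a) (mr_enc ?dd b'))))"
      by (intro sum.cong refl) (simp add: sum_distrib_left mult_ac)
    also have "\<dots> = (if \<forall>j<m. h j (a ! j) = ls ! j then block_state n a e e' else 0)"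
      using KK block_state_eq[OF a e] by (auto intro!: sum.neutral cong: sum.cong)
    finally have "(\<Sum>c\<in>blocks ds n. \<Sum>b\<in>blocks ds n. \<Sum>b'\<in>blocks ds n.
      K c (mr_enc ?NN a) (mr_enc ?dd b) * ?r (mr_enc ?dd b) (mr_enc ?dd b') * cnj (K c (mr_enc ?NN a) (mr_enc ?dd b')))
      = (if \<forall>j<m. h j (a ! j) = ls ! j then block_state n a e e' else 0)" .
    then show "(\<Sum>c\<in>blocks ds n. \<Sum>b\<in>blocks ds n. \<Sum>b'\<in>blocks ds n.
      K c (mr_enc ?NN a) (mr_enc ?dd b) * ?r (mr_enc ?dd b) (mr_enc ?dd b') * cnj (K c (mr_enc ?NN a) (mr_enc ?dd b'))) * Z (mr_enc ?NN a) (mr_enc ?NN a)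
      = (if \<forall>j<m. h j (a ! j) = ls ! j \<and> g j ls (a ! j) = k ! j then block_state n a e e' else 0)"
      by (simp only: Z_def mr_dec_mr_enc[OF a]) auto
  qed
  finally show "P k ls $$ (e, e') = (\<Sum>a\<in>blocks Ns n.
      if \<forall>j<m. h j (a ! j) = ls ! j \<and> g j ls (a ! j) = k ! j then block_state n a e e' else 0)" .
qed

end

section \<open>Protocols from classical functions\<close>

lemma digit_add_div: "r < d \<Longrightarrow> (x * d + r) div d = (x :: nat)"
  by (metis add.commute add.right_neutral div_less div_mult_self1 not_less_zero)

lemma digit_add_mod: "r < d \<Longrightarrow> (x * d + r) mod d = (r :: nat)"
  by simp

text \<open>Extending vectors by zero outside block c preserves norms and reproduces the form of
  that block.\<close>

lemma contraction_block:
  fixes W :: "nat \<Rightarrow> nat \<Rightarrow> complex"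
  assumes W: "contraction {..<N * d} W" and c: "c < N"
  shows "contraction {..<d} (\<lambda>r s. W (c * d + r) (c * d + s))"
  unfolding contraction_def
proof (intro allI)
  fix u v
  define ext where "ext = (\<lambda>u i. if i div d = c then u (i mod d) else (0::complex))"
  have ext: "ext u (x * d + r) = (if x = c then u r else 0)" if "r < d" for u x r
    using that by (simp add: ext_def)
  have sums: "(\<Sum>i<N * d. F i) = (\<Sum>r<d. F (c * d + r))"
    if "\<And>x r. x < N \<Longrightarrow> r < d \<Longrightarrow> x \<noteq> c \<Longrightarrow> F (x * d + r) = 0" for F :: "nat \<Rightarrow> 'a :: comm_monoid_add"
  proof -
    have "(\<Sum>i<N * d. F i) = (\<Sum>x<N. if x = c then \<Sum>r<d. F (c * d + r) else 0)"
      unfolding sum_lessThan_mult using that by (intro sum.cong refl) (auto intro!: sum.neutral)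
    then show ?thesis using c by simp
  qed
  have nrm_ext: "nrm {..<N * d} (ext u) = nrm {..<d} u" for u
  proof -
    have "(\<Sum>i<N * d. (cmod (ext u i))\<^sup>2) = (\<Sum>r<d. (cmod (ext u (c * d + r)))\<^sup>2)"
      by (rule sums) (simp add: ext)
    also have "\<dots> = (\<Sum>r<d. (cmod (u r))\<^sup>2)" by (intro sum.cong refl) (simp add: ext)
    finally show ?thesis by (simp add: nrm_def L2_set_def)
  qed
  have mv_ext: "mv {..<N * d} W (ext v) i = (\<Sum>s<d. W i (c * d + s) * v s)" for i
  proof -
    have "mv {..<N * d} W (ext v) i = (\<Sum>s<d. W i (c * d + s) * ext v (c * d + s))"
      unfolding mv_def by (rule sums) (simp add: ext)
    then show ?thesis by (simp add: ext)
  qed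
  have "ip {..<N * d} (ext u) (mv {..<N * d} W (ext v)) = (\<Sum>r<d. cnj (ext u (c * d + r)) * mv {..<N * d} W (ext v) (c * d + r))"
    unfolding ip_def by (rule sums) (simp add: ext)
  also have "\<dots> = ip {..<d} u (mv {..<d} (\<lambda>r s. W (c * d + r) (c * d + s)) v)"
    unfolding ip_def mv_ext unfolding mv_def by (intro sum.cong refl) (simp add: ext)
  finally have "ip {..<d} u (mv {..<d} (\<lambda>r s. W (c * d + r) (c * d + s)) v) = ip {..<N * d} (ext u) (mv {..<N * d} W (ext v))" ..
  then show "cmod (ip {..<d} u (mv {..<d} (\<lambda>r s. W (c * d + r) (c * d + s)) v)) \<le> nrm {..<d} u * nrm {..<d} v"
    using W nrm_ext unfolding contraction_def by metis
qed

lemma sum_if_const: "(\<Sum>r\<in>S. if c then f r else 0) = (if c then \<Sum>r\<in>S. f r else 0)"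
  by simp

lemma prod_delta:
  fixes n :: nat
  shows "(\<Prod>t<n. if f t = g t then 1 else (0 :: 'a :: comm_semiring_1)) = (if \<forall>t<n. f t = g t then 1 else 0)"
proof (cases "\<forall>t<n. f t = g t")
  case False
  then obtain t where t: "t < n" "f t \<noteq> g t" by auto
  have "(\<Prod>t<n. if f t = g t then 1 else (0 :: 'a)) = 0"
    by (rule prod_zero) (use t in \<open>auto intro!: bexI[of _ t]\<close>)
  then show ?thesis using False by simp
qed simp

lemma map_upt_eq_iff:
  assumes "length xs = k"
  shows "map f [0..<k] = xs \<longleftrightarrow> (\<forall>j<k. f j = xs ! j)"
proof -
  have xs: "map (\<lambda>j. xs ! j) [0..<k] = xs" unfolding assms[symmetric] by (rule map_nth)
  have "map f [0..<k] = xs \<longleftrightarrow> map f [0..<k] = map (\<lambda>j. xs ! j) [0..<k]" unfolding xs ..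
  also have "\<dots> \<longleftrightarrow> (\<forall>j\<in>set [0..<k]. f j = xs ! j)" by (rule map_eq_conv)
  finally show ?thesis by (simp only: set_upt atLeastLessThan_iff Ball_def) simp
qed

section \<open>Product eigenbases of the conditional states and the protocol built on them\<close>

context measured_state
begin

text \<open>A predicate rather than a fixed choice: entropies, weights and vectors can all be stated
  for one and the same eigendecomposition.\<close>

definition letter_spectrum :: "(nat list \<times> nat \<Rightarrow> real) \<Rightarrow> (nat list \<times> nat \<Rightarrow> nat \<Rightarrow> complex) \<Rightarrow> bool" where
  "letter_spectrum l e \<longleftrightarrow> (\<forall>x\<in>tuples Ns. (\<forall>i<dE. 0 \<le> l (x, i))
    \<and> (\<forall>i<dE. \<forall>j<dE. ip {..<dE} (e (x, i)) (e (x, j)) = (if i = j then 1 else 0))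
    \<and> (\<forall>r<dE. \<forall>s<dE. (\<Sum>i<dE. e (x, i) r * cnj (e (x, i) s)) = (if r = s then 1 else 0))
    \<and> (\<forall>r<dE. \<forall>s<dE. cq_block ds dE \<rho> M x $$ (r, s) = (\<Sum>i<dE. complex_of_real (l (x, i)) * e (x, i) r * cnj (e (x, i) s))))"

lemma exists_letter_spectrum: "\<exists>l e. letter_spectrum l e"
  unfolding letter_spectrum_def by (rule cq_block_spectrum)

definition block_weight :: "nat \<Rightarrow> (nat list \<times> nat \<Rightarrow> real) \<Rightarrow> nat list \<times> nat \<Rightarrow> real" where
  "block_weight n l z = (\<Prod>t<n. l (letters Ns n (fst z) t, digit dE n (snd z) t))"

definition block_vec :: "nat \<Rightarrow> (nat list \<times> nat \<Rightarrow> nat \<Rightarrow> complex) \<Rightarrow> nat list \<times> nat \<Rightarrow> nat \<Rightarrow> complex" where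
  "block_vec n e z r = (\<Prod>t<n. e (letters Ns n (fst z) t, digit dE n (snd z) t) (digit dE n r t))"

definition block_prob :: "nat \<Rightarrow> nat list \<Rightarrow> real" where
  "block_prob n a = (\<Prod>t<n. prob (letters Ns n a t))"

definition bins :: "(nat \<Rightarrow> nat \<Rightarrow> nat) \<Rightarrow> nat list \<Rightarrow> nat list" where
  "bins h a = map (\<lambda>j. h j (a ! j)) [0..<m]"

lemma block_state_spectral:
  assumes s: "letter_spectrum l e" and a: "a \<in> blocks Ns n" and r: "r < dE ^ n" "r' < dE ^ n"
  shows "block_state n a r r' = (\<Sum>i<dE ^ n. complex_of_real (block_weight n l (a, i)) * block_vec n e (a, i) r * cnj (block_vec n e (a, i) r'))"
proof -
  have "(\<Sum>i<dE ^ n. complex_of_real (block_weight n l (a, i)) * block_vec n e (a, i) r * cnj (block_vec n e (a, i) r'))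
     = (\<Sum>i<dE ^ n. \<Prod>t<n. (\<lambda>t i. complex_of_real (l (letters Ns n a t, i)) * e (letters Ns n a t, i) (digit dE n r t)
          * cnj (e (letters Ns n a t, i) (digit dE n r' t))) t (digit dE n i t))"
    by (simp add: block_weight_def block_vec_def prod.distrib)
  also have "\<dots> = (\<Prod>t<n. \<Sum>i<dE. complex_of_real (l (letters Ns n a t, i)) * e (letters Ns n a t, i) (digit dE n r t)
          * cnj (e (letters Ns n a t, i) (digit dE n r' t)))"
    by (rule sum_prod_digit)
  also have "\<dots> = block_state n a r r'"
    unfolding block_state_def using s letters_in_tuples[OF a] digit_less[OF r(1)] digit_less[OF r(2)]
    by (intro prod.cong refl) (simp add: letter_spectrum_def)
  finally show ?thesis ..
qed

lemma block_vec_orthonormal: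
  assumes s: "letter_spectrum l e" and a: "a \<in> blocks Ns n" and i: "i < dE ^ n" "j < dE ^ n"
  shows "ip {..<dE ^ n} (block_vec n e (a, i)) (block_vec n e (a, j)) = (if i = j then 1 else 0)"
proof -
  have "ip {..<dE ^ n} (block_vec n e (a, i)) (block_vec n e (a, j))
     = (\<Sum>r<dE ^ n. \<Prod>t<n. (\<lambda>t r. cnj (e (letters Ns n a t, digit dE n i t) r) * e (letters Ns n a t, digit dE n j t) r) t (digit dE n r t))"
    by (simp add: ip_def block_vec_def prod.distrib)
  also have "\<dots> = (\<Prod>t<n. \<Sum>r<dE. cnj (e (letters Ns n a t, digit dE n i t) r) * e (letters Ns n a t, digit dE n j t) r)"
    by (rule sum_prod_digit)
  also have "\<dots> = (\<Prod>t<n. if digit dE n i t = digit dE n j t then 1 else 0)"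
    using s letters_in_tuples[OF a] digit_less[OF i(1)] digit_less[OF i(2)]
    by (intro prod.cong refl) (simp add: letter_spectrum_def ip_def)
  also have "\<dots> = (if i = j then 1 else 0)"
    unfolding prod_delta using digit_inject[OF i] by auto
  finally show ?thesis .
qed

text \<open>The trace taken in the eigenbasis. So \<open>l\<close> is a joint distribution of the
  outcome and an eigenvector index, with \<open>prob\<close> as its marginal.\<close>

lemma letter_weight_sum:
  assumes s: "letter_spectrum l e" and x: "x \<in> tuples Ns"
  shows "(\<Sum>i<dE. l (x, i)) = prob x"
proof -
  have "complex_of_real (prob x) = (\<Sum>r<dE. \<Sum>i<dE. complex_of_real (l (x, i)) * (e (x, i) r * cnj (e (x, i) r)))"
    using s x by (simp add: joint_prob_trace letter_spectrum_def mult.assoc)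
  also have "\<dots> = (\<Sum>i<dE. complex_of_real (l (x, i)) * ip {..<dE} (e (x, i)) (e (x, i)))"
    by (subst sum.swap) (simp add: ip_def sum_distrib_left mult_ac)
  also have "\<dots> = complex_of_real (\<Sum>i<dE. l (x, i))"
    using s x by (simp add: letter_spectrum_def)
  finally show ?thesis using of_real_eq_iff by metis
qed

lemma prob_nonneg:
  assumes x: "x \<in> tuples Ns"
  shows "0 \<le> prob x"
proof -
  obtain l e where s: "letter_spectrum l e" using exists_letter_spectrum by blast
  show ?thesis unfolding letter_weight_sum[OF s x, symmetric]
    using s x by (intro sum_nonneg) (simp add: letter_spectrum_def)
qed

lemma letter_weight_sum_all:
  assumes "letter_spectrum l e"
  shows "(\<Sum>z\<in>tuples Ns \<times> {..<dE}. l z) = 1"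
  using letter_weight_sum[OF assms] sum_joint_prob
  by (simp add: sum.cartesian_product[symmetric, where g = "\<lambda>x i. l (x, i)", unfolded case_prod_unfold prod.collapse])

lemma block_weight_nonneg:
  "letter_spectrum l e \<Longrightarrow> z \<in> blocks Ns n \<times> {..<dE ^ n} \<Longrightarrow> 0 \<le> block_weight n l z"
  unfolding block_weight_def by (intro prod_nonneg) (auto simp: letter_spectrum_def letters_in_tuples digit_less)

lemma block_weight_sum:
  assumes s: "letter_spectrum l e" and a: "a \<in> blocks Ns n"
  shows "(\<Sum>i<dE ^ n. block_weight n l (a, i)) = block_prob n a"
proof -
  have "(\<Sum>i<dE ^ n. block_weight n l (a, i)) = (\<Sum>i<dE ^ n. \<Prod>t<n. (\<lambda>t i. l (letters Ns n a t, i)) t (digit dE n i t))"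
    by (simp add: block_weight_def)
  also have "\<dots> = (\<Prod>t<n. \<Sum>i<dE. l (letters Ns n a t, i))" by (rule sum_prod_digit)
  finally show ?thesis unfolding block_prob_def
    using letter_weight_sum[OF s] letters_in_tuples[OF a] by simp
qed

lemma block_prob_nonneg: "a \<in> blocks Ns n \<Longrightarrow> 0 \<le> block_prob n a"
  unfolding block_prob_def by (intro prod_nonneg) (auto simp: prob_nonneg letters_in_tuples)

lemma block_prob_sum: "(\<Sum>a\<in>blocks Ns n. block_prob n a) = 1"
  unfolding block_prob_def using sum_prod_letters[where g = "\<lambda>_. prob" and ds = Ns and n = n] sum_joint_prob by simp

lemma block_state_trace:
  assumes a: "a \<in> blocks Ns n"
  shows "(\<Sum>r<dE ^ n. block_state n a r r) = complex_of_real (block_prob n a)"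
proof -
  have "(\<Sum>r<dE ^ n. block_state n a r r)
     = (\<Sum>r<dE ^ n. \<Prod>t<n. (\<lambda>t r. cq_block ds dE \<rho> M (letters Ns n a t) $$ (r, r)) t (digit dE n r t))"
    by (simp add: block_state_def)
  also have "\<dots> = (\<Prod>t<n. \<Sum>r<dE. cq_block ds dE \<rho> M (letters Ns n a t) $$ (r, r))" by (rule sum_prod_digit)
  finally show ?thesis unfolding block_prob_def
    using joint_prob_trace[OF letters_in_tuples[OF a]] by simp
qed

lemma block_state_cnj:
  assumes a: "a \<in> blocks Ns n" and r: "r < dE ^ n" "r' < dE ^ n"
  shows "cnj (block_state n a r r') = block_state n a r' r"
proof -
  obtain l e where s: "letter_spectrum l e" using exists_letter_spectrum by blast
  show ?thesis unfolding block_state_spectral[OF s a r] block_state_spectral[OF s a r(2,1)]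
    by (simp add: mult_ac)
qed

lemma bins_in_tuples:
  assumes "\<And>j b. j < m \<Longrightarrow> b < (Ns ! j) ^ n \<Longrightarrow> h j b < Ls ! j" "length Ls = m" "a \<in> blocks Ns n"
  shows "bins h a \<in> tuples Ls"
  unfolding tuples_def bins_def using assms(1,2) nth_tuples[OF assms(3)] len_Ns by auto

lemma bins_eq_iff: "length ls = m \<Longrightarrow> bins h a = ls \<longleftrightarrow> (\<forall>j<m. h j (a ! j) = ls ! j)"
  unfolding bins_def by (rule map_upt_eq_iff)

text \<open>Every outcome lies in exactly one bin, so the sum over announcements restores all
  outcomes. The Kraus sum is then a Gram matrix of block factors, and completeness of the POVM
  applies letter by letter.\<close>

lemma bin_kraus_trace_preserving:
  assumes v: "meas_factor v" and j: "j < m" and h: "\<And>b. b < (Ns ! j) ^ n \<Longrightarrow> h j b < L"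
  shows "msum ((ds ! j) ^ n) ((ds ! j) ^ n) (\<lambda>(l, c). adj (bin_kraus v n h j l ! c) * (bin_kraus v n h j l ! c))
     {(l, c). l < L \<and> c < length (bin_kraus v n h j l)} = 1\<^sub>m ((ds ! j) ^ n)"
proof (rule eq_matI)
  let ?d = "(ds ! j) ^ n" and ?N = "(Ns ! j) ^ n"
  fix b b' assume "b < dim_row (1\<^sub>m ?d)" "b' < dim_col (1\<^sub>m ?d)"
  then have b: "b < ?d" "b' < ?d" by auto
  have S: "{(l, c). l < L \<and> c < length (bin_kraus v n h j l)} = {..<L} \<times> {..<?d}"
    by (auto simp: bin_kraus_def)
  have ent: "(adj (bin_kraus v n h j l ! c) * (bin_kraus v n h j l ! c)) $$ (b, b')
     = (\<Sum>a<?N. if h j a = l then cnj (block_factor v n j a c b) * block_factor v n j a c b' else 0)" if c: "c < ?d" for l c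
  proof -
    have "(adj (bin_kraus v n h j l ! c) * (bin_kraus v n h j l ! c)) $$ (b, b')
      = (\<Sum>a<?N. cnj ((bin_kraus v n h j l ! c) $$ (a, b)) * (bin_kraus v n h j l ! c) $$ (a, b'))"
      using c b by (simp add: bin_kraus_def scalar_prod_def adj_def atLeast0LessThan)
    also have "\<dots> = (\<Sum>a<?N. if h j a = l then cnj (block_factor v n j a c b) * block_factor v n j a c b' else 0)"
      using c b by (intro sum.cong refl) (simp add: bin_kraus_def)
    finally show ?thesis .
  qed
  have "msum ?d ?d (\<lambda>(l, c). adj (bin_kraus v n h j l ! c) * (bin_kraus v n h j l ! c))
     {(l, c). l < L \<and> c < length (bin_kraus v n h j l)} $$ (b, b')
     = (\<Sum>l<L. \<Sum>c<?d. \<Sum>a<?N. if h j a = l then cnj (block_factor v n j a c b) * block_factor v n j a c b' else 0)"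
  proof -
    have pairs: "(\<Sum>x\<in>{..<L} \<times> {..<?d}. (case x of (l, c) \<Rightarrow> F l c) $$ (b, b')) = (\<Sum>l<L. \<Sum>c<?d. F l c $$ (b, b'))"
      for F :: "nat \<Rightarrow> nat \<Rightarrow> complex mat"
      by (simp add: sum.cartesian_product case_prod_unfold)
    show ?thesis unfolding S msum_index[OF b] pairs by (intro sum.cong refl ent) simp
  qed
  also have "\<dots> = (\<Sum>c<?d. \<Sum>a<?N. \<Sum>l<L. if h j a = l then cnj (block_factor v n j a c b) * block_factor v n j a c b' else 0)"
    by (subst sum.swap, rule sum.cong[OF refl], rule sum.swap)
  also have "\<dots> = (\<Sum>c<?d. \<Sum>a<?N. block_factor v n j a c b' * cnj (block_factor v n j a c b))"
    using h by (intro sum.cong refl) (simp add: mult.commute)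
  also have "\<dots> = (\<Sum>a<?N. \<Sum>c<?d. block_factor v n j a c b' * cnj (block_factor v n j a c b))"
    by (rule sum.swap)
  also have "\<dots> = (\<Sum>a<?N. \<Prod>t<n. (\<lambda>t x. M j x $$ (digit (ds ! j) n b t, digit (ds ! j) n b' t)) t (digit (Ns ! j) n a t))"
    using block_factor_gram[OF v j _ b(2,1)] by (intro sum.cong refl) simp
  also have "\<dots> = (\<Prod>t<n. \<Sum>x<Ns ! j. M j x $$ (digit (ds ! j) n b t, digit (ds ! j) n b' t))"
    by (rule sum_prod_digit)
  also have "\<dots> = (\<Prod>t<n. if digit (ds ! j) n b t = digit (ds ! j) n b' t then 1 else 0)"
    using digit_less[OF b(1)] digit_less[OF b(2)] by (intro prod.cong refl) (simp add: M_sum[OF j])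
  also have "\<dots> = (if b = b' then 1 else 0)"
    unfolding prod_delta using digit_inject[OF b] by auto
  finally show "msum ?d ?d (\<lambda>(l, c). adj (bin_kraus v n h j l ! c) * (bin_kraus v n h j l ! c))
     {(l, c). l < L \<and> c < length (bin_kraus v n h j l)} $$ (b, b') = 1\<^sub>m ?d $$ (b, b')" using b by simp
qed (simp_all add: msum_def)

lemma povm_key_povm:
  assumes g: "\<And>a. a < (Ns ! j) ^ n \<Longrightarrow> g j ls a < \<kappa>"
  shows "povm ((Ns ! j) ^ n) \<kappa> (key_povm n g j ls)"
  unfolding povm_def
proof (intro conjI allI impI)
  let ?N = "(Ns ! j) ^ n"
  show "key_povm n g j ls x \<in> carrier_mat ?N ?N" for x by (simp add: key_povm_def)
  show "psd (key_povm n g j ls x)" for x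
  proof (rule psd_gram[of _ ?N "\<lambda>s y. if s = y \<and> g j ls y = x then 1 else 0" "{..<?N}"])
    fix r s assume r: "r < ?N" "s < ?N"
    have "(\<Sum>t<?N. (if t = r \<and> g j ls r = x then 1 else 0) * cnj (if t = s \<and> g j ls s = x then 1 else 0))
        = (\<Sum>t<?N. if t = r then (if r = s \<and> g j ls s = x then 1 else 0) else (0::complex))"
      by (intro sum.cong refl) auto
    then show "key_povm n g j ls x $$ (r, s) = (\<Sum>t<?N. (if t = r \<and> g j ls r = x then 1 else 0) * cnj (if t = s \<and> g j ls s = x then 1 else 0))"
      using r by (simp add: key_povm_def)
  qed (simp add: key_povm_def)
  show "msum ?N ?N (key_povm n g j ls) {..<\<kappa>} = 1\<^sub>m ?N"
  proof (rule eq_matI)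
    fix q a assume "q < dim_row (1\<^sub>m ?N)" "a < dim_col (1\<^sub>m ?N)"
    then have qa: "q < ?N" "a < ?N" by auto
    have "(\<Sum>k<\<kappa>. key_povm n g j ls k $$ (q, a)) = (\<Sum>k<\<kappa>. if k = g j ls a then (if q = a then 1 else 0) else 0)"
      using qa by (intro sum.cong refl) (auto simp: key_povm_def)
    then show "msum ?N ?N (key_povm n g j ls) {..<\<kappa>} $$ (q, a) = 1\<^sub>m ?N $$ (q, a)"
      using qa g by (simp add: msum_index)
  qed (simp_all add: msum_def)
qed

text \<open>By the diagonal formula of \<open>prot_block_index\<close>, real and ideal states differ
  by an operator that is block diagonal in key and announcement. Trace-norm duality then yields the
  very expression that \<open>key_insecurity_le\<close> bounds; the 2 in
  \<open>2 * \<epsilon>\<close> pays for the halved trace norm in the definition of secrecy.\<close>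

lemma protocol_from_classical:
  fixes Ls :: "nat list" and \<kappa> :: nat
  assumes m: "1 \<le> m" and \<kappa>: "1 \<le> \<kappa>" and Ls: "length Ls = m"
    and rate: "\<And>j. j < m \<Longrightarrow> real (Ls ! j) \<le> 2 powr (real n * Rs j)"
    and h: "\<And>j b. j < m \<Longrightarrow> b < (Ns ! j) ^ n \<Longrightarrow> h j b < Ls ! j"
    and g: "\<And>j ls b. j < m \<Longrightarrow> b < (Ns ! j) ^ n \<Longrightarrow> g j ls b < \<kappa>"
    and s: "letter_spectrum l e"
    and correct: "(\<Sum>a\<in>{a\<in>blocks Ns n. \<exists>j<m. g j (bins h a) (a ! j) \<noteq> g 0 (bins h a) (a ! 0)}. block_prob n a) \<le> \<epsilon>"
    and secret: "key_insecurity_le \<kappa> (tuples Ls) {..<dE ^ n} (blocks Ns n \<times> {..<dE ^ n}) (block_weight n l) (block_vec n e)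
      (\<lambda>z. bins h (fst z)) (\<lambda>z. g 0 (bins h (fst z)) (fst z ! 0)) (2 * \<epsilon>)"
  shows "is_protocol ds dE \<rho> n Rs \<epsilon> \<kappa>"
proof -
  obtain v where v: "meas_factor v" using exists_meas_factor by blast
  let ?NN = "map (\<lambda>d. d ^ n) Ns" and ?dn = "dE ^ n"
  define L where "L = prod_list Ls"
  define PB where "PB = prot_block ds dE \<rho> n ?NN (bin_kraus v n h) (key_povm n g)"
  have PB_carrier: "PB k ls \<in> carrier_mat ?dn ?dn" for k ls
    unfolding PB_def by (rule prot_block_index(1)[OF v])
  have PB_index: "PB k ls $$ (r, r') = (\<Sum>a\<in>blocks Ns n.
      if \<forall>j<m. h j (a ! j) = ls ! j \<and> g j ls (a ! j) = k ! j then block_state n a r r' else 0)"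
    if "r < ?dn" "r' < ?dn" for k ls r r'
    unfolding PB_def by (rule prot_block_index(2)[OF v that])
  have bt: "bins h a \<in> tuples Ls" if "a \<in> blocks Ns n" for a
    by (rule bins_in_tuples[OF h Ls that])
  have an: "a ! j < (Ns ! j) ^ n" if "a \<in> blocks Ns n" "j < m" for a j
    using nth_tuples[OF that(1), of j] that(2) len_Ns by simp
  have lenls: "length ls = m" if "ls \<in> tuples Ls" for ls using length_tuples[OF that] Ls by simp

  have correctness: "1 - \<epsilon> \<le> (\<Sum>ls\<in>tuples Ls. \<Sum>k<\<kappa>. Re (mtrace (PB (replicate m k) ls)))"
  proof -
    let ?ok = "\<lambda>a ls k. \<forall>j<m. h j (a ! j) = ls ! j \<and> g j ls (a ! j) = k"
    let ?good = "\<lambda>a. \<forall>j<m. g j (bins h a) (a ! j) = g 0 (bins h a) (a ! 0)"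
    have tr: "Re (mtrace (PB (replicate m k) ls)) = (\<Sum>a\<in>blocks Ns n. if ?ok a ls k then block_prob n a else 0)" for k ls
    proof -
      have "mtrace (PB (replicate m k) ls) = (\<Sum>r<?dn. \<Sum>a\<in>blocks Ns n. if ?ok a ls k then block_state n a r r else 0)"
        using PB_carrier[of "replicate m k" ls] by (simp add: mtrace_def PB_index cong: if_cong)
      also have "\<dots> = (\<Sum>a\<in>blocks Ns n. if ?ok a ls k then complex_of_real (block_prob n a) else 0)"
        by (subst sum.swap) (rule sum.cong[OF refl], simp only: sum_if_const block_state_trace)
      also have "\<dots> = complex_of_real (\<Sum>a\<in>blocks Ns n. if ?ok a ls k then block_prob n a else 0)"
        by (simp add: if_distrib cong: if_cong)
      finally show ?thesis by simp
    qed
    have "1 - \<epsilon> \<le> (\<Sum>a\<in>blocks Ns n. block_prob n a) - (\<Sum>a\<in>{a\<in>blocks Ns n. \<not> ?good a}. block_prob n a)"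
      using correct block_prob_sum by auto
    also have "\<dots> = (\<Sum>a\<in>{a\<in>blocks Ns n. ?good a}. block_prob n a)"
    proof -
      have un: "blocks Ns n = {a\<in>blocks Ns n. ?good a} \<union> {a\<in>blocks Ns n. \<not> ?good a}" by blast
      have "(\<Sum>a\<in>{a\<in>blocks Ns n. ?good a} \<union> {a\<in>blocks Ns n. \<not> ?good a}. block_prob n a)
        = (\<Sum>a\<in>{a\<in>blocks Ns n. ?good a}. block_prob n a) + (\<Sum>a\<in>{a\<in>blocks Ns n. \<not> ?good a}. block_prob n a)"
        by (rule sum.union_disjoint) auto
      then show ?thesis unfolding un[symmetric] by simp
    qed
    also have "\<dots> = (\<Sum>a\<in>blocks Ns n. if ?good a then block_prob n a else 0)"
      by (rule sum.inter_filter) simp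
    \<comment> \<open>Each good outcome is found in the term of its own bin tuple and common key;
      all other terms are nonnegative.\<close>
    also have "\<dots> \<le> (\<Sum>a\<in>blocks Ns n. \<Sum>ls\<in>tuples Ls. \<Sum>k<\<kappa>. if ?ok a ls k then block_prob n a else 0)"
    proof (rule sum_mono)
      fix a assume a: "a \<in> blocks Ns n"
      have nn: "0 \<le> (if ?ok a ls k then block_prob n a else 0)" for ls k using block_prob_nonneg[OF a] by simp
      show "(if ?good a then block_prob n a else 0) \<le> (\<Sum>ls\<in>tuples Ls. \<Sum>k<\<kappa>. if ?ok a ls k then block_prob n a else 0)"
      proof (cases "?good a")
        case True
        let ?k = "g 0 (bins h a) (a ! 0)"
        have k: "?k < \<kappa>" using m by (intro g an[OF a]) auto
        have "block_prob n a = (if ?ok a (bins h a) ?k then block_prob n a else 0)"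
          using True by (simp add: bins_def)
        also have "\<dots> \<le> (\<Sum>k<\<kappa>. if ?ok a (bins h a) k then block_prob n a else 0)"
          by (rule member_le_sum[of ?k "{..<\<kappa>}" "\<lambda>k. if ?ok a (bins h a) k then block_prob n a else 0"]) (use k nn in auto)
        also have "\<dots> \<le> (\<Sum>ls\<in>tuples Ls. \<Sum>k<\<kappa>. if ?ok a ls k then block_prob n a else 0)"
          by (rule member_le_sum[OF bt[OF a]]) (intro sum_nonneg nn, simp)
        finally show ?thesis using True by simp
      next
        case False
        then show ?thesis using nn by (simp only: if_False) (intro sum_nonneg, simp)
      qed
    qed
    also have "\<dots> = (\<Sum>ls\<in>tuples Ls. \<Sum>k<\<kappa>. \<Sum>a\<in>blocks Ns n. if ?ok a ls k then block_prob n a else 0)"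
      by (subst sum.swap, rule sum.cong[OF refl], rule sum.swap)
    finally show ?thesis unfolding tr .
  qed

  \<comment> \<open>The reference state is the true joint state of the announcement and the
    eavesdropper's system, so that only the key is replaced. \<open>A0 y\<close> is its block at the
    announcement encoded by y.\<close>
  define A0 where "A0 = (\<lambda>y r r'. \<Sum>a\<in>blocks Ns n. if bins h a = mr_dec Ls y then block_state n a r r' else 0)"
  define \<tau>0 where "\<tau>0 = mat (L * ?dn) (L * ?dn) (\<lambda>(i, j). if i div ?dn = j div ?dn then A0 (i div ?dn) (i mod ?dn) (j mod ?dn) else 0)"
  have dn_pos: "0 < ?dn" using dims_pos by simp
  have divL: "i div ?dn < K" if "i < K * ?dn" for i K
    using that by (simp add: less_mult_imp_div_less)
  have \<tau>0_density: "density (L * ?dn) \<tau>0"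
    unfolding density_def
  proof (intro conjI)
    show c: "\<tau>0 \<in> carrier_mat (L * ?dn) (L * ?dn)" by (simp add: \<tau>0_def)
    \<comment> \<open>Gram vectors: an eigenvector scaled by the root of its weight, placed in the
      block of the announcement that its outcome produces.\<close>
    let ?G = "\<lambda>z i. if bins h (fst z) = mr_dec Ls (i div ?dn) then complex_of_real (sqrt (block_weight n l z)) * block_vec n e z (i mod ?dn) else 0"
    show "psd \<tau>0"
    proof (rule psd_gram[OF c, of ?G "blocks Ns n \<times> {..<?dn}"])
      fix i j assume ij: "i < L * ?dn" "j < L * ?dn"
      have md: "i mod ?dn < ?dn" "j mod ?dn < ?dn" using dn_pos by auto
      have inj: "mr_dec Ls (i div ?dn) = mr_dec Ls (j div ?dn) \<longleftrightarrow> i div ?dn = j div ?dn"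
        using mr_enc_mr_dec[of "i div ?dn" Ls] mr_enc_mr_dec[of "j div ?dn" Ls] divL[OF ij(1)] divL[OF ij(2)]
        unfolding L_def by metis
      have "(\<Sum>z\<in>blocks Ns n \<times> {..<?dn}. ?G z i * cnj (?G z j))
         = (\<Sum>a\<in>blocks Ns n. \<Sum>k<?dn. ?G (a, k) i * cnj (?G (a, k) j))"
        by (simp only: sum.cartesian_product case_prod_unfold prod.collapse)
      also have "\<dots> = (\<Sum>a\<in>blocks Ns n. if bins h a = mr_dec Ls (i div ?dn) \<and> i div ?dn = j div ?dn then block_state n a (i mod ?dn) (j mod ?dn) else 0)"
      proof (rule sum.cong[OF refl])
        fix a assume a: "a \<in> blocks Ns n"
        have "complex_of_real (sqrt (block_weight n l (a, k))) * complex_of_real (sqrt (block_weight n l (a, k))) = complex_of_real (block_weight n l (a, k))"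
          if "k < ?dn" for k using block_weight_nonneg[OF s, of "(a, k)" n] a that by (simp flip: of_real_mult)
        then have "(\<Sum>k<?dn. ?G (a, k) i * cnj (?G (a, k) j)) = (\<Sum>k<?dn. if bins h a = mr_dec Ls (i div ?dn) \<and> i div ?dn = j div ?dn
            then complex_of_real (block_weight n l (a, k)) * block_vec n e (a, k) (i mod ?dn) * cnj (block_vec n e (a, k) (j mod ?dn)) else 0)"
          using inj by (intro sum.cong refl) (auto simp: mult_ac)
        then show "(\<Sum>k<?dn. ?G (a, k) i * cnj (?G (a, k) j)) = (if bins h a = mr_dec Ls (i div ?dn) \<and> i div ?dn = j div ?dn then block_state n a (i mod ?dn) (j mod ?dn) else 0)"
          unfolding block_state_spectral[OF s a md] by (simp only: sum_if_const)
      qed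
      also have "\<dots> = \<tau>0 $$ (i, j)" using ij by (simp add: \<tau>0_def A0_def)
      finally show "\<tau>0 $$ (i, j) = (\<Sum>z\<in>blocks Ns n \<times> {..<?dn}. ?G z i * cnj (?G z j))" ..
    qed
    have "mtrace \<tau>0 = (\<Sum>y<L. \<Sum>r<?dn. \<tau>0 $$ (y * ?dn + r, y * ?dn + r))"
      by (simp only: mtrace_def carrier_matD(1)[OF c] sum_lessThan_mult)
    also have "\<dots> = (\<Sum>y<L. \<Sum>r<?dn. A0 y r r)"
      by (intro sum.cong refl) (simp add: \<tau>0_def index_less_mult_add digit_add_div digit_add_mod)
    also have "\<dots> = (\<Sum>y<L. \<Sum>a\<in>blocks Ns n. if bins h a = mr_dec Ls y then complex_of_real (block_prob n a) else 0)"
      unfolding A0_def by (rule sum.cong[OF refl], subst sum.swap)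
        (rule sum.cong[OF refl], simp only: sum_if_const block_state_trace)
    also have "\<dots> = (\<Sum>a\<in>blocks Ns n. \<Sum>y<L. if bins h a = mr_dec Ls y then complex_of_real (block_prob n a) else 0)"
      by (rule sum.swap)
    also have "\<dots> = (\<Sum>a\<in>blocks Ns n. \<Sum>ls\<in>tuples Ls. if bins h a = ls then complex_of_real (block_prob n a) else 0)"
      unfolding L_def by (simp only: sum_mr_dec[of "\<lambda>ls. if bins h _ = ls then complex_of_real (block_prob n _) else 0"])
    also have "\<dots> = complex_of_real (\<Sum>a\<in>blocks Ns n. block_prob n a)"
      using bt by simp
    finally show "mtrace \<tau>0 = 1" by (simp add: block_prob_sum)
  qed

  define \<Omega> where "\<Omega> = cq_op (\<kappa> * L) ?dn
     (\<lambda>c. msum ?dn ?dn (\<lambda>k. PB k (mr_dec Ls (c mod L))) {k \<in> tuples (replicate m \<kappa>). k ! 0 = c div L})"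
  \<comment> \<open>Real minus ideal: the indicator that player 0 obtains key k, less the uniform
    weight, on outcomes with announcement \<open>ls\<close>.\<close>
  define coef where "coef = (\<lambda>k ls a. if bins h a = ls then (if g 0 (bins h a) (a ! 0) = k then 1 else 0) - 1 / real \<kappa> else 0)"
  define \<Delta> where "\<Delta> = \<Omega> - tensor_list [(1 / of_nat \<kappa>) \<cdot>\<^sub>m 1\<^sub>m \<kappa>, \<tau>0]"
  have L_pos: "0 < L"
  proof -
    have "blocks Ns n \<noteq> {}" using block_prob_sum by (metis sum.empty zero_neq_one)
    then have "tuples Ls \<noteq> {}" using bt by blast
    then have "0 < card (tuples Ls)" by (simp add: card_gt_0_iff)
    then show ?thesis by (simp add: card_tuples L_def del: prod_list_zero_iff)
  qed
  have \<Omega>_index: "\<Omega> $$ ((k * L + y) * ?dn + r, (k' * L + y') * ?dn + r')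
     = (if k = k' \<and> y = y' then \<Sum>a\<in>blocks Ns n. if bins h a = mr_dec Ls y \<and> g 0 (mr_dec Ls y) (a ! 0) = k then block_state n a r r' else 0 else 0)"
    if k: "k < \<kappa>" "k' < \<kappa>" and y: "y < L" "y' < L" and r: "r < ?dn" "r' < ?dn" for k k' y y' r r'
  proof -
    have i1: "(k * L + y) * ?dn + r < \<kappa> * L * ?dn" and i2: "(k' * L + y') * ?dn + r' < \<kappa> * L * ?dn"
      using k y r by (auto intro!: index_less_mult_add)
    have eq: "k * L + y = k' * L + y' \<longleftrightarrow> k = k' \<and> y = y'"
    proof
      assume a: "k * L + y = k' * L + y'"
      have "(k * L + y) div L = k" "(k' * L + y') div L = k'" "(k * L + y) mod L = y" "(k' * L + y') mod L = y'"
        using y by auto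
      then show "k = k' \<and> y = y'" using a by metis
    qed simp
    have ls: "mr_dec Ls y \<in> tuples Ls" using y by (simp add: mr_dec_in_tuples L_def)
    have "\<Omega> $$ ((k * L + y) * ?dn + r, (k' * L + y') * ?dn + r')
       = (if k = k' \<and> y = y' then \<Sum>kk\<in>{kk \<in> tuples (replicate m \<kappa>). kk ! 0 = k}. PB kk (mr_dec Ls y) $$ (r, r') else 0)"
      using i1 i2 r y by (simp add: \<Omega>_def cq_op_def msum_index eq digit_add_div digit_add_mod)
    also have "(\<Sum>kk\<in>{kk \<in> tuples (replicate m \<kappa>). kk ! 0 = k}. PB kk (mr_dec Ls y) $$ (r, r'))
       = (\<Sum>a\<in>blocks Ns n. \<Sum>kk\<in>{kk \<in> tuples (replicate m \<kappa>). kk ! 0 = k}.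
          if \<forall>j<m. h j (a ! j) = mr_dec Ls y ! j \<and> g j (mr_dec Ls y) (a ! j) = kk ! j then block_state n a r r' else 0)"
      unfolding PB_index[OF r] by (rule sum.swap)
    also have "\<dots> = (\<Sum>a\<in>blocks Ns n. if bins h a = mr_dec Ls y \<and> g 0 (mr_dec Ls y) (a ! 0) = k then block_state n a r r' else 0)"
    proof (rule sum.cong[OF refl])
      fix a assume a: "a \<in> blocks Ns n"
      \<comment> \<open>For a given announcement an outcome determines the whole key tuple, so
        summing over the other players' keys leaves at most one term.\<close>
      define K where "K = map (\<lambda>j. g j (mr_dec Ls y) (a ! j)) [0..<m]"
      have K: "K \<in> tuples (replicate m \<kappa>)" using g an[OF a] by (auto simp: tuples_def K_def)
      have "0 < m" using m by linarith
      then have K0: "K ! 0 = g 0 (mr_dec Ls y) (a ! 0)" by (simp add: K_def)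
      have Keq: "(\<forall>j<m. g j (mr_dec Ls y) (a ! j) = kk ! j) \<longleftrightarrow> kk = K" if "kk \<in> tuples (replicate m \<kappa>)" for kk
        using map_upt_eq_iff[of kk m "\<lambda>j. g j (mr_dec Ls y) (a ! j)"] length_tuples[OF that] by (auto simp: K_def)
      have "(\<Sum>kk\<in>{kk \<in> tuples (replicate m \<kappa>). kk ! 0 = k}.
          if \<forall>j<m. h j (a ! j) = mr_dec Ls y ! j \<and> g j (mr_dec Ls y) (a ! j) = kk ! j then block_state n a r r' else 0)
        = (\<Sum>kk\<in>{kk \<in> tuples (replicate m \<kappa>). kk ! 0 = k}. if kk = K then (if bins h a = mr_dec Ls y then block_state n a r r' else 0) else 0)"
      proof (rule sum.cong[OF refl])
        fix kk assume "kk \<in> {kk \<in> tuples (replicate m \<kappa>). kk ! 0 = k}"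
        then have "kk \<in> tuples (replicate m \<kappa>)" by simp
        note Keq[OF this]
        then have "(\<forall>j<m. h j (a ! j) = mr_dec Ls y ! j \<and> g j (mr_dec Ls y) (a ! j) = kk ! j) \<longleftrightarrow> kk = K \<and> bins h a = mr_dec Ls y"
          using bins_eq_iff[OF lenls[OF ls], of h a] by blast
        then show "(if \<forall>j<m. h j (a ! j) = mr_dec Ls y ! j \<and> g j (mr_dec Ls y) (a ! j) = kk ! j then block_state n a r r' else 0)
          = (if kk = K then (if bins h a = mr_dec Ls y then block_state n a r r' else 0) else 0)" by simp
      qed
      also have "\<dots> = (if bins h a = mr_dec Ls y \<and> g 0 (mr_dec Ls y) (a ! 0) = k then block_state n a r r' else 0)"
        using K K0 by simp
      finally show "(\<Sum>kk\<in>{kk \<in> tuples (replicate m \<kappa>). kk ! 0 = k}.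
          if \<forall>j<m. h j (a ! j) = mr_dec Ls y ! j \<and> g j (mr_dec Ls y) (a ! j) = kk ! j then block_state n a r r' else 0)
        = (if bins h a = mr_dec Ls y \<and> g 0 (mr_dec Ls y) (a ! 0) = k then block_state n a r r' else 0)" .
    qed
    finally show ?thesis .
  qed
  have ideal_index: "tensor_list [(1 / of_nat \<kappa>) \<cdot>\<^sub>m 1\<^sub>m \<kappa>, \<tau>0] $$ ((k * L + y) * ?dn + r, (k' * L + y') * ?dn + r')
     = (if k = k' \<and> y = y' then (1 / of_nat \<kappa>) * A0 y r r' else 0)"
    if k: "k < \<kappa>" "k' < \<kappa>" and y: "y < L" "y' < L" and r: "r < ?dn" "r' < ?dn" for k k' y y' r r'
  proof -
    have e: "(k * L + y) * ?dn + r = k * (L * ?dn) + (y * ?dn + r)" for k y r by (simp add: algebra_simps)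
    have i1: "y * ?dn + r < L * ?dn" and i2: "y' * ?dn + r' < L * ?dn" using y r by (auto intro!: index_less_mult_add)
    have j1: "k * (L * ?dn) + (y * ?dn + r) < \<kappa> * (L * ?dn)" and j2: "k' * (L * ?dn) + (y' * ?dn + r') < \<kappa> * (L * ?dn)"
      using k i1 i2 by (auto intro!: index_less_mult_add)
    have "tensor_list [(1 / of_nat \<kappa>) \<cdot>\<^sub>m 1\<^sub>m \<kappa>, \<tau>0] $$ (k * (L * ?dn) + (y * ?dn + r), k' * (L * ?dn) + (y' * ?dn + r'))
      = ((1 / of_nat \<kappa>) \<cdot>\<^sub>m 1\<^sub>m \<kappa>) $$ (k, k') * \<tau>0 $$ (y * ?dn + r, y' * ?dn + r')"
      using j1 j2 i1 i2 by (simp add: tensor_list_def Let_def \<tau>0_def numeral_2_eq_2 digit_add_div digit_add_mod)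
    also have "\<dots> = (if k = k' \<and> y = y' then (1 / of_nat \<kappa>) * A0 y r r' else 0)"
      using k i1 i2 r by (simp add: \<tau>0_def digit_add_div digit_add_mod)
    finally show ?thesis unfolding e .
  qed
  have \<Omega>_carrier: "\<Omega> \<in> carrier_mat (\<kappa> * L * ?dn) (\<kappa> * L * ?dn)" by (simp add: \<Omega>_def cq_op_def)
  have ideal_carrier: "tensor_list [(1 / of_nat \<kappa>) \<cdot>\<^sub>m 1\<^sub>m \<kappa>, \<tau>0] \<in> carrier_mat (\<kappa> * L * ?dn) (\<kappa> * L * ?dn)"
    by (intro carrier_matI) (simp_all add: \<tau>0_def mult_ac)
  have \<Delta>_carrier: "\<Delta> \<in> carrier_mat (\<kappa> * L * ?dn) (\<kappa> * L * ?dn)"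
    unfolding \<Delta>_def using \<Omega>_carrier ideal_carrier by (intro minus_carrier_mat)
  have \<Delta>_index: "\<Delta> $$ ((k * L + y) * ?dn + r, (k' * L + y') * ?dn + r')
     = (if k = k' \<and> y = y' then \<Sum>a\<in>blocks Ns n. complex_of_real (coef k (mr_dec Ls y) a) * block_state n a r r' else 0)"
    if k: "k < \<kappa>" "k' < \<kappa>" and y: "y < L" "y' < L" and r: "r < ?dn" "r' < ?dn" for k k' y y' r r'
  proof -
    have i1: "(k * L + y) * ?dn + r < \<kappa> * L * ?dn" and i2: "(k' * L + y') * ?dn + r' < \<kappa> * L * ?dn"
      using k y r by (auto intro!: index_less_mult_add)
    have "\<Delta> $$ ((k * L + y) * ?dn + r, (k' * L + y') * ?dn + r')
      = (if k = k' \<and> y = y' then (\<Sum>a\<in>blocks Ns n. if bins h a = mr_dec Ls y \<and> g 0 (mr_dec Ls y) (a ! 0) = k then block_state n a r r' else 0)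
         - (1 / of_nat \<kappa>) * A0 y r r' else 0)"
    proof -
      let ?B = "tensor_list [(1 / of_nat \<kappa>) \<cdot>\<^sub>m 1\<^sub>m \<kappa>, \<tau>0]"
      have d: "(k * L + y) * ?dn + r < dim_row ?B" "(k' * L + y') * ?dn + r' < dim_col ?B"
        unfolding carrier_matD[OF ideal_carrier] by (rule i1, rule i2)
      show ?thesis unfolding \<Delta>_def index_minus_mat(1)[OF d] \<Omega>_index[OF that] ideal_index[OF that] by simp
    qed
    also have "(\<Sum>a\<in>blocks Ns n. if bins h a = mr_dec Ls y \<and> g 0 (mr_dec Ls y) (a ! 0) = k then block_state n a r r' else 0)
         - (1 / of_nat \<kappa>) * A0 y r r' = (\<Sum>a\<in>blocks Ns n. complex_of_real (coef k (mr_dec Ls y) a) * block_state n a r r')"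
      unfolding A0_def sum_distrib_left sum_subtractf[symmetric]
      by (intro sum.cong refl) (auto simp: coef_def algebra_simps)
    finally show ?thesis .
  qed
  have split3: "\<exists>k y r. k < \<kappa> \<and> y < L \<and> r < ?dn \<and> i = (k * L + y) * ?dn + r" if i: "i < \<kappa> * L * ?dn" for i
  proof -
    have "i div ?dn < \<kappa> * L" using divL[OF i] .
    then have "i div ?dn div L < \<kappa>" by (simp add: less_mult_imp_div_less)
    moreover have "i div ?dn mod L < L" "i mod ?dn < ?dn" using L_pos dn_pos by auto
    moreover have "i = (i div ?dn div L * L + i div ?dn mod L) * ?dn + i mod ?dn" by (simp only: div_mult_mod_eq)
    ultimately show ?thesis by blast
  qed
  have \<Delta>_adj: "adj \<Delta> = \<Delta>"
  proof (rule eq_matI)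
    fix i j assume "i < dim_row \<Delta>" "j < dim_col \<Delta>"
    then have ij: "i < \<kappa> * L * ?dn" "j < \<kappa> * L * ?dn" using carrier_matD[OF \<Delta>_carrier] by auto
    from split3[OF ij(1)] obtain k y r where i: "k < \<kappa>" "y < L" "r < ?dn" "i = (k * L + y) * ?dn + r" by blast
    from split3[OF ij(2)] obtain k' y' r' where j: "k' < \<kappa>" "y' < L" "r' < ?dn" "j = (k' * L + y') * ?dn + r'" by blast
    have "adj \<Delta> $$ (i, j) = cnj (\<Delta> $$ (j, i))" using ij carrier_matD[OF \<Delta>_carrier] by (simp add: adj_def)
    also have "\<dots> = \<Delta> $$ (i, j)"
      unfolding i(4) j(4) \<Delta>_index[OF i(1) j(1) i(2) j(2) i(3) j(3)] \<Delta>_index[OF j(1) i(1) j(2) i(2) j(3) i(3)]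
      using block_state_cnj[OF _ j(3) i(3)] by simp
    finally show "adj \<Delta> $$ (i, j) = \<Delta> $$ (i, j)" .
  qed (use carrier_matD[OF \<Delta>_carrier] in \<open>auto simp: adj_def\<close>)

  have secrecy: "trace_norm \<Delta> / 2 \<le> \<epsilon>"
  proof -
    from trace_norm_dual[OF \<Delta>_carrier \<Delta>_adj] obtain W where
      W: "contraction {..<\<kappa> * L * ?dn} W" and
      tn: "complex_of_real (trace_norm \<Delta>) = (\<Sum>x<\<kappa> * L * ?dn. \<Sum>y<\<kappa> * L * ?dn. \<Delta> $$ (x, y) * W y x)"
      by blast
    \<comment> \<open>Only the diagonal blocks of \<open>W\<close> enter the pairing with the
      block-diagonal \<Delta>, and each of them is again a contraction.\<close>
    define W' where "W' = (\<lambda>c r s. W ((fst c * L + mr_enc Ls (snd c)) * ?dn + r) ((fst c * L + mr_enc Ls (snd c)) * ?dn + s))"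
    have W'c: "\<forall>c\<in>{..<\<kappa>} \<times> tuples Ls. contraction {..<?dn} (W' c)"
    proof
      fix c assume "c \<in> {..<\<kappa>} \<times> tuples Ls"
      then have "fst c < \<kappa>" "mr_enc Ls (snd c) < L" by (auto simp: L_def mr_enc_less)
      then have "fst c * L + mr_enc Ls (snd c) < \<kappa> * L" by (rule index_less_mult_add)
      then show "contraction {..<?dn} (W' c)" unfolding W'_def by (rule contraction_block[OF W])
    qed
    have "(\<Sum>x<\<kappa> * L * ?dn. \<Sum>y<\<kappa> * L * ?dn. \<Delta> $$ (x, y) * W y x)
      = (\<Sum>k<\<kappa>. \<Sum>y<L. \<Sum>r<?dn. \<Sum>k'<\<kappa>. \<Sum>y'<L. \<Sum>r'<?dn.
          \<Delta> $$ ((k * L + y) * ?dn + r, (k' * L + y') * ?dn + r') * W ((k' * L + y') * ?dn + r') ((k * L + y) * ?dn + r))"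
      by (simp only: sum_lessThan_mult)
    also have "\<dots> = (\<Sum>k<\<kappa>. \<Sum>y<L. \<Sum>r<?dn. \<Sum>r'<?dn.
          (\<Sum>a\<in>blocks Ns n. complex_of_real (coef k (mr_dec Ls y) a) * block_state n a r r') * W ((k * L + y) * ?dn + r') ((k * L + y) * ?dn + r))"
    proof (rule sum.cong[OF refl], rule sum.cong[OF refl], rule sum.cong[OF refl])
      fix k y r assume "k \<in> {..<\<kappa>}" "y \<in> {..<L}" "r \<in> {..<?dn}"
      then have k: "k < \<kappa>" and y: "y < L" and r: "r < ?dn" by auto
      let ?S = "\<Sum>r'<?dn. (\<Sum>a\<in>blocks Ns n. complex_of_real (coef k (mr_dec Ls y) a) * block_state n a r r') * W ((k * L + y) * ?dn + r') ((k * L + y) * ?dn + r)"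
      have "(\<Sum>k'<\<kappa>. \<Sum>y'<L. \<Sum>r'<?dn.
          \<Delta> $$ ((k * L + y) * ?dn + r, (k' * L + y') * ?dn + r') * W ((k' * L + y') * ?dn + r') ((k * L + y) * ?dn + r))
        = (\<Sum>k'<\<kappa>. \<Sum>y'<L. if k' = k then (if y' = y then ?S else 0) else 0)"
        using \<Delta>_index[OF k _ y _ r] by (intro sum.cong refl) (auto intro!: sum.neutral)
      also have "\<dots> = (\<Sum>k'<\<kappa>. if k' = k then ?S else 0)"
        using y by (intro sum.cong refl) simp
      finally show "(\<Sum>k'<\<kappa>. \<Sum>y'<L. \<Sum>r'<?dn.
          \<Delta> $$ ((k * L + y) * ?dn + r, (k' * L + y') * ?dn + r') * W ((k' * L + y') * ?dn + r') ((k * L + y) * ?dn + r)) = ?S"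
        using k by simp
    qed
    also have "\<dots> = (\<Sum>k<\<kappa>. \<Sum>ls\<in>tuples Ls. \<Sum>r<?dn. \<Sum>r'<?dn.
          (\<Sum>a\<in>blocks Ns n. complex_of_real (coef k ls a) * block_state n a r r') * W' (k, ls) r' r)"
      unfolding L_def sum_tuples_mr_enc[symmetric]
      by (intro sum.cong refl) (simp add: mr_dec_mr_enc W'_def L_def)
    also have "\<dots> = (\<Sum>k<\<kappa>. \<Sum>ls\<in>tuples Ls. \<Sum>z\<in>blocks Ns n \<times> {..<?dn}.
        complex_of_real (coef k ls (fst z) * block_weight n l z) * ip {..<?dn} (block_vec n e z) (mv {..<?dn} (W' (k, ls)) (block_vec n e z)))"
    proof (rule sum.cong[OF refl], rule sum.cong[OF refl])
      fix k ls
      have "(\<Sum>r<?dn. \<Sum>r'<?dn. (\<Sum>a\<in>blocks Ns n. complex_of_real (coef k ls a) * block_state n a r r') * W' (k, ls) r' r)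
        = (\<Sum>r<?dn. \<Sum>r'<?dn. \<Sum>a\<in>blocks Ns n. \<Sum>i<?dn. complex_of_real (coef k ls a * block_weight n l (a, i))
            * (cnj (block_vec n e (a, i) r') * (W' (k, ls) r' r * block_vec n e (a, i) r)))"
        using block_state_spectral[OF s]
        by (intro sum.cong refl) (simp add: sum_distrib_left sum_distrib_right mult_ac)
      also have "\<dots> = (\<Sum>r<?dn. \<Sum>r'<?dn. \<Sum>z\<in>blocks Ns n \<times> {..<?dn}. complex_of_real (coef k ls (fst z) * block_weight n l z)
            * (cnj (block_vec n e z r') * (W' (k, ls) r' r * block_vec n e z r)))"
        by (simp only: sum.cartesian_product case_prod_unfold prod.collapse)
      also have "\<dots> = (\<Sum>z\<in>blocks Ns n \<times> {..<?dn}. \<Sum>r<?dn. \<Sum>r'<?dn. complex_of_real (coef k ls (fst z) * block_weight n l z)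
            * (cnj (block_vec n e z r') * (W' (k, ls) r' r * block_vec n e z r)))"
        by (subst sum.swap, subst (2) sum.swap, rule refl)
      also have "\<dots> = (\<Sum>z\<in>blocks Ns n \<times> {..<?dn}. \<Sum>r'<?dn. \<Sum>r<?dn. complex_of_real (coef k ls (fst z) * block_weight n l z)
            * (cnj (block_vec n e z r') * (W' (k, ls) r' r * block_vec n e z r)))"
        by (rule sum.cong[OF refl], rule sum.swap)
      also have "\<dots> = (\<Sum>z\<in>blocks Ns n \<times> {..<?dn}.
        complex_of_real (coef k ls (fst z) * block_weight n l z) * ip {..<?dn} (block_vec n e z) (mv {..<?dn} (W' (k, ls)) (block_vec n e z)))"
        unfolding ip_def mv_def by (simp only: sum_distrib_left)
      finally show "(\<Sum>r<?dn. \<Sum>r'<?dn. (\<Sum>a\<in>blocks Ns n. complex_of_real (coef k ls a) * block_state n a r r') * W' (k, ls) r' r)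
        = (\<Sum>z\<in>blocks Ns n \<times> {..<?dn}.
        complex_of_real (coef k ls (fst z) * block_weight n l z) * ip {..<?dn} (block_vec n e z) (mv {..<?dn} (W' (k, ls)) (block_vec n e z)))" .
    qed
    also have "\<dots> = (\<Sum>c\<in>{..<\<kappa>} \<times> tuples Ls. \<Sum>z\<in>blocks Ns n \<times> {..<dE ^ n}.
        complex_of_real ((if bins h (fst z) = snd c then (if g 0 (bins h (fst z)) (fst z ! 0) = fst c then 1 else 0) - 1 / \<kappa> else 0) * block_weight n l z)
        * ip {..<dE ^ n} (block_vec n e z) (mv {..<dE ^ n} (W' c) (block_vec n e z)))"
    proof -
      have pairs: "(\<Sum>c\<in>{..<\<kappa>} \<times> tuples Ls. Z c) = (\<Sum>k<\<kappa>. \<Sum>ls\<in>tuples Ls. Z (k, ls))" for Z :: "nat \<times> nat list \<Rightarrow> complex"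
        by (simp only: sum.cartesian_product case_prod_unfold prod.collapse)
      show ?thesis unfolding coef_def pairs fst_conv snd_conv ..
    qed
    finally have "cmod (complex_of_real (trace_norm \<Delta>)) \<le> 2 * \<epsilon>" unfolding tn using secret[unfolded key_insecurity_le_def, THEN spec, THEN mp, OF W'c] by simp
    then show ?thesis by simp
  qed

  show ?thesis
    unfolding is_protocol_def Let_def
  proof (rule exI[of _ Ls], rule exI[of _ ?NN], rule exI[of _ "bin_kraus v n h"], rule exI[of _ "key_povm n g"], intro conjI)
    show "length Ls = m" by (rule Ls)
    show "length ?NN = m" by (simp add: len_Ns)
    show "\<forall>j<m. real (Ls ! j) \<le> 2 powr (real n * Rs j)" using rate by simp
    show "\<forall>j<m. \<forall>l<Ls ! j. \<forall>K\<in>set (bin_kraus v n h j l). K \<in> carrier_mat (?NN ! j) ((ds ! j) ^ n)"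
      by (auto simp: bin_kraus_def len_Ns)
    show "\<forall>j<m. msum ((ds ! j) ^ n) ((ds ! j) ^ n) (\<lambda>(l, c). adj (bin_kraus v n h j l ! c) * (bin_kraus v n h j l ! c))
       {(l, c). l < Ls ! j \<and> c < length (bin_kraus v n h j l)} = 1\<^sub>m ((ds ! j) ^ n)"
      by (intro allI impI bin_kraus_trace_preserving v h)
    show "\<forall>j<m. \<forall>ls\<in>tuples Ls. povm (?NN ! j) \<kappa> (key_povm n g j ls)"
    proof (intro allI impI ballI)
      fix j ls assume j: "j < m"
      have "povm ((Ns ! j) ^ n) \<kappa> (key_povm n g j ls)" by (rule povm_key_povm) (rule g[OF j])
      then show "povm (?NN ! j) \<kappa> (key_povm n g j ls)" using j by (simp add: len_Ns)
    qed
    show "1 - \<epsilon> \<le> (\<Sum>ls\<in>tuples Ls. \<Sum>k<\<kappa>. Re (mtrace (prot_block ds dE \<rho> n ?NN (bin_kraus v n h) (key_povm n g) (replicate m k) ls)))"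
      using correctness unfolding PB_def .
    show "\<exists>\<tau>0. density (prod_list Ls * ?dn) \<tau>0 \<and>
      trace_norm (cq_op (\<kappa> * prod_list Ls) ?dn (\<lambda>c. msum ?dn ?dn (\<lambda>k. prot_block ds dE \<rho> n ?NN (bin_kraus v n h) (key_povm n g) k (mr_dec Ls (c mod prod_list Ls)))
         {k \<in> tuples (replicate m \<kappa>). k ! 0 = c div prod_list Ls}) - tensor_list [(1 / of_nat \<kappa>) \<cdot>\<^sub>m 1\<^sub>m \<kappa>, \<tau>0]) / 2 \<le> \<epsilon>"
      using \<tau>0_density secrecy unfolding \<Delta>_def \<Omega>_def PB_def L_def by blast
  qed
qed

end

section \<open>Entropies of the measured state\<close>

text \<open>Eigenvectors of a block-diagonal operator can be taken inside single blocks: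
  \<open>U k\<close> is eigenvector \<open>k mod d\<close> of block \<open>k div d\<close>, padded
  by zero.\<close>

lemma spec_sum_cq_op:
  fixes l :: "nat \<Rightarrow> nat \<Rightarrow> real"
  assumes on: "\<And>c i j. c < N \<Longrightarrow> i < d \<Longrightarrow> j < d \<Longrightarrow> ip {..<d} (u c i) (u c j) = (if i = j then 1 else 0)"
    and compl: "\<And>c r s. c < N \<Longrightarrow> r < d \<Longrightarrow> s < d \<Longrightarrow> (\<Sum>i<d. u c i r * cnj (u c i s)) = (if r = s then 1 else 0)"
    and ent: "\<And>c r s. c < N \<Longrightarrow> r < d \<Longrightarrow> s < d \<Longrightarrow> B c $$ (r, s) = (\<Sum>i<d. complex_of_real (l c i) * u c i r * cnj (u c i s))"
  shows "spec_sum f (cq_op N d B) = (\<Sum>c<N. \<Sum>i<d. f (complex_of_real (l c i)))"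
proof -
  define U where "U = (\<lambda>k i. if i div d = k div d then u (k div d) (k mod d) (i mod d) else 0)"
  have lt: "i div d < N" "i mod d < d" if "i < N * d" for i
    using that by (simp_all add: less_mult_imp_div_less) (metis mod_less_divisor mult_0_right neq0_conv not_less_zero)
  have U_index: "U (c * d + q) i = (if i div d = c then u c q (i mod d) else 0)" if "q < d" for c q i
    using that by (simp add: U_def digit_add_div digit_add_mod)
  have eqI: "i = j \<longleftrightarrow> i div d = j div d \<and> i mod d = j mod d" for i j :: nat
    by (metis div_mult_mod_eq)
  have quad: "(\<Sum>k<N * d. F (k div d) (k mod d) * U k i * cnj (U k j))
      = (if i div d = j div d then \<Sum>q<d. F (i div d) q * u (i div d) q (i mod d) * cnj (u (i div d) q (j mod d)) else 0)"
    if i: "i < N * d" for F i j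
  proof -
    have "(\<Sum>k<N * d. F (k div d) (k mod d) * U k i * cnj (U k j))
       = (\<Sum>c<N. \<Sum>q<d. F c q * U (c * d + q) i * cnj (U (c * d + q) j))"
      unfolding sum_lessThan_mult by (intro sum.cong refl) (simp add: digit_add_div digit_add_mod)
    also have "\<dots> = (\<Sum>c<N. if c = i div d then (if i div d = j div d then \<Sum>q<d. F (i div d) q * u (i div d) q (i mod d) * cnj (u (i div d) q (j mod d)) else 0) else 0)"
      by (intro sum.cong refl) (auto simp: U_index intro!: sum.neutral)
    finally show ?thesis using lt(1)[OF i] by simp
  qed
  have "spec_sum f (cq_op N d B) = (\<Sum>k<N * d. f (complex_of_real (l (k div d) (k mod d))))"
  proof (rule spec_sum_diagonalized)
    show "cq_op N d B \<in> carrier_mat (N * d) (N * d)" by (simp add: cq_op_def)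
    fix i j assume ij: "i < N * d" "j < N * d"
    show "ip {..<N * d} (U i) (U j) = (if i = j then 1 else 0)"
    proof -
      have "ip {..<N * d} (U i) (U j) = (\<Sum>x<N. \<Sum>r<d. cnj (U i (x * d + r)) * U j (x * d + r))"
        unfolding ip_def by (rule sum_lessThan_mult)
      also have "\<dots> = (\<Sum>x<N. if x = i div d then (if i div d = j div d then ip {..<d} (u (i div d) (i mod d)) (u (i div d) (j mod d)) else 0) else 0)"
        unfolding ip_def by (intro sum.cong refl) (auto simp: U_def digit_add_div digit_add_mod intro!: sum.neutral sum.cong)
      also have "\<dots> = (if i = j then 1 else 0)"
        using lt[OF ij(1)] lt[OF ij(2)] on by (simp add: eqI[of i j])
      finally show ?thesis .
    qed
    show "(\<Sum>k<N * d. U k i * cnj (U k j)) = (if i = j then 1 else 0)"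
      using quad[OF ij(1), of "\<lambda>_ _. 1" j] lt[OF ij(1)] lt[OF ij(2)] compl[of "i div d" "i mod d" "j mod d"]
      by (auto simp: eqI[of i j])
    show "cq_op N d B $$ (i, j) = (\<Sum>k<N * d. complex_of_real (l (k div d) (k mod d)) * U k i * cnj (U k j))"
      using quad[OF ij(1), of "\<lambda>c q. complex_of_real (l c q)" j] lt[OF ij(1)] lt[OF ij(2)] ij ent
      by (simp add: cq_op_def)
  qed
  also have "\<dots> = (\<Sum>c<N. \<Sum>i<d. f (complex_of_real (l c i)))"
    unfolding sum_lessThan_mult by (intro sum.cong refl) (simp add: digit_add_div digit_add_mod)
  finally show ?thesis .
qed

text \<open>A non-zero product of nonnegative factors has positive factors, so it is exactly 2 to
  the power of the sum of their logarithms, and the deviation bound controls that sum.\<close>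

lemma iid_typical_weight:
  fixes q :: "'z \<Rightarrow> real"
  assumes q: "\<And>t. t < n \<Longrightarrow> 0 \<le> q (w t)" and pos: "(\<Prod>t<n. q (w t)) \<noteq> 0"
    and dev: "\<bar>(\<Sum>t<n. - log 2 (q (w t))) - real n * H\<bar> \<le> real n * \<delta>"
  shows "2 powr (- (n * (H + \<delta>))) \<le> (\<Prod>t<n. q (w t))" "(\<Prod>t<n. q (w t)) \<le> 2 powr (- (n * (H - \<delta>)))"
proof -
  have "0 < q (w t)" if "t < n" for t
  proof -
    have "q (w t) \<noteq> 0" using pos that by (auto simp: prod_zero_iff)
    then show ?thesis using q[OF that] by simp
  qed
  then have eq: "(\<Prod>t<n. q (w t)) = 2 powr (- (\<Sum>t<n. - log 2 (q (w t))))"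
    by (intro prod_eq_powr_sum_log) auto
  show "2 powr (- (n * (H + \<delta>))) \<le> (\<Prod>t<n. q (w t))"
    unfolding eq using dev by (intro powr_mono) (auto simp: algebra_simps)
  show "(\<Prod>t<n. q (w t)) \<le> 2 powr (- (n * (H - \<delta>)))"
    unfolding eq using dev by (intro powr_mono) (auto simp: algebra_simps)
qed

section \<open>The average state of the eavesdropper and its overlaps with the conditional
  states\<close>

context measured_state
begin

definition rho_E :: "complex mat" where
  "rho_E = ptrace_first (prod_list Ns) (omega_XE ds dE \<rho> Ns M)"

lemma tuples_Ns_nonempty: "tuples Ns \<noteq> {}"
  using sum_joint_prob by auto

lemma prod_Ns_pos: "0 < prod_list Ns"
  using tuples_Ns_nonempty card_tuples[of Ns] by (metis card_gt_0_iff finite_tuples)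

lemma rho_E_carrier: "rho_E \<in> carrier_mat dE dE"
  and rho_E_index: "e < dE \<Longrightarrow> e' < dE \<Longrightarrow> rho_E $$ (e, e') = (\<Sum>x\<in>tuples Ns. cq_block ds dE \<rho> M x $$ (e, e'))"
proof -
  let ?N = "prod_list Ns" and ?w = "omega_XE ds dE \<rho> Ns M"
  have c: "?w \<in> carrier_mat (?N * dE) (?N * dE)" by (simp add: omega_XE_def cq_op_def)
  have dB: "dim_row ?w div ?N = dE"
    unfolding carrier_matD(1)[OF c] using prod_Ns_pos by (metis nonzero_mult_div_cancel_left neq0_conv)
  show "rho_E \<in> carrier_mat dE dE" unfolding rho_E_def ptrace_first_def Let_def dB by simp
  assume e: "e < dE" "e' < dE"
  have "rho_E $$ (e, e') = (\<Sum>a<?N. ?w $$ (a * dE + e, a * dE + e'))"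
    unfolding rho_E_def ptrace_first_def Let_def dB using e by simp
  also have "\<dots> = (\<Sum>a<?N. cq_block ds dE \<rho> M (mr_dec Ns a) $$ (e, e'))"
    using e by (intro sum.cong refl)
      (simp add: omega_XE_def cq_op_def digit_add_div digit_add_mod index_less_mult_add)
  also have "\<dots> = (\<Sum>x\<in>tuples Ns. cq_block ds dE \<rho> M x $$ (e, e'))"
    by (rule sum_mr_dec[of "\<lambda>x. cq_block ds dE \<rho> M x $$ (e, e')"])
  finally show "rho_E $$ (e, e') = (\<Sum>x\<in>tuples Ns. cq_block ds dE \<rho> M x $$ (e, e'))" .
qed

text \<open>The sign of \<mu> comes later from \<open>env_weight_eq\<close>, which exhibits each
  \<open>\<mu> j\<close> as a mean of squared overlaps.\<close>

definition env_spectrum :: "(nat \<Rightarrow> real) \<Rightarrow> (nat \<Rightarrow> nat \<Rightarrow> complex) \<Rightarrow> bool" where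
  "env_spectrum \<mu> f \<longleftrightarrow> (\<forall>i<dE. \<forall>j<dE. ip {..<dE} (f i) (f j) = (if i = j then 1 else 0))
    \<and> (\<forall>r<dE. \<forall>s<dE. (\<Sum>i<dE. f i r * cnj (f i s)) = (if r = s then 1 else 0))
    \<and> (\<forall>r<dE. \<forall>s<dE. rho_E $$ (r, s) = (\<Sum>i<dE. complex_of_real (\<mu> i) * f i r * cnj (f i s)))"

lemma exists_env_spectrum: "\<exists>\<mu> f. env_spectrum \<mu> f"
proof -
  have "adj rho_E = rho_E"
  proof (rule eq_matI)
    fix i j assume "i < dim_row rho_E" "j < dim_col rho_E"
    then have ij: "i < dE" "j < dE" using carrier_matD[OF rho_E_carrier] by auto
    have "cnj (cq_block ds dE \<rho> M x $$ (j, i)) = cq_block ds dE \<rho> M x $$ (i, j)" if "x \<in> tuples Ns" for x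
      using hermitian_index[OF cq_block_carrier[OF that] _ ij(2,1)] cq_block_psd[OF that] by (simp add: psd_def)
    then show "adj rho_E $$ (i, j) = rho_E $$ (i, j)"
      using ij carrier_matD[OF rho_E_carrier] by (simp add: adj_index rho_E_index)
  qed (use carrier_matD[OF rho_E_carrier] in \<open>auto simp: adj_def\<close>)
  from rho_E_carrier this show ?thesis
  proof (rule spectral_theorem)
    fix f and \<mu> :: "nat \<Rightarrow> real"
    assume "\<And>i j. i < dE \<Longrightarrow> j < dE \<Longrightarrow> ip {..<dE} (f i) (f j) = (if i = j then 1 else 0)"
      "\<And>r s. r < dE \<Longrightarrow> s < dE \<Longrightarrow> (\<Sum>k<dE. f k r * cnj (f k s)) = (if r = s then 1 else 0)"
      "\<And>r s. r < dE \<Longrightarrow> s < dE \<Longrightarrow> rho_E $$ (r, s) = (\<Sum>k<dE. complex_of_real (\<mu> k) * f k r * cnj (f k s))"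
    then have "env_spectrum \<mu> f" by (simp add: env_spectrum_def)
    then show "\<exists>\<mu> f. env_spectrum \<mu> f" by blast
  qed
qed

text \<open>The expectation of \<open>rho_E\<close> in its eigenvector \<open>f j\<close>, computed
  once from the ensemble and once from its own spectrum. It turns the loss from projecting the
  conditional eigenvectors into a tail of the classical distribution \<mu>, although the two kinds
  of eigenbases need not match.\<close>

lemma env_weight_eq:
  assumes s: "letter_spectrum l e" and f: "env_spectrum \<mu> f" and j: "j < dE"
  shows "(\<Sum>z\<in>tuples Ns \<times> {..<dE}. l z * (cmod (ip {..<dE} (f j) (e z)))\<^sup>2) = \<mu> j"
proof -
  let ?Q = "{..<dE}"
  have "complex_of_real (\<Sum>z\<in>tuples Ns \<times> ?Q. l z * (cmod (ip ?Q (f j) (e z)))\<^sup>2)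
     = (\<Sum>z\<in>tuples Ns \<times> ?Q. complex_of_real (l z) * (ip ?Q (f j) (e z) * cnj (ip ?Q (f j) (e z))))"
    unfolding mult_cnj_self by simp
  also have "\<dots> = (\<Sum>z\<in>tuples Ns \<times> ?Q. \<Sum>r<dE. \<Sum>s<dE. cnj (f j r) * (complex_of_real (l z) * e z r * cnj (e z s)) * f j s)"
    unfolding ip_def cnj_sum sum_product by (intro sum.cong refl) (simp add: sum_distrib_left mult_ac)
  also have "\<dots> = (\<Sum>r<dE. \<Sum>s<dE. \<Sum>z\<in>tuples Ns \<times> ?Q. cnj (f j r) * (complex_of_real (l z) * e z r * cnj (e z s)) * f j s)"
    by (subst sum.swap, rule sum.cong[OF refl], rule sum.swap)
  also have "\<dots> = (\<Sum>r<dE. \<Sum>s<dE. cnj (f j r) * rho_E $$ (r, s) * f j s)"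
  proof (intro sum.cong refl)
    fix r s' assume "r \<in> ?Q" "s' \<in> ?Q"
    then have rs: "r < dE" "s' < dE" by auto
    have "(\<Sum>z\<in>tuples Ns \<times> ?Q. complex_of_real (l z) * e z r * cnj (e z s')) = (\<Sum>x\<in>tuples Ns. \<Sum>i<dE. complex_of_real (l (x, i)) * e (x, i) r * cnj (e (x, i) s'))"
      by (simp only: sum.cartesian_product case_prod_unfold prod.collapse)
    also have "\<dots> = rho_E $$ (r, s')" unfolding rho_E_index[OF rs] using s rs by (simp add: letter_spectrum_def)
    finally show "(\<Sum>z\<in>tuples Ns \<times> ?Q. cnj (f j r) * (complex_of_real (l z) * e z r * cnj (e z s')) * f j s') = cnj (f j r) * rho_E $$ (r, s') * f j s'"
      by (simp only: sum_distrib_left[symmetric] sum_distrib_right[symmetric])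
  qed
  also have "\<dots> = (\<Sum>r<dE. \<Sum>s<dE. \<Sum>k<dE. complex_of_real (\<mu> k) * ((cnj (f j r) * f k r) * (cnj (f k s) * f j s)))"
    using f by (intro sum.cong refl) (simp add: env_spectrum_def sum_distrib_left sum_distrib_right mult_ac)
  also have "\<dots> = (\<Sum>r<dE. \<Sum>k<dE. \<Sum>s<dE. complex_of_real (\<mu> k) * ((cnj (f j r) * f k r) * (cnj (f k s) * f j s)))"
    by (rule sum.cong[OF refl], rule sum.swap)
  also have "\<dots> = (\<Sum>k<dE. \<Sum>r<dE. \<Sum>s<dE. complex_of_real (\<mu> k) * ((cnj (f j r) * f k r) * (cnj (f k s) * f j s)))"
    by (rule sum.swap)
  also have "\<dots> = (\<Sum>k<dE. complex_of_real (\<mu> k) * (ip ?Q (f j) (f k) * ip ?Q (f k) (f j)))"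
    unfolding ip_def sum_product by (simp only: sum_distrib_left)
  also have "\<dots> = (\<Sum>k<dE. if k = j then complex_of_real (\<mu> k) else 0)"
    using f j by (intro sum.cong refl) (simp add: env_spectrum_def)
  also have "\<dots> = complex_of_real (\<mu> j)" using j by simp
  finally show ?thesis using of_real_eq_iff by blast
qed

lemma env_weight_nonneg:
  assumes s: "letter_spectrum l e" and f: "env_spectrum \<mu> f" and j: "j < dE"
  shows "0 \<le> \<mu> j"
  unfolding env_weight_eq[OF s f j, symmetric]
  using s by (intro sum_nonneg mult_nonneg_nonneg) (auto simp: letter_spectrum_def)

lemma env_weight_sum:
  assumes s: "letter_spectrum l e" and f: "env_spectrum \<mu> f"
  shows "(\<Sum>j<dE. \<mu> j) = 1"
proof -
  have "complex_of_real (\<Sum>j<dE. \<mu> j) = (\<Sum>j<dE. complex_of_real (\<mu> j) * ip {..<dE} (f j) (f j))"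
    using f by (simp add: env_spectrum_def)
  also have "\<dots> = (\<Sum>r<dE. rho_E $$ (r, r))"
    using f unfolding ip_def sum_distrib_left by (subst sum.swap) (simp add: env_spectrum_def mult_ac)
  also have "\<dots> = (\<Sum>x\<in>tuples Ns. \<Sum>r<dE. cq_block ds dE \<rho> M x $$ (r, r))"
    using rho_E_index by (subst sum.swap) simp
  also have "\<dots> = complex_of_real (\<Sum>x\<in>tuples Ns. prob x)" using joint_prob_trace by simp
  finally show ?thesis unfolding sum_joint_prob using of_real_eq_iff by blast
qed

text \<open>Both von Neumann entropies become means of negative log weights under classical
  distributions, the quantities to which Chebyshev's inequality is applied.\<close>

lemma cond_entropy_eq:
  assumes s: "letter_spectrum l e" and f: "env_spectrum \<mu> f"
  shows "cond_vn_XE ds dE \<rho> Ns M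
    = (\<Sum>z\<in>tuples Ns \<times> {..<dE}. l z * - log 2 (l z)) - (\<Sum>j<dE. \<mu> j * - log 2 (\<mu> j))"
proof -
  have "spec_sum (\<lambda>z. eta (Re z)) (omega_XE ds dE \<rho> Ns M)
      = (\<Sum>c<prod_list Ns. \<Sum>i<dE. eta (Re (complex_of_real (l (mr_dec Ns c, i)))))"
    unfolding omega_XE_def
    by (rule spec_sum_cq_op[where u = "\<lambda>c i. e (mr_dec Ns c, i)"])
      (use s mr_dec_in_tuples in \<open>auto simp: letter_spectrum_def\<close>)
  also have "\<dots> = (\<Sum>x\<in>tuples Ns. \<Sum>i<dE. eta (l (x, i)))"
    by (simp add: sum_mr_dec[of "\<lambda>x. \<Sum>i<dE. eta (l (x, i))"])
  also have "\<dots> = (\<Sum>x\<in>tuples Ns. \<Sum>i<dE. l (x, i) * log 2 (l (x, i)))"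
    using s by (intro sum.cong refl) (simp add: letter_spectrum_def eta_nonneg_arg)
  also have "\<dots> = (\<Sum>z\<in>tuples Ns \<times> {..<dE}. l z * log 2 (l z))"
    by (simp only: sum.cartesian_product case_prod_unfold prod.collapse)
  finally have 1: "vn_entropy (omega_XE ds dE \<rho> Ns M) = (\<Sum>z\<in>tuples Ns \<times> {..<dE}. l z * - log 2 (l z))"
    by (simp add: vn_entropy_def sum_negf)
  have "spec_sum (\<lambda>z. eta (Re z)) rho_E = (\<Sum>k<dE. eta (Re (complex_of_real (\<mu> k))))"
    by (rule spec_sum_diagonalized[OF rho_E_carrier, where u = f]) (use f in \<open>simp_all add: env_spectrum_def\<close>)
  also have "\<dots> = (\<Sum>j<dE. \<mu> j * log 2 (\<mu> j))"
    using env_weight_nonneg[OF s f] by (intro sum.cong refl) (simp add: eta_nonneg_arg)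
  finally have 2: "vn_entropy rho_E = (\<Sum>j<dE. \<mu> j * - log 2 (\<mu> j))"
    by (simp add: vn_entropy_def sum_negf)
  show ?thesis unfolding cond_vn_XE_def rho_E_def[symmetric] 1 2 ..
qed

definition env_block_vec :: "nat \<Rightarrow> (nat \<Rightarrow> nat \<Rightarrow> complex) \<Rightarrow> nat \<Rightarrow> nat \<Rightarrow> complex" where
  "env_block_vec n f j r = (\<Prod>t<n. f (digit dE n j t) (digit dE n r t))"

definition env_block_weight :: "nat \<Rightarrow> (nat \<Rightarrow> real) \<Rightarrow> nat \<Rightarrow> real" where
  "env_block_weight n \<mu> j = (\<Prod>t<n. \<mu> (digit dE n j t))"

lemma env_block_vec_orthonormal:
  assumes f: "env_spectrum \<mu> f" and i: "i < dE ^ n" "j < dE ^ n"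
  shows "ip {..<dE ^ n} (env_block_vec n f i) (env_block_vec n f j) = (if i = j then 1 else 0)"
proof -
  have "ip {..<dE ^ n} (env_block_vec n f i) (env_block_vec n f j)
     = (\<Sum>r<dE ^ n. \<Prod>t<n. (\<lambda>t r. cnj (f (digit dE n i t) r) * f (digit dE n j t) r) t (digit dE n r t))"
    by (simp add: ip_def env_block_vec_def prod.distrib)
  also have "\<dots> = (\<Prod>t<n. \<Sum>r<dE. cnj (f (digit dE n i t) r) * f (digit dE n j t) r)"
    by (rule sum_prod_digit)
  also have "\<dots> = (\<Prod>t<n. if digit dE n i t = digit dE n j t then 1 else 0)"
    using f digit_less[OF i(1)] digit_less[OF i(2)]
    by (intro prod.cong refl) (simp add: env_spectrum_def ip_def)
  also have "\<dots> = (if i = j then 1 else 0)"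
    unfolding prod_delta using digit_inject[OF i] by auto
  finally show ?thesis .
qed

text \<open>Weights and overlaps of product vectors are products over copies, so the one-copy
  identity multiplies.\<close>

lemma env_block_weight_eq:
  assumes s: "letter_spectrum l e" and f: "env_spectrum \<mu> f" and j: "j < dE ^ n"
  shows "(\<Sum>z\<in>blocks Ns n \<times> {..<dE ^ n}. block_weight n l z * (cmod (ip {..<dE ^ n} (env_block_vec n f j) (block_vec n e z)))\<^sup>2)
    = env_block_weight n \<mu> j"
proof -
  have ipn: "ip {..<dE ^ n} (env_block_vec n f j) (block_vec n e z)
     = (\<Prod>t<n. ip {..<dE} (f (digit dE n j t)) (e (letters Ns n (fst z) t, digit dE n (snd z) t)))" for z
  proof -
    have "ip {..<dE ^ n} (env_block_vec n f j) (block_vec n e z)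
      = (\<Sum>r<dE ^ n. \<Prod>t<n. (\<lambda>t r. cnj (f (digit dE n j t) r) * e (letters Ns n (fst z) t, digit dE n (snd z) t) r) t (digit dE n r t))"
      by (simp add: ip_def env_block_vec_def block_vec_def prod.distrib)
    also have "\<dots> = (\<Prod>t<n. \<Sum>r<dE. cnj (f (digit dE n j t) r) * e (letters Ns n (fst z) t, digit dE n (snd z) t) r)"
      by (rule sum_prod_digit)
    finally show ?thesis by (simp add: ip_def)
  qed
  have "(\<Sum>z\<in>blocks Ns n \<times> {..<dE ^ n}. block_weight n l z * (cmod (ip {..<dE ^ n} (env_block_vec n f j) (block_vec n e z)))\<^sup>2)
    = (\<Sum>z\<in>blocks Ns n \<times> {..<dE ^ n}. \<Prod>t<n. (\<lambda>t z. l z * (cmod (ip {..<dE} (f (digit dE n j t)) (e z)))\<^sup>2) t (letters Ns n (fst z) t, digit dE n (snd z) t))"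
    unfolding ipn by (simp add: block_weight_def prod.distrib prod_norm[symmetric] prod_power_distrib)
  also have "\<dots> = (\<Prod>t<n. \<Sum>z\<in>tuples Ns \<times> {..<dE}. l z * (cmod (ip {..<dE} (f (digit dE n j t)) (e z)))\<^sup>2)"
    by (rule sum_prod_letters_digit)
  also have "\<dots> = env_block_weight n \<mu> j"
    unfolding env_block_weight_def using env_weight_eq[OF s f] digit_less[OF j] by simp
  finally show ?thesis .
qed

end

section \<open>Achievable rates\<close>

lemma marginal_mono:
  assumes p: "\<And>x. x \<in> tuples Ns \<Longrightarrow> 0 \<le> p x" and J: "J \<subseteq> J'" and x: "x \<in> tuples Ns"
  shows "marginal Ns p J' (restr J' x) \<le> marginal Ns p J (restr J x)"
  unfolding marginal_def
proof (rule sum_mono2)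
  show "{x' \<in> tuples Ns. restr J' x' = restr J' x} \<subseteq> {x' \<in> tuples Ns. restr J x' = restr J x}"
  proof (intro subsetI)
    fix x' assume x': "x' \<in> {x' \<in> tuples Ns. restr J' x' = restr J' x}"
    then have l: "length x' = length x" using x by (auto dest!: length_tuples)
    show "x' \<in> {x' \<in> tuples Ns. restr J x' = restr J x}"
      using x' J unfolding restr_cong_iff[OF l] mem_Collect_eq by (simp add: restr_cong_iff[OF l] subset_iff)
  qed
qed (use p in auto)

text \<open>A larger set of kept coordinates pools fewer tuples, hence gives smaller marginals. It
  serves to show that admissible rates are nonnegative.\<close>

lemma shannon_marg_mono:
  assumes p: "\<And>x. x \<in> tuples Ns \<Longrightarrow> 0 \<le> p x" and J: "J \<subseteq> J'"
  shows "shannon_marg Ns p J \<le> shannon_marg Ns p J'"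
proof -
  have eq: "shannon_marg Ns p K = (\<Sum>x\<in>tuples Ns. p x * - log 2 (marginal Ns p K (restr K x)))" for K
    by (rule shannon_marg_eq[symmetric]) (rule p)
  show ?thesis unfolding eq
  proof (rule sum_mono)
    fix x assume x: "x \<in> tuples Ns"
    have "p x \<le> marginal Ns p J' (restr J' x)"
      unfolding marginal_def using x p by (intro member_le_sum) auto
    moreover have "marginal Ns p J' (restr J' x) \<le> marginal Ns p J (restr J x)"
      by (rule marginal_mono[OF p J x])
    ultimately show "p x * - log 2 (marginal Ns p J (restr J x)) \<le> p x * - log 2 (marginal Ns p J' (restr J' x))"
      using p[OF x] by (cases "p x = 0") (auto intro!: mult_left_mono)
  qed
qed

text \<open>Guards the infimum in \<open>R_CO\<close>, which can be approached only over a non-empty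
  set. The witness gives every player the sum of the moduli of all constraints, so a single member
  of \<open>I\<close> already satisfies the constraint for \<open>I\<close>.\<close>

lemma rate_region_nonempty: "rate_region_CO m Ns p \<noteq> {}"
proof -
  define B where "B = (\<Sum>I\<in>Pow {..<m}. \<bar>shannon_cond Ns p I ({..<m} - I)\<bar>)"
  have B: "\<bar>shannon_cond Ns p I ({..<m} - I)\<bar> \<le> B" if "I \<subseteq> {..<m}" for I
    unfolding B_def using that by (intro member_le_sum) auto
  have "0 \<le> B" unfolding B_def by (intro sum_nonneg) auto
  have "shannon_cond Ns p I ({..<m} - I) \<le> (\<Sum>j\<in>I. B)" if I: "I \<subset> {..<m}" for I
  proof (cases "I = {}")
    case True
    then show ?thesis by (simp add: shannon_cond_def)
  next
    case False
    have "finite I" using I by (auto intro: finite_subset[of _ "{..<m}"])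
    then have "1 \<le> card I" using False by (metis One_nat_def Suc_leI card_gt_0_iff)
    then have "1 * B \<le> real (card I) * B" using \<open>0 \<le> B\<close> by (intro mult_right_mono) auto
    then show ?thesis using B[of I] I by auto
  qed
  then have "(\<lambda>_. B) \<in> rate_region_CO m Ns p" by (simp add: rate_region_CO_def)
  then show ?thesis by blast
qed

section \<open>Trivial protocols and protocols from decoders\<close>

context measured_state
begin

text \<open>With a single key value the coefficient 1 - 1/1 is zero, so the secrecy sum vanishes
  identically. This covers rate 0 and the case of zero copies.\<close>

lemma trivial_protocol:
  assumes m: "1 \<le> m" and Rs: "\<And>j. 0 \<le> Rs j" and \<epsilon>: "0 \<le> \<epsilon>"
  shows "is_protocol ds dE \<rho> n Rs \<epsilon> 1"
proof -
  obtain l e where s: "letter_spectrum l e" using exists_letter_spectrum by blast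
  show ?thesis
  proof (rule protocol_from_classical[where Ls = "replicate m 1" and h = "\<lambda>_ _. 0" and g = "\<lambda>_ _ _. 0", OF m _ _ _ _ _ s])
    show "key_insecurity_le 1 (tuples (replicate m 1)) {..<dE ^ n} (blocks Ns n \<times> {..<dE ^ n}) (block_weight n l) (block_vec n e)
      (\<lambda>z. bins (\<lambda>_ _. 0) (fst z)) (\<lambda>z. 0) (2 * \<epsilon>)"
      unfolding key_insecurity_le_def
    proof (intro allI impI)
      fix W :: "nat \<times> nat list \<Rightarrow> nat \<Rightarrow> nat \<Rightarrow> complex"
      have zero: "(\<Sum>c\<in>{..<1} \<times> tuples (replicate m 1). \<Sum>z\<in>blocks Ns n \<times> {..<dE ^ n}.
        complex_of_real ((if bins (\<lambda>_ _. 0) (fst z) = snd c then (if 0 = fst c then 1 else 0) - 1 / real 1 else 0) * block_weight n l z)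
        * ip {..<dE ^ n} (block_vec n e z) (mv {..<dE ^ n} (W c) (block_vec n e z))) = 0"
        by (intro ballI sum.neutral) auto
      show "cmod (\<Sum>c\<in>{..<1} \<times> tuples (replicate m 1). \<Sum>z\<in>blocks Ns n \<times> {..<dE ^ n}.
        complex_of_real ((if bins (\<lambda>_ _. 0) (fst z) = snd c then (if 0 = fst c then 1 else 0) - 1 / real 1 else 0) * block_weight n l z)
        * ip {..<dE ^ n} (block_vec n e z) (mv {..<dE ^ n} (W c) (block_vec n e z))) \<le> 2 * \<epsilon>"
        unfolding zero using \<epsilon> by simp
    qed
  next
    fix j assume "j < m"
    then show "real (replicate m 1 ! j) \<le> 2 powr (real n * Rs j)"
      using Rs[of j] by (simp add: ge_one_powr_ge_zero)
  next
    show "(\<Sum>a\<in>{a \<in> blocks Ns n. \<exists>j<m. (0::nat) \<noteq> 0}. block_prob n a) \<le> \<epsilon>"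
      using \<epsilon> by simp
  qed simp_all
qed

text \<open>With at least two players a singleton is a proper subset, and a classical conditional
  entropy is nonnegative. It follows that the target number of bins is at least 1, which bounds the
  effect of rounding.\<close>

lemma rate_nonneg:
  assumes m: "2 \<le> m" and R: "R \<in> rate_region_CO m Ns prob" and j: "j < m"
  shows "0 \<le> R j"
proof -
  have "card {j} < card {..<m}" using m by simp
  then have "{j} \<noteq> {..<m}" by (metis less_irrefl)
  then have sub: "{j} \<subset> {..<m}" using j by (simp add: psubset_eq)
  have un: "{j} \<union> ({..<m} - {j}) = {..<m}" using j by auto
  have "shannon_marg Ns prob ({..<m} - {j}) \<le> shannon_marg Ns prob {..<m}"
    by (intro shannon_marg_mono prob_nonneg) auto
  then have "0 \<le> shannon_cond Ns prob {j} ({..<m} - {j})" unfolding shannon_cond_def un by simp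
  also have "\<dots> \<le> (\<Sum>j\<in>{j}. R j)" using R sub unfolding rate_region_CO_def by blast
  finally show ?thesis by simp
qed

text \<open>The decoder takes any candidate in \<open>T\<close> that fits the own block and the
  announced bins; without a decoding failure the true block is the only one.\<close>

lemma decoder_correct:
  assumes g: "g = (\<lambda>j ls b. if \<exists>x\<in>T. x ! j = b \<and> bins h x = ls then F (SOME x. x \<in> T \<and> x ! j = b \<and> bins h x = ls) else (0::nat))"
    and a: "a \<in> T" and uniq: "\<not> (\<exists>x'\<in>T. x' \<noteq> a \<and> (\<exists>i<m. x' ! i = a ! i) \<and> (\<forall>j<m. h j (x' ! j) = h j (a ! j)))"
    and j: "j < m"
  shows "g j (bins h a) (a ! j) = F a"
proof -
  have "x = a" if x: "x \<in> T" "x ! j = a ! j" "bins h x = bins h a" for x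
  proof -
    have "\<forall>i<m. h i (x ! i) = h i (a ! i)"
    proof (intro allI impI)
      fix i assume i: "i < m"
      have "bins h x ! i = bins h a ! i" using x(3) by simp
      then show "h i (x ! i) = h i (a ! i)" using i by (simp add: bins_def)
    qed
    then show ?thesis using uniq x(1,2) j by blast
  qed
  then have "(SOME x. x \<in> T \<and> x ! j = a ! j \<and> bins h x = bins h a) = a"
    using a by (intro some_equality) auto
  then show ?thesis unfolding g using a by auto
qed

text \<open>Secrecy is given for the key \<open>F\<close> of the true outcome, but player 0 outputs
  a decoded key. The two differ only on decoding failures, where the coefficients change by at most
  2 in total modulus. This costs \<open>2 * \<epsilon>1\<close> before halving.\<close>

lemma protocol_from_decoding:
  fixes Ls :: "nat list" and \<kappa> :: nat
  assumes m: "1 \<le> m" and \<kappa>: "1 \<le> \<kappa>" and Ls: "length Ls = m"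
    and rate: "\<And>j. j < m \<Longrightarrow> real (Ls ! j) \<le> 2 powr (real n * Rs j)"
    and h: "\<And>j b. j < m \<Longrightarrow> b < (Ns ! j) ^ n \<Longrightarrow> h j b < Ls ! j"
    and F: "F \<in> PiE (blocks Ns n) (\<lambda>_. {..<\<kappa>})"
    and T: "T \<subseteq> blocks Ns n" and s: "letter_spectrum l e"
    and bad: "(\<Sum>x\<in>decoding_failures m h T (blocks Ns n). block_prob n x) \<le> \<epsilon>1"
    and secret: "key_insecurity_le \<kappa> (tuples Ls) {..<dE ^ n} (blocks Ns n \<times> {..<dE ^ n}) (block_weight n l) (block_vec n e)
      (\<lambda>z. bins h (fst z)) (\<lambda>z. F (fst z)) \<epsilon>2"
    and \<epsilon>2: "0 \<le> \<epsilon>2"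
  shows "is_protocol ds dE \<rho> n Rs (\<epsilon>1 + \<epsilon>2) \<kappa>"
proof -
  define Bd where "Bd = decoding_failures m h T (blocks Ns n)"
  define g where "g = (\<lambda>j ls b. if \<exists>x\<in>T. x ! j = b \<and> bins h x = ls then F (SOME x. x \<in> T \<and> x ! j = b \<and> bins h x = ls) else (0::nat))"
  have F_lt: "F x < \<kappa>" if "x \<in> blocks Ns n" for x using F that by auto
  have g_lt: "g j ls b < \<kappa>" for j ls b
  proof (cases "\<exists>x\<in>T. x ! j = b \<and> bins h x = ls")
    case True
    then have "\<exists>x. x \<in> T \<and> x ! j = b \<and> bins h x = ls" by blast
    from someI_ex[OF this] have "(SOME x. x \<in> T \<and> x ! j = b \<and> bins h x = ls) \<in> blocks Ns n" using T by auto
    then show ?thesis using True F_lt by (simp add: g_def)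
  qed (use \<kappa> in \<open>auto simp: g_def\<close>)
  have g_good: "g j (bins h a) (a ! j) = F a" if "a \<in> blocks Ns n" "a \<notin> Bd" "j < m" for a j
    by (rule decoder_correct[OF g_def]) (use that in \<open>auto simp: Bd_def decoding_failures_def\<close>)
  have m0: "0 < m" using m by linarith
  let ?Z = "blocks Ns n \<times> {..<dE ^ n}" and ?C = "{..<\<kappa>} \<times> tuples Ls"
  let ?cf = "\<lambda>key (c :: nat \<times> nat list) (z :: nat list \<times> nat). if bins h (fst z) = snd c then (if key (fst z) = fst c then 1 else 0) - 1 / real \<kappa> else (0 :: real)"
  let ?X = "\<lambda>W c z. ip {..<dE ^ n} (block_vec n e z) (mv {..<dE ^ n} (W c) (block_vec n e z))"
  show ?thesis
  proof (rule protocol_from_classical[where h = h and g = g, OF m \<kappa> Ls rate h g_lt s])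
    have "(\<Sum>a\<in>{a \<in> blocks Ns n. \<exists>j<m. g j (bins h a) (a ! j) \<noteq> g 0 (bins h a) (a ! 0)}. block_prob n a)
       \<le> (\<Sum>a\<in>Bd. block_prob n a)"
    proof (rule sum_mono2)
      show "{a \<in> blocks Ns n. \<exists>j<m. g j (bins h a) (a ! j) \<noteq> g 0 (bins h a) (a ! 0)} \<subseteq> Bd"
      proof (rule subsetI, rule ccontr)
        fix a assume a: "a \<in> {a \<in> blocks Ns n. \<exists>j<m. g j (bins h a) (a ! j) \<noteq> g 0 (bins h a) (a ! 0)}" "a \<notin> Bd"
        then obtain j where j: "j < m" "g j (bins h a) (a ! j) \<noteq> g 0 (bins h a) (a ! 0)" by blast
        have "a \<in> blocks Ns n" using a(1) by simp
        from g_good[OF this a(2) j(1)] g_good[OF this a(2) m0] j(2) show False by simp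
      qed
    qed (auto simp: Bd_def decoding_failures_def block_prob_nonneg)
    also have "\<dots> \<le> \<epsilon>1" using bad by (simp only: Bd_def)
    finally show "(\<Sum>a\<in>{a \<in> blocks Ns n. \<exists>j<m. g j (bins h a) (a ! j) \<noteq> g 0 (bins h a) (a ! 0)}. block_prob n a) \<le> \<epsilon>1 + \<epsilon>2"
      using \<epsilon>2 by simp
  next
    show "key_insecurity_le \<kappa> (tuples Ls) {..<dE ^ n} ?Z (block_weight n l) (block_vec n e)
      (\<lambda>z. bins h (fst z)) (\<lambda>z. g 0 (bins h (fst z)) (fst z ! 0)) (2 * (\<epsilon>1 + \<epsilon>2))"
      unfolding key_insecurity_le_def
    proof (intro allI impI)
      fix W :: "nat \<times> nat list \<Rightarrow> nat \<Rightarrow> nat \<Rightarrow> complex"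
      assume W: "\<forall>c\<in>?C. contraction {..<dE ^ n} (W c)"
      define d where "d = (\<lambda>c z. ?cf (\<lambda>a. g 0 (bins h a) (a ! 0)) c z - ?cf F c z)"
      have X1: "cmod (?X W c z) \<le> 1" if "c \<in> ?C" "z \<in> ?Z" for c z
      proof -
        obtain a i where z: "z = (a, i)" by (cases z)
        have "ip {..<dE ^ n} (block_vec n e z) (block_vec n e z) = 1"
          using that(2) unfolding z by (subst block_vec_orthonormal[OF s]) auto
        then have "nrm {..<dE ^ n} (block_vec n e z) = 1" by (rule nrm_unit)
        then show ?thesis using W that(1) unfolding contraction_def by (metis mult_1)
      qed
      have d2: "(\<Sum>c\<in>?C. \<bar>d c z\<bar>) \<le> (if fst z \<in> Bd then 2 else 0)" if z: "z \<in> ?Z" for z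
      proof -
        have bt: "bins h (fst z) \<in> tuples Ls" by (rule bins_in_tuples[OF h Ls]) (use z in auto)
        let ?g = "g 0 (bins h (fst z)) (fst z ! 0)"
        have "(\<Sum>c\<in>?C. \<bar>d c z\<bar>) = (\<Sum>k<\<kappa>. \<Sum>ls\<in>tuples Ls. \<bar>d (k, ls) z\<bar>)"
          by (simp only: sum.cartesian_product case_prod_unfold prod.collapse)
        also have "\<dots> = (\<Sum>k<\<kappa>. \<Sum>ls\<in>tuples Ls. if ls = bins h (fst z)
            then \<bar>(if ?g = k then 1 else 0) - (if F (fst z) = k then 1 else 0)\<bar> else 0)"
          by (intro sum.cong refl) (auto simp: d_def)
        also have "\<dots> = (\<Sum>k<\<kappa>. \<bar>(if ?g = k then 1 else 0) - (if F (fst z) = k then 1 else 0)\<bar>)"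
          using bt by simp
        also have "\<dots> \<le> (if fst z \<in> Bd then 2 else 0)"
        proof (cases "fst z \<in> Bd")
          case True
          have "(\<Sum>k<\<kappa>. \<bar>(if ?g = k then 1 else 0) - (if F (fst z) = k then 1 else 0)\<bar>)
             \<le> (\<Sum>k<\<kappa>. (if ?g = k then 1 else 0) + (if F (fst z) = k then 1 else (0::real)))"
            by (intro sum_mono) auto
          also have "\<dots> = 2" using g_lt[of 0 "bins h (fst z)" "fst z ! 0"] F_lt[of "fst z"] z
            by (auto simp: sum.distrib)
          finally show ?thesis using True by simp
        next
          case False
          have "?g = F (fst z)" using z False m0 by (intro g_good) auto
          then show ?thesis using False by simp
        qed
        finally show ?thesis .
      qed
      have "cmod (\<Sum>c\<in>?C. \<Sum>z\<in>?Z. complex_of_real (d c z * block_weight n l z) * ?X W c z)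
         \<le> (\<Sum>c\<in>?C. \<Sum>z\<in>?Z. \<bar>d c z\<bar> * block_weight n l z)"
      proof (intro order_trans[OF norm_sum] sum_mono)
        fix c z assume cz: "c \<in> ?C" "z \<in> ?Z"
        have "cmod (complex_of_real (d c z * block_weight n l z) * ?X W c z) = (\<bar>d c z\<bar> * block_weight n l z) * cmod (?X W c z)"
          using block_weight_nonneg[OF s cz(2)] by (simp add: norm_mult abs_mult)
        also have "\<dots> \<le> (\<bar>d c z\<bar> * block_weight n l z) * 1"
          using X1[OF cz] block_weight_nonneg[OF s cz(2)] by (intro mult_left_mono) auto
        finally show "cmod (complex_of_real (d c z * block_weight n l z) * ?X W c z) \<le> \<bar>d c z\<bar> * block_weight n l z" by simp
      qed
      also have "\<dots> = (\<Sum>z\<in>?Z. (\<Sum>c\<in>?C. \<bar>d c z\<bar>) * block_weight n l z)"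
        by (subst sum.swap) (simp only: sum_distrib_right)
      also have "\<dots> \<le> (\<Sum>z\<in>?Z. (if fst z \<in> Bd then 2 else 0) * block_weight n l z)"
        using d2 block_weight_nonneg[OF s] by (intro sum_mono mult_right_mono)
      also have "\<dots> = (\<Sum>a\<in>blocks Ns n. (if a \<in> Bd then 2 else 0) * (\<Sum>i<dE ^ n. block_weight n l (a, i)))"
        by (simp add: sum.cartesian_product[symmetric] sum_distrib_left case_prod_unfold
          flip: sum.cartesian_product[where g = "\<lambda>a i. (if a \<in> Bd then 2 else 0) * block_weight n l (a, i)", unfolded case_prod_unfold prod.collapse])
      also have "\<dots> = (\<Sum>a\<in>blocks Ns n. if a \<in> Bd then 2 * block_prob n a else 0)"
        using block_weight_sum[OF s] by (intro sum.cong refl) simp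
      also have "\<dots> = 2 * (\<Sum>a\<in>Bd. block_prob n a)"
      proof -
        have "Bd \<subseteq> blocks Ns n" by (auto simp: Bd_def decoding_failures_def)
        then show ?thesis by (simp add: sum.inter_restrict[symmetric] Int_absorb1 sum_distrib_left)
      qed
      also have "\<dots> \<le> 2 * \<epsilon>1" using bad by (simp add: Bd_def)
      finally have diff: "cmod (\<Sum>c\<in>?C. \<Sum>z\<in>?Z. complex_of_real (d c z * block_weight n l z) * ?X W c z) \<le> 2 * \<epsilon>1" .
      have "(\<Sum>c\<in>?C. \<Sum>z\<in>?Z. complex_of_real (?cf (\<lambda>a. g 0 (bins h a) (a ! 0)) c z * block_weight n l z) * ?X W c z)
         = (\<Sum>c\<in>?C. \<Sum>z\<in>?Z. complex_of_real (d c z * block_weight n l z) * ?X W c z)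
         + (\<Sum>c\<in>?C. \<Sum>z\<in>?Z. complex_of_real (?cf F c z * block_weight n l z) * ?X W c z)"
        unfolding sum.distrib[symmetric] distrib_right[symmetric] of_real_add[symmetric]
        by (intro sum.cong refl) (simp only: d_def diff_add_cancel)
      then have "cmod (\<Sum>c\<in>?C. \<Sum>z\<in>?Z. complex_of_real (?cf (\<lambda>a. g 0 (bins h a) (a ! 0)) c z * block_weight n l z) * ?X W c z)
         \<le> cmod (\<Sum>c\<in>?C. \<Sum>z\<in>?Z. complex_of_real (d c z * block_weight n l z) * ?X W c z)
         + cmod (\<Sum>c\<in>?C. \<Sum>z\<in>?Z. complex_of_real (?cf F c z * block_weight n l z) * ?X W c z)"
        by (simp only: norm_triangle_ineq)
      also have "\<dots> \<le> 2 * \<epsilon>1 + \<epsilon>2" using diff secret[unfolded key_insecurity_le_def, THEN spec, THEN mp, OF W] by simp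
      also have "\<dots> \<le> 2 * (\<epsilon>1 + \<epsilon>2)" using \<epsilon>2 by simp
      finally show "cmod (\<Sum>c\<in>?C. \<Sum>z\<in>?Z. complex_of_real ((if bins h (fst z) = snd c then (if g 0 (bins h (fst z)) (fst z ! 0) = fst c then 1 else 0) - 1 / real \<kappa> else 0) * block_weight n l z) * ?X W c z) \<le> 2 * (\<epsilon>1 + \<epsilon>2)" .
    qed
  qed
qed

end

section \<open>Exponents, error bounds and the limit of many copies\<close>

context measured_state
begin

text \<open>\<open>T\<close> caps the weights at 2 powr (- n (Hl - \<delta>)), and \<open>J\<close>
  spans at most 2 powr (n (H\<mu> + \<delta>)) dimensions; the product of the two bounds gives the
  exponent Hl - H\<mu> - 2\<delta>. \<open>V1\<close> and \<open>V2\<close> depend only on the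
  letter distributions and \<delta>, so n, \<kappa>, \<open>Y\<close> and \<open>h\<close> may be
  chosen afterwards.\<close>

lemma privacy_bound:
  assumes s: "letter_spectrum l e" and f: "env_spectrum \<mu> f" and \<delta>: "\<delta> > 0"
    and Hl: "Hl = (\<Sum>z\<in>tuples Ns \<times> {..<dE}. l z * - log 2 (l z))"
    and H\<mu>: "H\<mu> = (\<Sum>j<dE. \<mu> j * - log 2 (\<mu> j))"
  shows "\<exists>V1 V2. 0 \<le> V1 \<and> 0 \<le> V2 \<and> (\<forall>n\<ge>1. \<forall>\<kappa>\<ge>(1::nat). \<forall>Y h. finite Y \<longrightarrow> (\<forall>a\<in>blocks Ns n. h a \<in> Y) \<longrightarrow>
    (\<exists>F\<in>PiE (blocks Ns n) (\<lambda>_. {..<\<kappa>}). key_insecurity_le \<kappa> Y {..<dE ^ n} (blocks Ns n \<times> {..<dE ^ n}) (block_weight n l) (block_vec n e)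
        (\<lambda>z. h (fst z)) (\<lambda>z. F (fst z))
        (2 * (V1 / n) + 4 * sqrt (V2 / n) + sqrt (\<kappa> * card Y * 2 powr (- (n * (Hl - H\<mu> - 2 * \<delta>)))))))"
proof -
  define V1 where "V1 = (\<Sum>z\<in>tuples Ns \<times> {..<dE}. l z * (- log 2 (l z) - Hl)\<^sup>2) / \<delta>\<^sup>2"
  define V2 where "V2 = (\<Sum>j<dE. \<mu> j * (- log 2 (\<mu> j) - H\<mu>)\<^sup>2) / \<delta>\<^sup>2"
  have l0: "0 \<le> l z" if "z \<in> tuples Ns \<times> {..<dE}" for z using s that by (auto simp: letter_spectrum_def)
  have \<mu>0: "0 \<le> \<mu> j" if "j < dE" for j using env_weight_nonneg[OF s f that] .
  have V: "0 \<le> V1" "0 \<le> V2" unfolding V1_def V2_def using l0 \<mu>0 by (auto intro!: divide_nonneg_nonneg sum_nonneg)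
  show ?thesis
  proof (rule exI[of _ V1], rule exI[of _ V2], intro conjI allI impI V)
    fix n \<kappa> :: nat and Y :: "'a set" and h
    assume n: "1 \<le> n" and \<kappa>: "1 \<le> \<kappa>" and Y: "finite Y" and h: "\<forall>a\<in>blocks Ns n. h a \<in> Y"
    let ?Z = "blocks Ns n \<times> {..<dE ^ n}"
    define zz where "zz = (\<lambda>(z :: nat list \<times> nat) t. (letters Ns n (fst z) t, digit dE n (snd z) t))"
    define T where "T = (\<lambda>z. \<bar>(\<Sum>t<n. - log 2 (l (zz z t))) - n * Hl\<bar> \<le> n * \<delta>)"
    define G where "G = (\<lambda>j. \<bar>(\<Sum>t<n. - log 2 (\<mu> (digit dE n j t))) - n * H\<mu>\<bar> \<le> n * \<delta>)"
    \<comment> \<open>Eigenvectors of weight zero are left out because the dimension is counted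
      through a lower bound on the weights; they add nothing to the lost mass.\<close>
    define J where "J = {j\<in>{..<dE ^ n}. env_block_weight n \<mu> j \<noteq> 0 \<and> G j}"
    have zz_in: "zz z t \<in> tuples Ns \<times> {..<dE}" if "z \<in> ?Z" "t < n" for z t
      using that by (auto simp: zz_def letters_in_tuples digit_less)
    have bw: "block_weight n l z = (\<Prod>t<n. l (zz z t))" for z by (simp add: block_weight_def zz_def)
    have finJ: "finite J" by (simp add: J_def)
    have lsum: "(\<Sum>z\<in>?Z. block_weight n l z) = 1"
      unfolding bw zz_def using sum_prod_letters_digit[where g = "\<lambda>_. l" and ds = Ns and d = dE and n = n] letter_weight_sum_all[OF s]
      by simp
    have \<mu>sum: "(\<Sum>j<dE ^ n. env_block_weight n \<mu> j) = 1"
      unfolding env_block_weight_def using sum_prod_digit[where g = "\<lambda>_. \<mu>" and d = dE and n = n] env_weight_sum[OF s f] by simp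
    have ebw0: "0 \<le> env_block_weight n \<mu> j" if "j < dE ^ n" for j
      unfolding env_block_weight_def using \<mu>0 digit_less[OF that] by (intro prod_nonneg) auto
    have T_le: "block_weight n l z \<le> 2 powr (- (n * (Hl - \<delta>)))" if z: "z \<in> ?Z" "T z" for z
    \<comment> \<open>A zero weight meets the cap trivially; the logarithmic estimate is for
      non-zero products.\<close>
    proof (cases "block_weight n l z = 0")
      case False
      then show ?thesis unfolding bw using zz_in[OF z(1)] l0 z(2)
        by (intro iid_typical_weight(2)[where q = l and w = "zz z"]) (auto simp: T_def)
    qed simp
    have atyp: "(\<Sum>z\<in>{z\<in>?Z. \<not> T z}. block_weight n l z) \<le> V1 / n"
    proof -
      have "(\<Sum>z\<in>{z\<in>?Z. \<not> T z}. block_weight n l z) \<le> (\<Sum>z\<in>tuples Ns \<times> {..<dE}. l z * (- log 2 (l z) - Hl)\<^sup>2) / (n * \<delta>\<^sup>2)"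
        unfolding bw T_def
      proof (rule iid_chebyshev)
        show "(\<Sum>s\<in>?Z. \<Prod>t<n. g t (zz s t)) = (\<Prod>t<n. \<Sum>z\<in>tuples Ns \<times> {..<dE}. g t z)" for g :: "nat \<Rightarrow> nat list \<times> nat \<Rightarrow> real"
          unfolding zz_def by (rule sum_prod_letters_digit)
      qed (use letter_weight_sum_all[OF s] l0 zz_in Hl n \<delta> in auto)
      then show ?thesis by (simp add: V1_def mult.commute)
    qed
    have f_on: "ip {..<dE ^ n} (env_block_vec n f i) (env_block_vec n f j) = (if i = j then 1 else 0)" if "i \<in> J" "j \<in> J" for i j
      using that by (intro env_block_vec_orthonormal[OF f]) (auto simp: J_def)
    have resid: "(\<Sum>z\<in>?Z. block_weight n l z * (1 - (\<Sum>j\<in>J. (cmod (ip {..<dE ^ n} (env_block_vec n f j) (block_vec n e z)))\<^sup>2))) \<le> V2 / n"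
    proof -
      have "(\<Sum>z\<in>?Z. block_weight n l z * (1 - (\<Sum>j\<in>J. (cmod (ip {..<dE ^ n} (env_block_vec n f j) (block_vec n e z)))\<^sup>2)))
        = (\<Sum>z\<in>?Z. block_weight n l z) - (\<Sum>z\<in>?Z. \<Sum>j\<in>J. block_weight n l z * (cmod (ip {..<dE ^ n} (env_block_vec n f j) (block_vec n e z)))\<^sup>2)"
        by (simp only: right_diff_distrib mult_1_right sum_subtractf sum_distrib_left)
      also have "(\<Sum>z\<in>?Z. \<Sum>j\<in>J. block_weight n l z * (cmod (ip {..<dE ^ n} (env_block_vec n f j) (block_vec n e z)))\<^sup>2)
        = (\<Sum>j\<in>J. \<Sum>z\<in>?Z. block_weight n l z * (cmod (ip {..<dE ^ n} (env_block_vec n f j) (block_vec n e z)))\<^sup>2)"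
        by (rule sum.swap)
      also have "\<dots> = (\<Sum>j\<in>J. env_block_weight n \<mu> j)"
        by (rule sum.cong[OF refl], rule env_block_weight_eq[OF s f]) (simp add: J_def)
      \<comment> \<open>Both distributions have total mass 1, so the lost weight is the mass of the
        eigenvectors outside \<open>J\<close>.\<close>
      also have "(\<Sum>z\<in>?Z. block_weight n l z) - (\<Sum>j\<in>J. env_block_weight n \<mu> j) = (\<Sum>j\<in>{..<dE ^ n} - J. env_block_weight n \<mu> j)"
        unfolding lsum \<mu>sum[symmetric] by (subst sum_diff) (auto simp: J_def)
      also have "\<dots> \<le> (\<Sum>j\<in>{j\<in>{..<dE ^ n}. \<not> G j}. env_block_weight n \<mu> j)"
      proof -
        have "(\<Sum>j\<in>{..<dE ^ n} - J. env_block_weight n \<mu> j) = (\<Sum>j\<in>{j\<in>{..<dE ^ n}. \<not> G j \<and> env_block_weight n \<mu> j \<noteq> 0}. env_block_weight n \<mu> j)"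
          by (rule sum.mono_neutral_right) (auto simp: J_def)
        also have "\<dots> \<le> (\<Sum>j\<in>{j\<in>{..<dE ^ n}. \<not> G j}. env_block_weight n \<mu> j)"
          using ebw0 by (intro sum_mono2) auto
        finally show ?thesis .
      qed
      also have "\<dots> \<le> (\<Sum>j<dE. \<mu> j * (- log 2 (\<mu> j) - H\<mu>)\<^sup>2) / (n * \<delta>\<^sup>2)"
        unfolding env_block_weight_def G_def
      proof (rule iid_chebyshev)
        show "(\<Sum>b<dE ^ n. \<Prod>t<n. g t (digit dE n b t)) = (\<Prod>t<n. \<Sum>z<dE. g t z)" for g :: "nat \<Rightarrow> nat \<Rightarrow> real"
          by (rule sum_prod_digit)
      qed (use env_weight_sum[OF s f] \<mu>0 digit_less H\<mu> n \<delta> in auto)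
      finally show ?thesis by (simp add: V2_def mult.commute)
    qed
    have cardJ: "card J \<le> 2 powr (n * (H\<mu> + \<delta>))"
    proof -
      have "card J * 2 powr (- (n * (H\<mu> + \<delta>))) = (\<Sum>j\<in>J. 2 powr (- (n * (H\<mu> + \<delta>))))" by simp
      also have "\<dots> \<le> (\<Sum>j\<in>J. env_block_weight n \<mu> j)"
      proof (rule sum_mono)
        fix j assume j: "j \<in> J"
        then have jn: "j < dE ^ n" by (simp add: J_def)
        show "2 powr (- (n * (H\<mu> + \<delta>))) \<le> env_block_weight n \<mu> j"
          unfolding env_block_weight_def
          by (rule iid_typical_weight(1)[where q = \<mu>]) (use j \<mu>0 digit_less[OF jn] in \<open>auto simp: J_def G_def env_block_weight_def\<close>)
      qed
      also have "\<dots> \<le> (\<Sum>j<dE ^ n. env_block_weight n \<mu> j)"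
        using ebw0 by (intro sum_mono2) (auto simp: J_def)
      finally have "card J * 2 powr (- (n * (H\<mu> + \<delta>))) * 2 powr (n * (H\<mu> + \<delta>)) \<le> 1 * 2 powr (n * (H\<mu> + \<delta>))"
        unfolding \<mu>sum by (intro mult_right_mono) auto
      then show ?thesis by (simp add: mult.assoc powr_add[symmetric])
    qed
    have amplified: "\<exists>F\<in>PiE (blocks Ns n) (\<lambda>_. {..<\<kappa>}). key_insecurity_le \<kappa> Y {..<dE ^ n} (blocks Ns n \<times> {..<dE ^ n}) (block_weight n l) (block_vec n e)
        (\<lambda>z. h (fst z)) (\<lambda>z. F (fst z))
        (2 * (\<Sum>z\<in>{z\<in>?Z. \<not> T z}. block_weight n l z)
        + 4 * sqrt (\<Sum>z\<in>?Z. block_weight n l z * (1 - (\<Sum>j\<in>J. (cmod (ip {..<dE ^ n} (env_block_vec n f j) (block_vec n e z)))\<^sup>2)))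
        + sqrt (\<kappa> * card Y * card J * 2 powr (- (n * (Hl - \<delta>)))))"
      by (rule privacy_amplification[where X = "blocks Ns n" and I = "{..<dE ^ n}" and Y = Y and J = J and \<kappa> = \<kappa>
          and l = "block_weight n l" and Q = "{..<dE ^ n}" and e = "block_vec n e" and f = "env_block_vec n f" and h = h
          and T = T and \<tau> = "2 powr (- (real n * (Hl - \<delta>)))"])
        (use Y finJ \<kappa> block_weight_nonneg[OF s] lsum block_vec_orthonormal[OF s] f_on h T_le in auto)
    have "\<kappa> * card Y * card J * 2 powr (- (n * (Hl - \<delta>)))
       \<le> \<kappa> * card Y * 2 powr (n * (H\<mu> + \<delta>)) * 2 powr (- (n * (Hl - \<delta>)))"
      unfolding of_nat_mult using cardJ by (intro mult_right_mono mult_left_mono) simp_all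
    also have "\<dots> = \<kappa> * card Y * 2 powr (- (n * (Hl - H\<mu> - 2 * \<delta>)))"
      by (simp add: mult.assoc powr_add[symmetric]) (simp add: algebra_simps)
    finally have third: "sqrt (\<kappa> * card Y * card J * 2 powr (- (n * (Hl - \<delta>)))) \<le> sqrt (\<kappa> * card Y * 2 powr (- (n * (Hl - H\<mu> - 2 * \<delta>))))"
      by simp
    have second: "sqrt (\<Sum>z\<in>?Z. block_weight n l z * (1 - (\<Sum>j\<in>J. (cmod (ip {..<dE ^ n} (env_block_vec n f j) (block_vec n e z)))\<^sup>2))) \<le> sqrt (V2 / n)"
      using resid by simp
    have "2 * (\<Sum>z\<in>{z\<in>?Z. \<not> T z}. block_weight n l z)
      + 4 * sqrt (\<Sum>z\<in>?Z. block_weight n l z * (1 - (\<Sum>j\<in>J. (cmod (ip {..<dE ^ n} (env_block_vec n f j) (block_vec n e z)))\<^sup>2)))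
      + sqrt (\<kappa> * card Y * card J * 2 powr (- (n * (Hl - \<delta>))))
      \<le> 2 * (V1 / n) + 4 * sqrt (V2 / n) + sqrt (\<kappa> * card Y * 2 powr (- (n * (Hl - H\<mu> - 2 * \<delta>))))"
      using atyp second third by linarith
    with amplified show "\<exists>F\<in>PiE (blocks Ns n) (\<lambda>_. {..<\<kappa>}). key_insecurity_le \<kappa> Y {..<dE ^ n} (blocks Ns n \<times> {..<dE ^ n}) (block_weight n l) (block_vec n e)
        (\<lambda>z. h (fst z)) (\<lambda>z. F (fst z))
        (2 * (V1 / n) + 4 * sqrt (V2 / n) + sqrt (\<kappa> * card Y * 2 powr (- (n * (Hl - H\<mu> - 2 * \<delta>)))))"
      using key_insecurity_le_mono by blast
  qed
qed

text \<open>Bookkeeping of exponents: 3m\<delta> for the bin tuples, 2\<delta> for the two spectra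
  and one \<delta> kept as decay make up the \<open>3 * real m + 3\<close> in \<open>r\<close>.
  Rounding the numbers of bins up costs at most a factor 2 per player, hence \<open>2 ^ m\<close>;
  rounding the key size down only lowers the error.\<close>

lemma protocol_exists:
  assumes m: "2 \<le> m" and R: "R \<in> rate_region_CO m Ns prob" and \<delta>: "\<delta> > 0"
    and r: "r = cond_vn_XE ds dE \<rho> Ns M - (\<Sum>j<m. R j) - (3 * real m + 3) * \<delta>" and r0: "0 \<le> r"
  shows "\<exists>V0 V1 V2. \<forall>n\<ge>1. is_protocol ds dE \<rho> n (\<lambda>j. R j + 3 * \<delta> + 1)
    (V0 / n + 2 ^ m * 2 powr (- (n * \<delta>)) + (2 * (V1 / n) + 4 * sqrt (V2 / n) + sqrt (2 ^ m * 2 powr (- (n * \<delta>)))))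
    (nat \<lfloor>2 powr (n * r)\<rfloor>)"
proof -
  obtain l e where s: "letter_spectrum l e" using exists_letter_spectrum by blast
  obtain \<mu> f where f: "env_spectrum \<mu> f" using exists_env_spectrum by blast
  define Hl where "Hl = (\<Sum>z\<in>tuples Ns \<times> {..<dE}. l z * - log 2 (l z))"
  define H\<mu> where "H\<mu> = (\<Sum>j<dE. \<mu> j * - log 2 (\<mu> j))"
  have S: "cond_vn_XE ds dE \<rho> Ns M = Hl - H\<mu>" unfolding Hl_def H\<mu>_def by (rule cond_entropy_eq[OF s f])
  have R': "R \<in> rate_region_CO (length Ns) Ns prob" using R by (simp add: len_Ns)
  from slepian_wolf[OF prob_nonneg sum_joint_prob R' \<delta>] obtain V0 where
    SW: "\<forall>n\<ge>1. \<forall>L. (\<forall>j<m. 2 powr (real n * (R j + 3 * \<delta>)) \<le> real (L j)) \<longrightarrow>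
    (\<exists>h\<in>PiE {..<m} (\<lambda>j. PiE {..<(Ns ! j) ^ n} (\<lambda>_. {..<L j})). \<exists>T\<subseteq>blocks Ns n.
      (\<Sum>x\<in>decoding_failures m h T (blocks Ns n). \<Prod>t<n. prob (letters Ns n x t))
       \<le> V0 / n + 2 ^ m * 2 powr (- (n * \<delta>)))"
    unfolding len_Ns by (rule exE)
  from privacy_bound[where 'a = "nat list", OF s f \<delta> Hl_def H\<mu>_def] obtain V1 V2 where V: "0 \<le> V1" "0 \<le> V2" and
    PA: "\<forall>n\<ge>1. \<forall>\<kappa>\<ge>(1::nat). \<forall>(Y :: nat list set) h. finite Y \<longrightarrow> (\<forall>a\<in>blocks Ns n. h a \<in> Y) \<longrightarrow>
    (\<exists>F\<in>PiE (blocks Ns n) (\<lambda>_. {..<\<kappa>}). key_insecurity_le \<kappa> Y {..<dE ^ n} (blocks Ns n \<times> {..<dE ^ n}) (block_weight n l) (block_vec n e)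
        (\<lambda>z. h (fst z)) (\<lambda>z. F (fst z))
        (2 * (V1 / n) + 4 * sqrt (V2 / n) + sqrt (\<kappa> * card Y * 2 powr (- (n * (Hl - H\<mu> - 2 * \<delta>))))))"
    by (elim exE conjE)
  have R0: "0 \<le> R j + 3 * \<delta>" if "j < m" for j using rate_nonneg[OF m R that] \<delta> by simp
  show ?thesis
  proof (intro exI allI impI)
    fix n :: nat assume n: "1 \<le> n"
    define L where "L = (\<lambda>j. nat \<lceil>2 powr (real n * (R j + 3 * \<delta>))\<rceil>)"
    define Ls where "Ls = map L [0..<m]"
    define \<kappa> where "\<kappa> = nat \<lfloor>2 powr (real n * r)\<rfloor>"
    have L_ge: "2 powr (real n * (R j + 3 * \<delta>)) \<le> real (L j)" for j unfolding L_def by (rule real_nat_ceiling_ge)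
    \<comment> \<open>The exponent is nonnegative, so the 1 added by rounding up is at most the
      number itself.\<close>
    have L_le: "real (L j) \<le> 2 * 2 powr (real n * (R j + 3 * \<delta>))" if "j < m" for j
    proof -
      have "0 \<le> real n * (R j + 3 * \<delta>)" using R0[OF that] by simp
      then have "1 \<le> 2 powr (real n * (R j + 3 * \<delta>))" by (rule ge_one_powr_ge_zero[rotated]) simp
      moreover have "real (L j) \<le> 2 powr (real n * (R j + 3 * \<delta>)) + 1"
        unfolding L_def by (simp add: of_nat_ceiling)
      ultimately show ?thesis by linarith
    qed
    have \<kappa>1: "1 \<le> \<kappa>"
    proof -
      have "1 \<le> 2 powr (real n * r)" using r0 by (intro ge_one_powr_ge_zero) auto
      then show ?thesis unfolding \<kappa>_def by linarith
    qed
    have \<kappa>_le: "real \<kappa> \<le> 2 powr (real n * r)" unfolding \<kappa>_def by (simp add: of_nat_floor)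
    from SW[THEN spec, THEN mp, OF n, THEN spec[of _ L], THEN mp] L_ge obtain h T where
      h: "h \<in> PiE {..<m} (\<lambda>j. PiE {..<(Ns ! j) ^ n} (\<lambda>_. {..<L j}))" and T: "T \<subseteq> blocks Ns n" and
      bad: "(\<Sum>x\<in>decoding_failures m h T (blocks Ns n). \<Prod>t<n. prob (letters Ns n x t))
       \<le> V0 / n + 2 ^ m * 2 powr (- (n * \<delta>))" by blast
    have bad': "(\<Sum>x\<in>decoding_failures m h T (blocks Ns n). block_prob n x)
       \<le> V0 / n + 2 ^ m * 2 powr (- (n * \<delta>))"
      unfolding block_prob_def by (rule bad)
    have Ls_len: "length Ls = m" by (simp add: Ls_def)
    have Ls_nth: "Ls ! j = L j" if "j < m" for j using that by (simp add: Ls_def)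
    have h_lt: "h j b < Ls ! j" if "j < m" "b < (Ns ! j) ^ n" for j b
      using PiE_mem[OF h, of j] that by (auto simp: Ls_nth)
    have Y: "\<forall>a\<in>blocks Ns n. bins h a \<in> tuples Ls" by (intro ballI bins_in_tuples h_lt Ls_len)
    from PA[THEN spec, THEN mp, OF n, THEN spec, THEN mp, OF \<kappa>1, THEN spec, THEN spec, THEN mp, OF finite_tuples, THEN mp, OF Y] obtain F where F: "F \<in> PiE (blocks Ns n) (\<lambda>_. {..<\<kappa>})" and
      FW: "key_insecurity_le \<kappa> (tuples Ls) {..<dE ^ n} (blocks Ns n \<times> {..<dE ^ n}) (block_weight n l) (block_vec n e)
        (\<lambda>z. bins h (fst z)) (\<lambda>z. F (fst z))
        (2 * (V1 / n) + 4 * sqrt (V2 / n) + sqrt (\<kappa> * card (tuples Ls) * 2 powr (- (n * (Hl - H\<mu> - 2 * \<delta>)))))"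
      by (rule bexE)
    have "real (card (tuples Ls)) = (\<Prod>j<m. real (L j))"
      unfolding card_tuples Ls_def by (simp add: prod.distinct_set_conv_list[symmetric] atLeast0LessThan)
    also have "\<dots> \<le> (\<Prod>j<m. 2 * 2 powr (real n * (R j + 3 * \<delta>)))"
      using L_le by (intro prod_mono) auto
    also have "\<dots> = 2 ^ m * 2 powr (\<Sum>j<m. real n * (R j + 3 * \<delta>))"
      by (simp add: prod.distrib powr_sum)
    also have "(\<Sum>j<m. real n * (R j + 3 * \<delta>)) = real n * ((\<Sum>j<m. R j) + 3 * real m * \<delta>)"
      by (simp add: sum_distrib_left[symmetric] sum.distrib)
    finally have cardY: "real (card (tuples Ls)) \<le> 2 ^ m * 2 powr (real n * ((\<Sum>j<m. R j) + 3 * real m * \<delta>))" .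
    have "\<kappa> * card (tuples Ls) * 2 powr (- (n * (Hl - H\<mu> - 2 * \<delta>)))
      \<le> (2 powr (real n * r) * (2 ^ m * 2 powr (real n * ((\<Sum>j<m. R j) + 3 * real m * \<delta>)))) * 2 powr (- (n * (Hl - H\<mu> - 2 * \<delta>)))"
      unfolding of_nat_mult by (intro mult_right_mono mult_mono \<kappa>_le cardY) auto
    also have "\<dots> = 2 ^ m * 2 powr (real n * r + real n * ((\<Sum>j<m. R j) + 3 * real m * \<delta>) + (- (n * (Hl - H\<mu> - 2 * \<delta>))))"
      unfolding powr_add by (simp only: mult_ac)
    \<comment> \<open>The definition of \<open>r\<close> makes the key, the bins and the conditional
      entropy cancel up to one \<delta>.\<close>
    also have "real n * r + real n * ((\<Sum>j<m. R j) + 3 * real m * \<delta>) + (- (n * (Hl - H\<mu> - 2 * \<delta>))) = - (n * \<delta>)"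
      unfolding r S by (simp add: algebra_simps)
    finally have third: "sqrt (\<kappa> * card (tuples Ls) * 2 powr (- (n * (Hl - H\<mu> - 2 * \<delta>)))) \<le> sqrt (2 ^ m * 2 powr (- (n * \<delta>)))"
      by simp
    show "is_protocol ds dE \<rho> n (\<lambda>j. R j + 3 * \<delta> + 1)
      (V0 / n + 2 ^ m * 2 powr (- (n * \<delta>)) + (2 * (V1 / n) + 4 * sqrt (V2 / n) + sqrt (2 ^ m * 2 powr (- (n * \<delta>)))))
      (nat \<lfloor>2 powr (n * r)\<rfloor>)"
      unfolding \<kappa>_def[symmetric]
    proof (rule protocol_from_decoding[where T = T and h = h and F = F, OF _ \<kappa>1 Ls_len _ h_lt F T s bad'])
      show "1 \<le> m" using m by simp
      show "real (Ls ! j) \<le> 2 powr (real n * (R j + 3 * \<delta> + 1))" if j: "j < m" for j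
      proof -
        \<comment> \<open>The extra 1 in the public rate absorbs the rounding factor 2, as n is at
          least 1.\<close>
        have "real (L j) \<le> 2 powr (real n * (R j + 3 * \<delta>) + 1)" using L_le[OF j] by (simp add: powr_add)
        also have "\<dots> \<le> 2 powr (real n * (R j + 3 * \<delta> + 1))"
          using n by (intro powr_mono) (auto simp: algebra_simps)
        finally show ?thesis by (simp add: Ls_nth[OF j])
      qed
      show "0 \<le> 2 * (V1 / n) + 4 * sqrt (V2 / n) + sqrt (2 ^ m * 2 powr (- (n * \<delta>)))" using V by simp
      show "key_insecurity_le \<kappa> (tuples Ls) {..<dE ^ n} (blocks Ns n \<times> {..<dE ^ n}) (block_weight n l) (block_vec n e)
        (\<lambda>z. bins h (fst z)) (\<lambda>z. F (fst z))
        (2 * (V1 / n) + 4 * sqrt (V2 / n) + sqrt (2 ^ m * 2 powr (- (n * \<delta>))))"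
        by (rule key_insecurity_le_mono[OF FW]) (use third in linarith)
    qed
  qed
qed

lemma achievable_zero:
  assumes "1 \<le> m"
  shows "achievable_ni ds dE \<rho> 0"
  unfolding achievable_ni_def
  by (intro exI[of _ "\<lambda>_. 0"] exI[of _ "\<lambda>_. 1"] conjI allI trivial_protocol assms) auto

lemma achievable_rate:
  assumes m: "2 \<le> m" and R: "R \<in> rate_region_CO m Ns prob" and \<delta>: "\<delta> > 0"
    and r: "r = cond_vn_XE ds dE \<rho> Ns M - (\<Sum>j<m. R j) - (3 * real m + 3) * \<delta>" and r0: "0 \<le> r"
  shows "achievable_ni ds dE \<rho> r"
proof -
  from protocol_exists[OF m R \<delta> r r0] obtain V0 V1 V2 where
    prot: "\<forall>n\<ge>1. is_protocol ds dE \<rho> n (\<lambda>j. R j + 3 * \<delta> + 1)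
    (V0 / n + 2 ^ m * 2 powr (- (n * \<delta>)) + (2 * (V1 / n) + 4 * sqrt (V2 / n) + sqrt (2 ^ m * 2 powr (- (n * \<delta>)))))
    (nat \<lfloor>2 powr (n * r)\<rfloor>)" by (elim exE)
  \<comment> \<open>Indices beyond the players get rate 1 because \<open>trivial_protocol\<close>,
    used for zero copies, is stated for rates that are nonnegative everywhere.\<close>
  define Rs where "Rs = (\<lambda>j. if j < m then R j + 3 * \<delta> + 1 else 1)"
  define \<epsilon> where "\<epsilon> = (\<lambda>n. V0 / real n + 2 ^ m * 2 powr (- (real n * \<delta>)) + (2 * (V1 / real n) + 4 * sqrt (V2 / real n) + sqrt (2 ^ m * 2 powr (- (real n * \<delta>)))))"
  define \<kappa> where "\<kappa> = (\<lambda>n::nat. nat \<lfloor>2 powr (real n * r)\<rfloor>)"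
  have ge1: "1 \<le> 2 powr (real n * r)" for n using r0 by (intro ge_one_powr_ge_zero) auto
  have \<kappa>1: "1 \<le> \<kappa> n" for n using ge1[of n] unfolding \<kappa>_def by linarith
  have protocol: "is_protocol ds dE \<rho> n Rs (\<epsilon> n) (\<kappa> n)" for n
  \<comment> \<open>Achievability also asks for a protocol on zero copies. There the key size is 1
    and the quotients by n are 0, so the trivial protocol has the required error.\<close>
  proof (cases "n = 0")
    case True
    have "\<kappa> n = 1" by (simp add: \<kappa>_def True)
    moreover have "is_protocol ds dE \<rho> n Rs (\<epsilon> n) 1"
      using m rate_nonneg[OF m R] \<delta> by (intro trivial_protocol) (auto simp: Rs_def \<epsilon>_def True)
    ultimately show ?thesis by simp
  next
    case False
    then have "is_protocol ds dE \<rho> n (\<lambda>j. R j + 3 * \<delta> + 1) (\<epsilon> n) (\<kappa> n)"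
      unfolding \<epsilon>_def \<kappa>_def by (intro prot[THEN spec, THEN mp]) simp
    then show ?thesis unfolding is_protocol_def Let_def by (simp add: Rs_def cong: conj_cong)
  qed
  have exp0: "(\<lambda>n. 2 ^ m * 2 powr (- (real n * \<delta>))) \<longlonglongrightarrow> 0"
  proof -
    have "(\<lambda>n. 2 ^ m * (2 powr (- \<delta>)) ^ n) \<longlonglongrightarrow> 2 ^ m * 0"
      using \<delta> by (intro tendsto_mult tendsto_const LIMSEQ_realpow_zero) (auto simp: powr_less_one)
    then show ?thesis by (simp add: powr_realpow[symmetric] powr_powr mult.commute)
  qed
  have inv0: "(\<lambda>n. V / real n) \<longlonglongrightarrow> 0" for V :: real by (rule lim_const_over_n)
  have "\<epsilon> \<longlonglongrightarrow> 0 + 0 + (2 * 0 + 4 * sqrt 0 + sqrt 0)"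
    unfolding \<epsilon>_def by (intro tendsto_add tendsto_mult tendsto_const tendsto_real_sqrt inv0 exp0)
  then have \<epsilon>0: "\<epsilon> \<longlonglongrightarrow> 0" by simp
  have rate: "(\<lambda>n. log 2 (real (\<kappa> n)) / real n) \<longlonglongrightarrow> r"
  proof (rule tendsto_sandwich)
    show "eventually (\<lambda>n. r - 1 / real n \<le> log 2 (real (\<kappa> n)) / real n) sequentially"
    proof (rule eventually_mono[OF eventually_ge_at_top[of 1]])
      fix n :: nat assume n: "1 \<le> n"
      \<comment> \<open>Rounding down loses at most a factor 2 because the key size is at least 1,
        so the rate drops by at most 1/n.\<close>
      have "2 powr (real n * r) \<le> real (\<kappa> n) + 1" unfolding \<kappa>_def by linarith
      also have "\<dots> \<le> 2 * real (\<kappa> n)" using \<kappa>1[of n] by simp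
      finally have "2 powr (real n * r - 1) \<le> real (\<kappa> n)" by (simp add: powr_diff)
      then have "real n * r - 1 \<le> log 2 (real (\<kappa> n))" using \<kappa>1[of n] by (subst le_log_iff) auto
      then have "(real n * r - 1) / real n \<le> log 2 (real (\<kappa> n)) / real n" by (rule divide_right_mono) simp
      then show "r - 1 / real n \<le> log 2 (real (\<kappa> n)) / real n" using n by (simp add: diff_divide_distrib)
    qed
    show "eventually (\<lambda>n. log 2 (real (\<kappa> n)) / real n \<le> r) sequentially"
    proof (rule eventually_mono[OF eventually_ge_at_top[of 1]])
      fix n :: nat assume n: "1 \<le> n"
      have "real (\<kappa> n) \<le> 2 powr (real n * r)" unfolding \<kappa>_def by (simp add: of_nat_floor)
      then have "log 2 (real (\<kappa> n)) \<le> real n * r" using \<kappa>1[of n] by (subst log_le_iff) auto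
      then show "log 2 (real (\<kappa> n)) / real n \<le> r" using n by (simp add: field_simps)
    qed
    have "(\<lambda>n. r - 1 / real n) \<longlonglongrightarrow> r - 0" by (intro tendsto_diff tendsto_const inv0)
    then show "(\<lambda>n. r - 1 / real n) \<longlonglongrightarrow> r" by simp
  qed (rule tendsto_const)
  show ?thesis unfolding achievable_ni_def
    by (intro exI[of _ Rs] exI[of _ \<epsilon>] exI[of _ \<kappa>] conjI allI \<kappa>1 protocol \<epsilon>0 rate)
qed

text \<open>The infimum in \<open>R_CO\<close> is only approached and every achievable rate loses a
  multiple of \<delta>, so a target z strictly between the capacity and the claimed bound is
  refuted. Targets that are not positive are met by rate 0.\<close>

lemma capacity_lower_bound:
  assumes m: "2 \<le> m"
  shows "ereal (cond_vn_XE ds dE \<rho> Ns M - R_CO m Ns prob) \<le> K_ni ds dE \<rho>"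
proof (rule ccontr)
  define v where "v = cond_vn_XE ds dE \<rho> Ns M - R_CO m Ns prob"
  assume "\<not> ?thesis"
  then have "K_ni ds dE \<rho> < ereal v" by (simp add: v_def)
  then obtain z where z: "K_ni ds dE \<rho> < ereal z" "ereal z < ereal v" using ereal_dense2 by blast
  have "\<exists>r\<ge>z. achievable_ni ds dE \<rho> r"
  proof (cases "z \<le> 0")
    case True
    then show ?thesis using achievable_zero m by fastforce
  next
    case False
    \<comment> \<open>Half of the gap pays for a rate tuple near the infimum, the other half for the
      multiple of \<delta> lost in \<open>achievable_rate\<close>.\<close>
    define \<eta> where "\<eta> = (v - z) / 2"
    have \<eta>: "0 < \<eta>" using z(2) by (simp add: \<eta>_def)
    let ?S = "{\<Sum>j<m. R j |R. R \<in> rate_region_CO m Ns prob}"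
    have "?S \<noteq> {}" using rate_region_nonempty by blast
    moreover have "Inf ?S < R_CO m Ns prob + \<eta>" using \<eta> by (simp add: R_CO_def)
    ultimately obtain R where R: "R \<in> rate_region_CO m Ns prob" and sum: "(\<Sum>j<m. R j) < R_CO m Ns prob + \<eta>"
      using cInf_lessD[of ?S "R_CO m Ns prob + \<eta>"] by blast
    define \<delta> where "\<delta> = \<eta> / (3 * real m + 3)"
    have pos: "0 < 3 * real m + 3" by (simp add: add_nonneg_pos)
    have \<delta>: "0 < \<delta>" using \<eta> pos by (simp add: \<delta>_def)
    define r where "r = cond_vn_XE ds dE \<rho> Ns M - (\<Sum>j<m. R j) - (3 * real m + 3) * \<delta>"
    have "(3 * real m + 3) * \<delta> = \<eta>" using pos unfolding \<delta>_def by simp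
    then have "z \<le> r" using sum unfolding r_def by (simp add: \<eta>_def v_def field_simps)
    then show ?thesis using achievable_rate[OF m R \<delta> r_def] False by auto
  qed
  then obtain r where "z \<le> r" "achievable_ni ds dE \<rho> r" by blast
  then have "ereal z \<le> K_ni ds dE \<rho>" unfolding K_ni_def by (intro Sup_upper2[of "ereal r"]) auto
  then show False using z(1) by simp
qed

end

theorem theorem2:
  fixes ds :: "nat list" and dE :: nat and \<rho> :: "complex mat"
    and Ns :: "nat list" and M :: "nat \<Rightarrow> nat \<Rightarrow> complex mat"
  assumes "length ds \<ge> 2"
    and "density (prod_list ds * dE) \<rho>"
    and "length Ns = length ds"
    and "\<forall>j<length ds. povm (ds ! j) (Ns ! j) (M j)"
  shows "ereal (cond_vn_XE ds dE \<rho> Ns M - R_CO (length ds) Ns (joint_prob ds dE \<rho> M))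
           \<le> K_ni ds dE \<rho>"
proof -
  interpret measured_state ds dE \<rho> Ns M
    using assms by unfold_locales auto
  show ?thesis using assms(1) by (rule capacity_lower_bound)
qed

end
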